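(* Let $d>0$ be a fixed integer, let $x_1,\ldots,x_n$ be algebraically independent variables, each in filtration $d$, and let $r_1,\ldots,r_n$ be integers $\geq 2$, each possibly equal to $\infty$ (with the convention $x_i^\infty=0$). Then the filtered ring $\mathbf{Z}[[x_1,\ldots,x_n]]/(x_1^{r_1},\ldots,x_n^{r_n})$ admits uncountably many isomorphism classes of filtered $\lambda$-ring structures.
   Context: All rings are commutative with unit. A $\lambda$-ring means a (special) $\lambda$-ring in the sense of Atiyah–Tall: a ring with operations $\lambda^i$, $i\ge 0$, satisfying the usual axioms ($\lambda^0=1$, $\lambda^1=\mathrm{id}$, $\lambda^i(1)=0$ for $i>1$, and the universal sum, product and composition formulas). A filtered ring is a ring $R$ with a decreasing sequence of ideals $R=I^0\supseteq I^1\supseteq I^2\supseteq\cdots$; a filtered $\lambda$-ring is a $\lambda$-ring which is a filtered ring with each $I^k$ closed under $\lambda^i$ for $i\ge1$. A morphism of filtered $\lambda$-rings is a $\lambda$-ring map preserving the filtration ideals. A filtered $\lambda$-ring structure on a given filtered ring is a $\lambda$-ring structure making it a filtered $\lambda$-ring; two such are isomorphic if there is a filtered $\lambda$-ring isomorphism between them. The filtration on $\mathbf{Z}[[x_1,\ldots,x_n]]/(x_1^{r_1},\ldots,x_n^{r_n})$ with each $x_i$ in filtration $d$ is the one in which $I^k$ consists of the (possibly infinite) sums of monomials $x_1^{e_1}\cdots x_n^{e_n}$ with $d(e_1+\cdots+e_n)\ge k$. *)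

theory Defs
  imports "HOL-Library.Poly_Mapping" "HOL-Library.Extended_Nat" "HOL-Library.Countable_Set"
          "HOL-Algebra.QuotRing"
begin

type_synonym ipoly = "(nat \<Rightarrow>\<^sub>0 nat) \<Rightarrow>\<^sub>0 int"

definition pvar :: "nat \<Rightarrow> ipoly" where
  "pvar i = Poly_Mapping.single (Poly_Mapping.single i 1) 1"

definition pvars :: "ipoly \<Rightarrow> nat set" where
  "pvars p = (\<Union>m\<in>Poly_Mapping.keys p. Poly_Mapping.keys m)"

definition esym :: "nat set \<Rightarrow> nat \<Rightarrow> ipoly" where
  "esym V j = (\<Sum>S\<in>{S. S \<subseteq> V \<and> card S = j}. \<Prod>i\<in>S. pvar i)"

definition psubst :: "(nat \<Rightarrow> ipoly) \<Rightarrow> ipoly \<Rightarrow> ipoly" where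
  "psubst v p = (\<Sum>m\<in>Poly_Mapping.keys p. of_int (Poly_Mapping.lookup p m) * (\<Prod>i\<in>Poly_Mapping.keys m. v i ^ Poly_Mapping.lookup m i))"

definition ring_peval :: "('a, 'b) ring_scheme \<Rightarrow> (nat \<Rightarrow> 'a) \<Rightarrow> ipoly \<Rightarrow> 'a" where
  "ring_peval R v p =
     finsum R (\<lambda>m. add_pow R (Poly_Mapping.lookup p m) \<one>\<^bsub>R\<^esub> \<otimes>\<^bsub>R\<^esub>
                     finprod R (\<lambda>i. v i [^]\<^bsub>R\<^esub> Poly_Mapping.lookup m i) (Poly_Mapping.keys m)) (Poly_Mapping.keys p)"

text \<open>Universal product polynomial P_k: coefficient of t^k in the product over i,j < k of
  (1 + xi_i eta_j t), where xi_i = variable i and eta_j = variable k+j, written as the unique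
  polynomial in s_1..s_k (variables 0..k-1) and sigma_1..sigma_k (variables k..2k-1), where
  s_j, sigma_j are the elementary symmetric functions of the xi's resp. eta's.\<close>
definition lam_prod_coeff :: "nat \<Rightarrow> ipoly" where
  "lam_prod_coeff k =
     (\<Sum>S\<in>{S. S \<subseteq> {0..<k} \<times> {0..<k} \<and> card S = k}. \<Prod>(i,j)\<in>S. pvar i * pvar (k + j))"

definition lam_P :: "nat \<Rightarrow> ipoly" where
  "lam_P k = (THE Q. pvars Q \<subseteq> {0..<2*k} \<and>
      psubst (\<lambda>i. if i < k then esym {0..<k} (i + 1) else esym {k..<2*k} (i - k + 1)) Q
        = lam_prod_coeff k)"

text \<open>Universal composition polynomial P_{m,n}: coefficient of t^m in the product over all
  n-element subsets S of {0..<mn} of (1 + (prod_{i in S} xi_i) t), written as the unique polynomial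
  in s_1..s_{mn} (variables 0..mn-1), the elementary symmetric functions of xi_0..xi_{mn-1}.\<close>
definition lam_comp_coeff :: "nat \<Rightarrow> nat \<Rightarrow> ipoly" where
  "lam_comp_coeff m n =
     (\<Sum>F\<in>{F. F \<subseteq> {S. S \<subseteq> {0..<m*n} \<and> card S = n} \<and> card F = m}. \<Prod>S\<in>F. \<Prod>i\<in>S. pvar i)"

definition lam_PP :: "nat \<Rightarrow> nat \<Rightarrow> ipoly" where
  "lam_PP m n = (THE Q. pvars Q \<subseteq> {0..<m*n} \<and>
      psubst (\<lambda>i. esym {0..<m*n} (i + 1)) Q = lam_comp_coeff m n)"

section \<open>(Special) lambda-rings in the sense of Atiyah--Tall\<close>

definition lambda_ring :: "('a, 'b) ring_scheme \<Rightarrow> (nat \<Rightarrow> 'a \<Rightarrow> 'a) \<Rightarrow> bool" where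
  "lambda_ring R lam \<longleftrightarrow> cring R \<and>
    (\<forall>i. \<forall>x\<in>carrier R. lam i x \<in> carrier R) \<and>
    (\<forall>x\<in>carrier R. lam 0 x = \<one>\<^bsub>R\<^esub>) \<and>
    (\<forall>x\<in>carrier R. lam 1 x = x) \<and>
    (\<forall>i>1. lam i \<one>\<^bsub>R\<^esub> = \<zero>\<^bsub>R\<^esub>) \<and>
    (\<forall>k. \<forall>x\<in>carrier R. \<forall>y\<in>carrier R.
        lam k (x \<oplus>\<^bsub>R\<^esub> y) = finsum R (\<lambda>i. lam i x \<otimes>\<^bsub>R\<^esub> lam (k - i) y) {0..k}) \<and>
    (\<forall>k\<ge>1. \<forall>x\<in>carrier R. \<forall>y\<in>carrier R.
        lam k (x \<otimes>\<^bsub>R\<^esub> y) =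
          ring_peval R (\<lambda>i. if i < k then lam (i + 1) x else lam (i - k + 1) y) (lam_P k)) \<and>
    (\<forall>m\<ge>1. \<forall>n\<ge>1. \<forall>x\<in>carrier R.
        lam m (lam n x) = ring_peval R (\<lambda>i. lam (i + 1) x) (lam_PP m n))"

definition filtered_lambda_structure ::
  "('a, 'b) ring_scheme \<Rightarrow> (nat \<Rightarrow> 'a set) \<Rightarrow> (nat \<Rightarrow> 'a \<Rightarrow> 'a) \<Rightarrow> bool" where
  "filtered_lambda_structure R I lam \<longleftrightarrow> lambda_ring R lam \<and>
     (\<forall>k i. i \<ge> 1 \<longrightarrow> (\<forall>x\<in>I k. lam i x \<in> I k))"

text \<open>Isomorphism of two filtered lambda-ring structures on the same filtered ring: a ring
  isomorphism commuting with the lambda-operations and mapping each filtration ideal onto itself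
  (so that it and its inverse are filtered lambda-ring maps).\<close>
definition filtered_lambda_iso ::
  "('a, 'b) ring_scheme \<Rightarrow> (nat \<Rightarrow> 'a set) \<Rightarrow> (nat \<Rightarrow> 'a \<Rightarrow> 'a) \<Rightarrow> (nat \<Rightarrow> 'a \<Rightarrow> 'a) \<Rightarrow> bool" where
  "filtered_lambda_iso R I lam1 lam2 \<longleftrightarrow>
     (\<exists>\<phi>. \<phi> \<in> ring_iso R R \<and> (\<forall>k. \<phi> ` I k = I k) \<and>
          (\<forall>i. \<forall>x\<in>carrier R. \<phi> (lam1 i x) = lam2 i (\<phi> x)))"

definition trunc_exps :: "nat \<Rightarrow> (nat \<Rightarrow> enat) \<Rightarrow> (nat \<Rightarrow> nat) set" where
  "trunc_exps n r = {e. (\<forall>i\<ge>n. e i = 0) \<and> (\<forall>i<n. enat (e i) < r i)}"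

text \<open>Elements are coefficient functions on exponent vectors (arbitrary, i.e. power series),
  vanishing off the admissible exponents.\<close>
definition trunc_ring :: "nat \<Rightarrow> (nat \<Rightarrow> enat) \<Rightarrow> ((nat \<Rightarrow> nat) \<Rightarrow> int) ring" where
  "trunc_ring n r =
    \<lparr>carrier = {f. \<forall>e. e \<notin> trunc_exps n r \<longrightarrow> f e = 0},
     mult = (\<lambda>f g e. if e \<in> trunc_exps n r
                      then (\<Sum>a\<in>{a. \<forall>i. a i \<le> e i}. f a * g (\<lambda>i. e i - a i)) else 0),
     one = (\<lambda>e. if e = (\<lambda>i. 0) then 1 else 0),
     zero = (\<lambda>e. 0),
     add = (\<lambda>f g e. f e + g e)\<rparr>"

definition trunc_filt :: "nat \<Rightarrow> (nat \<Rightarrow> enat) \<Rightarrow> nat \<Rightarrow> nat \<Rightarrow> ((nat \<Rightarrow> nat) \<Rightarrow> int) set" where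
  "trunc_filt n r d k =
     {f \<in> carrier (trunc_ring n r). \<forall>e. f e \<noteq> 0 \<longrightarrow> k \<le> d * (\<Sum>i<n. e i)}"

end

theory Submission
  imports Defs "HOL-Computational_Algebra.Formal_Power_Series"
begin

text \<open>
  Let \<open>\<epsilon>\<close> be a completely multiplicative function with values \<open>1\<close> and \<open>-1\<close>, prescribed arbitrarily on the
  primes, and put \<open>l(x) = \<Sum>n. \<epsilon>(n) x^n / n\<close>. By the functional equation lemma the series
  \<open>u\<^sub>m = l\<^sup>-\<^sup>1(\<epsilon>(m) m l(x))\<close> have integral coefficients, and \<open>u\<^sub>p\<close> is congruent to \<open>x^p\<close> modulo \<open>p\<close> for
  every prime \<open>p\<close>; moreover \<open>u\<^sub>m \<circ> u\<^sub>n = u\<^sub>m\<^sub>n\<close>. Substituting \<open>u\<^sub>m(x\<^sub>i)\<close> for every \<open>x\<^sub>i\<close> therefore gives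
  commuting Frobenius lifts, that is, Adams operations. Newton's identities turn them into operations
  \<open>\<lambda>\<^sup>k\<close>, integral by Dwork's lemma on ghost components. The operations descend to every truncation,
  since they respect the vanishing of coefficients on a downward closed set of exponents. Modulo
  filtration \<open>d + 1\<close>, the operation \<open>\<lambda>\<^sup>p\<close> acts on filtration \<open>d\<close> as the scalar \<open>(-1)^(p-1) \<epsilon>(p)\<close>. The
  isomorphism class therefore determines the sign at every prime.

  The product and composition axioms involve the universal polynomials of \<^const>\<open>lam_P\<close> and
  \<^const>\<open>lam_PP\<close>. These are identified through power sums with rational coefficients. Because elementary
  symmetric polynomials have distinct monic leading monomials, a polynomial in them whose value is
  divisible by an integer \<open>M\<close> is itself divisible by \<open>M\<close>; this gives both integrality (clearing
  denominators) and uniqueness (\<open>M = 0\<close>).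
\<close>

subsection \<open>Congruences modulo integers in commutative rings\<close>

text \<open>For \<epsilon> = 1 the series l is -log(1 - x) and u_m = 1 - (1 - x)^m, the classical
  Adams operation on 1 - L for a line element L. In general u_m is the endomorphism with linear
  coefficient \<epsilon>(m) m of the formal group with logarithm l. Complete multiplicativity makes
  the terms of l with index divisible by a prime q add up to (\<epsilon>(q)/q) l(x^q), which is the
  functional equation behind integrality. The condition \<epsilon>(q)^2 = 1 makes \<epsilon>(q) q
  l(x) congruent to l(x^q) modulo q, which forces the Frobenius congruence for u_q. An isomorphism
  may mix the variables linearly in lowest degree, so the invariant must survive a linear change of
  coordinates; a scalar does. The universal polynomials are given by definite descriptions in formal
  roots, while a ring element x has no roots to compute with. Only the power sums have counterparts,
  the \<psi>_i x, and passing from them back to elementary symmetric functions introduces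
  denominators; this is why polynomial relations are first carried with a denominator.\<close>

lemma of_nat_dvd_of_nat:
  assumes "m dvd n"
  shows "(of_nat m :: 'a::comm_ring_1) dvd of_nat n"
  using assms by (auto elim!: dvdE)

text \<open>Each p-th power gains one factor p: with a and b congruent modulo p, the cofactor of a -
  b in a^p - b^p is a sum of p terms, each congruent to b^(p-1), hence divisible by p.\<close>

lemma dvd_diff_power_prime_power:
  fixes x y :: "'a::comm_ring_1"
  assumes "of_nat p dvd x - y"
  shows "of_nat (p ^ Suc k) dvd x ^ (p ^ k) - y ^ (p ^ k)"
proof (induction k)
  case 0
  then show ?case using assms by simp
next
  case (Suc k)
  define a b where "a = x ^ (p ^ k)" and "b = y ^ (p ^ k)"
  show ?case
  proof (cases p)
    case 0
    then show ?thesis using assms by (cases k) auto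
  next
    case (Suc n)
    have ab: "of_nat p dvd a - b"
      using Suc.IH unfolding a_def b_def by (metis dvd_trans dvd_triv_left of_nat_mult power_Suc)
    have "of_nat p dvd (\<Sum>i<p. a ^ i * b ^ (n - i) - b ^ n)"
    proof (rule dvd_sum)
      fix i assume "i \<in> {..<p}"
      hence "a ^ i * b ^ (n - i) - b ^ n = (a ^ i - b ^ i) * b ^ (n - i)"
        using Suc by (simp add: algebra_simps flip: power_add)
      moreover have "a - b dvd a ^ i - b ^ i"
        by (simp add: power_diff_sumr2)
      ultimately show "of_nat p dvd a ^ i * b ^ (n - i) - b ^ n"
        using ab by (metis dvd_mult2 dvd_trans)
    qed
    moreover have "(\<Sum>i<p. a ^ i * b ^ (n - i) - b ^ n) = (\<Sum>i<p. a ^ i * b ^ (n - i)) - of_nat p * b ^ n"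
      by (simp add: sum_subtractf)
    ultimately have "of_nat p dvd (\<Sum>i<p. a ^ i * b ^ (n - i))"
      by (metis dvd_triv_left dvd_diff_right_iff dvd_diff_left_iff)
    hence "of_nat (p ^ Suc k) * of_nat p dvd (a - b) * (\<Sum>i<p. a ^ i * b ^ (n - i))"
      using Suc.IH unfolding a_def b_def by (rule mult_dvd_mono[rotated])
    moreover have "a ^ p - b ^ p = (a - b) * (\<Sum>i<p. a ^ i * b ^ (n - i))"
      unfolding Suc by (rule diff_power_eq_sum)
    moreover have "x ^ (p ^ Suc k) = a ^ p" "y ^ (p ^ Suc k) = b ^ p"
      by (simp_all add: a_def b_def flip: power_mult, simp_all add: mult.commute)
    ultimately show ?thesis by (simp add: mult_ac)
  qed
qed

lemma dvd_diff_power_prime_power_mult: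
  fixes x y :: "'a::comm_ring_1"
  assumes "of_nat p dvd x - y"
  shows "of_nat (p ^ Suc k) dvd x ^ (p ^ k * m) - y ^ (p ^ k * m)"
proof -
  have "x ^ (p ^ k) - y ^ (p ^ k) dvd (x ^ (p ^ k)) ^ m - (y ^ (p ^ k)) ^ m"
    by (simp only: power_diff_sumr2 dvd_triv_left)
  thus ?thesis using dvd_diff_power_prime_power[OF assms, of k] unfolding power_mult by (rule dvd_trans[rotated])
qed

section \<open>Additivity of the p-th power modulo p, and divisibility tested on prime
  powers\<close>

lemma prime_dvd_frobenius_add:
  fixes x y :: "'a::comm_ring_1"
  assumes "prime p"
  shows "of_nat p dvd (x + y) ^ p - (x ^ p + y ^ p)"
proof -
  have p: "p > 1" using assms by (rule prime_gt_1_nat)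
  have "(x + y) ^ p = (\<Sum>k\<in>{0<..<p} \<union> {0, p}. of_nat (p choose k) * x ^ k * y ^ (p - k))"
    unfolding binomial_ring using p by (intro sum.cong) auto
  also have "\<dots> = (\<Sum>k\<in>{0<..<p}. of_nat (p choose k) * x ^ k * y ^ (p - k)) + (x ^ p + y ^ p)"
    using p by (subst sum.union_disjoint) (auto simp: add_ac)
  finally have "(x + y) ^ p - (x ^ p + y ^ p) = (\<Sum>k\<in>{0<..<p}. of_nat (p choose k) * x ^ k * y ^ (p - k))"
    by simp
  also have "of_nat p dvd \<dots>"
  proof (rule dvd_sum)
    fix k assume "k \<in> {0<..<p}"
    hence "p dvd p choose k" using assms by (intro dvd_choose_prime) auto
    thus "of_nat p dvd of_nat (p choose k) * x ^ k * y ^ (p - k)"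
      by (metis dvd_mult2 of_nat_dvd_of_nat)
  qed
  finally show ?thesis .
qed

lemma prime_dvd_frobenius_sum:
  fixes f :: "'b \<Rightarrow> 'a::comm_ring_1"
  assumes "prime p"
  shows "of_nat p dvd (\<Sum>i\<in>I. f i) ^ p - (\<Sum>i\<in>I. f i ^ p)"
proof (induction I rule: infinite_finite_induct)
  case (insert i I)
  have "(\<Sum>i\<in>insert i I. f i) ^ p - (\<Sum>i\<in>insert i I. f i ^ p) =
        ((f i + sum f I) ^ p - (f i ^ p + sum f I ^ p)) + (sum f I ^ p - (\<Sum>i\<in>I. f i ^ p))"
    using insert.hyps by simp
  thus ?case using insert.IH prime_dvd_frobenius_add[OF assms] by (metis dvd_add)
qed (use prime_gt_0_nat[OF assms] in \<open>auto simp: zero_power\<close>)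

text \<open>Write n = p^k m with p not dividing m. By Bezout z is an integral combination of p^k z
  and m z, and n divides both: m divides z by induction, p^k divides z by hypothesis. No
  factorization theory of the ring enters.\<close>

lemma of_nat_dvd_by_prime_powers:
  fixes z :: "'a::comm_ring_1"
  assumes "n > 0" "\<And>p k. prime p \<Longrightarrow> p ^ k dvd n \<Longrightarrow> of_nat (p ^ k) dvd z"
  shows "of_nat n dvd z"
  using assms
proof (induction n rule: less_induct)
  case (less n)
  show ?case
  proof (cases "n = 1")
    case False
    then obtain p where p: "prime p" "p dvd n" using prime_factor_nat by blast
    define k where "k = multiplicity p n"
    obtain m where m: "n = p ^ k * m" "\<not> p dvd m"
      using multiplicity_decompose'[of n p] less.prems(1) p(1) unfolding k_def
      by (metis not_prime_unit not_gr0)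
    have k: "k > 0" using p less.prems(1) by (simp add: k_def prime_multiplicity_gt_zero_iff)
    have pk: "p ^ k > 1" using k prime_gt_1_nat[OF p(1)] by (intro one_less_power)
    have "m > 0" using m(1) less.prems(1) by (cases m) auto
    hence "m < n" unfolding m(1) using pk n_less_m_mult_n[of m "p ^ k"] by linarith
    have 1: "of_nat m dvd z"
    proof (rule less.IH[OF \<open>m < n\<close> \<open>m > 0\<close>])
      fix q j assume "prime q" "q ^ j dvd m"
      thus "of_nat (q ^ j) dvd z" using less.prems(2)[of q j] unfolding m(1) by (metis dvd_mult)
    qed
    have 2: "of_nat (p ^ k) dvd z" using less.prems(2)[OF p(1), of k] m(1) by simp
    have "coprime (p ^ k) m" using p(1) m(2) by (simp add: prime_imp_coprime)
    hence "coprime (int (p ^ k)) (int m)" by simp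
    then obtain u v where "u * int (p ^ k) + v * int m = 1"
      by (metis bezout_int coprime_iff_gcd_eq_1)
    hence "z = of_int (u * int (p ^ k) + v * int m) * z" by (simp only: of_int_1 mult_1)
    also have "\<dots> = of_int u * (of_nat (p ^ k) * z) + of_int v * (of_nat m * z)"
      by (simp only: of_int_add of_int_mult of_int_of_nat_eq distrib_right mult.assoc)
    finally have "z = of_int u * (of_nat (p ^ k) * z) + of_int v * (of_nat m * z)" .
    moreover have "of_nat n dvd of_nat (p ^ k) * z"
      unfolding m(1) of_nat_mult by (rule mult_dvd_mono[OF dvd_refl 1])
    moreover have "of_nat n dvd of_nat m * z"
      unfolding m(1) of_nat_mult mult.commute[of _ "of_nat m"] by (rule mult_dvd_mono[OF dvd_refl 2])
    ultimately show ?thesis by (metis dvd_add dvd_mult)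
  qed auto
qed

subsection \<open>Newton's identities\<close>

text \<open>Quotients by positive integers need not exist but are unique, which is what makes
  Newton's identities determine the elementary symmetric side. As a class it is shared by integers,
  integral polynomials and power series.\<close>

class torsion_free_ring = comm_ring_1 +
  assumes of_nat_mult_eq_0: "of_nat n * x = 0 \<Longrightarrow> n = 0 \<or> x = 0"

lemma (in torsion_free_ring) of_nat_mult_cancel:
  assumes "of_nat n * x = of_nat n * y" "n > 0"
  shows "x = y"
  using of_nat_mult_eq_0[of n "x - y"] assms by (simp add: right_diff_distrib)

text \<open>For power sums \<open>p i\<close> of elements z_a this is the sum of z_a / (1 + z_a t),
  the logarithmic derivative of the product of the 1 + z_a t. Only \<open>p 1\<close>,
  \<open>p 2\<close>, ... enter.\<close>

definition newton_log :: "(nat \<Rightarrow> 'a::comm_ring_1) \<Rightarrow> 'a fps" where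
  "newton_log p = Abs_fps (\<lambda>k. (-1) ^ k * p (Suc k))"

text \<open>The sequence \<open>p\<close> plays the role of the power sums, the coefficients of \<open>E\<close> that of the
  elementary symmetric functions.\<close>
definition newton :: "(nat \<Rightarrow> 'a::comm_ring_1) \<Rightarrow> 'a fps \<Rightarrow> bool" where
  "newton p E \<longleftrightarrow> fps_nth E 0 = 1 \<and> fps_deriv E = E * newton_log p"

lemma newton_iff:
  "newton p E \<longleftrightarrow> fps_nth E 0 = 1 \<and>
     (\<forall>k. of_nat (Suc k) * fps_nth E (Suc k) = (\<Sum>i\<le>k. fps_nth E i * ((-1) ^ (k - i) * p (Suc (k - i)))))"
  by (simp add: newton_def fps_eq_iff newton_log_def fps_mult_nth atLeast0AtMost)

lemma newton_0: "newton p E \<Longrightarrow> fps_nth E 0 = 1"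
  by (simp add: newton_def)

lemma newton_rec:
  "newton p E \<Longrightarrow> of_nat (Suc k) * fps_nth E (Suc k) =
     (\<Sum>i\<le>k. fps_nth E i * ((-1) ^ (k - i) * p (Suc (k - i))))"
  by (simp only: newton_iff)

lemma newton_1: "newton p E \<Longrightarrow> fps_nth E 1 = p 1"
  using newton_rec[of p E 0] newton_0[of p E] by simp

lemma newton_mult:
  assumes "newton p E" "newton q F"
  shows "newton (\<lambda>i. p i + q i) (E * F)"
proof -
  have "newton_log (\<lambda>i. p i + q i) = newton_log p + newton_log q"
    by (simp add: newton_log_def fps_eq_iff algebra_simps)
  thus ?thesis using assms by (simp add: newton_def algebra_simps)
qed

lemma newton_cong:
  assumes "newton p E" "\<And>i. i \<ge> 1 \<Longrightarrow> p i = q i"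
  shows "newton q E"
proof -
  have "newton_log p = newton_log q" using assms(2) by (simp add: newton_log_def)
  thus ?thesis using assms(1) by (simp add: newton_def)
qed

lemma newton_zero: "newton (\<lambda>i. 0) 1"
  by (simp add: newton_def newton_log_def fps_eq_iff)

lemma newton_linear: "newton (\<lambda>i. z ^ i) (1 + fps_const z * fps_X)"
proof -
  have "fps_const z = (1 + fps_const z * fps_X) * newton_log (\<lambda>i. z ^ i)"
  proof (rule fps_ext)
    fix n
    show "fps_nth (fps_const z) n = fps_nth ((1 + fps_const z * fps_X) * newton_log (\<lambda>i. z ^ i)) n"
      by (cases n) (simp_all add: newton_log_def algebra_simps)
  qed
  thus ?thesis by (simp add: newton_def)
qed

lemma newton_prod:
  "newton (\<lambda>i. \<Sum>a\<in>A. p a i) (\<Prod>a\<in>A. E a)" if "\<And>a. a \<in> A \<Longrightarrow> newton (p a) (E a)"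
  using that
proof (induction A rule: infinite_finite_induct)
  case (insert a A)
  thus ?case by (simp add: newton_mult)
qed (simp_all add: newton_zero)

text \<open>The generating series is the product of the factors 1 + z_a t expanded over subsets, and
  logarithmic derivatives of factors add. The index set is arbitrary so that the z_a may themselves
  be products over pairs or over subsets of variables.\<close>

lemma newton_elementary_symmetric:
  assumes "finite A"
  shows "newton (\<lambda>i. \<Sum>a\<in>A. z a ^ i) (Abs_fps (\<lambda>k. \<Sum>S | S \<subseteq> A \<and> card S = k. \<Prod>a\<in>S. z a))"
proof -
  have "(\<Prod>a\<in>A. 1 + fps_const (z a) * fps_X) = (\<Sum>S\<in>Pow A. fps_const (\<Prod>a\<in>S. z a) * fps_X ^ card S)"
    (is "?E = _")
  proof -
    have "?E = (\<Sum>S\<in>Pow A. \<Prod>a\<in>S. fps_const (z a) * fps_X)"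
      using prod_add[OF assms, of "\<lambda>a. fps_const (z a) * fps_X" "\<lambda>a. 1"] by (simp add: add.commute)
    also have "\<dots> = (\<Sum>S\<in>Pow A. fps_const (\<Prod>a\<in>S. z a) * fps_X ^ card S)"
    proof (intro sum.cong refl)
      fix S
      have "(\<Prod>a\<in>S. fps_const (z a)) = fps_const (\<Prod>a\<in>S. z a)"
        by (induction S rule: infinite_finite_induct) simp_all
      thus "(\<Prod>a\<in>S. fps_const (z a) * fps_X) = fps_const (\<Prod>a\<in>S. z a) * fps_X ^ card S"
        by (simp add: prod.distrib)
    qed
    finally show ?thesis .
  qed
  also have "\<dots> = Abs_fps (\<lambda>k. \<Sum>S | S \<subseteq> A \<and> card S = k. \<Prod>a\<in>S. z a)"
  proof (rule fps_ext)
    fix k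
    have "fps_nth (\<Sum>S\<in>Pow A. fps_const (\<Prod>a\<in>S. z a) * fps_X ^ card S) k =
          (\<Sum>S\<in>Pow A. if card S = k then \<Prod>a\<in>S. z a else 0)"
      by (auto simp: fps_sum_nth intro!: sum.cong)
    also have "\<dots> = (\<Sum>S\<in>{S\<in>Pow A. card S = k}. \<Prod>a\<in>S. z a)"
      using assms by (subst sum.inter_filter) auto
    finally show "fps_nth (\<Sum>S\<in>Pow A. fps_const (\<Prod>a\<in>S. z a) * fps_X ^ card S) k =
      fps_nth (Abs_fps (\<lambda>k. \<Sum>S | S \<subseteq> A \<and> card S = k. \<Prod>a\<in>S. z a)) k"
      by (simp add: Collect_conj_eq Pow_def)
  qed
  finally show ?thesis
    using newton_prod[of A "\<lambda>a i. z a ^ i" "\<lambda>a. 1 + fps_const (z a) * fps_X"] newton_linear by metis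
qed

lemma newton_hom:
  fixes h :: "'a::comm_ring_1 \<Rightarrow> 'b::comm_ring_1"
  assumes "newton p E" and add: "\<And>x y. h (x + y) = h x + h y"
    and mult: "\<And>x y. h (x * y) = h x * h y" and one: "h 1 = 1"
  shows "newton (\<lambda>i. h (p i)) (Abs_fps (\<lambda>k. h (fps_nth E k)))"
proof -
  have zero: "h 0 = 0" using add[of 0 0] by simp
  have minus: "h (- x) = - h x" for x using add[of x "-x"] zero by (simp add: add_eq_0_iff)
  have sum: "h (\<Sum>i\<in>A. f i) = (\<Sum>i\<in>A. h (f i))" for f :: "nat \<Rightarrow> 'a" and A
    by (induction A rule: infinite_finite_induct) (simp_all add: zero add)
  have sgn: "h ((-1) ^ k) = (-1) ^ k" for k
    by (induction k) (simp_all add: one mult minus)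
  have nat: "h (of_nat k) = of_nat k" for k
    by (induction k) (simp_all add: zero one add)
  have "of_nat (Suc k) * h (fps_nth E (Suc k)) =
     (\<Sum>i\<le>k. h (fps_nth E i) * ((-1) ^ (k - i) * h (p (Suc (k - i)))))" for k
    using arg_cong[OF newton_rec[OF assms(1), of k], of h] by (simp only: mult sum sgn nat)
  thus ?thesis using newton_0[OF assms(1)] one by (simp only: newton_iff fps_nth_Abs_fps) auto
qed

text \<open>The recursion gives k E_k from earlier terms, so the ideal must allow cancelling
  positive integers. The zero ideal yields uniqueness of E; the ideal of series vanishing on all
  exponents below a given one yields compatibility with truncation.\<close>

lemma newton_cong_ideal:
  fixes I :: "'a::comm_ring_1 set"
  assumes "newton p E" "newton q F"
    and zero: "0 \<in> I" and add: "\<And>x y. x \<in> I \<Longrightarrow> y \<in> I \<Longrightarrow> x + y \<in> I"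
    and mult: "\<And>x y. y \<in> I \<Longrightarrow> x * y \<in> I"
    and sat: "\<And>k x. of_nat (Suc k) * x \<in> I \<Longrightarrow> x \<in> I"
    and pq: "\<And>i. i \<ge> 1 \<Longrightarrow> p i - q i \<in> I"
  shows "fps_nth E k - fps_nth F k \<in> I"
proof (induction k rule: less_induct)
  case (less k)
  show ?case
  proof (cases k)
    case 0
    thus ?thesis using assms(1,2) zero by (simp add: newton_0)
  next
    case (Suc m)
    have sum: "(\<Sum>i\<in>A. f i) \<in> I" if "\<And>i. i \<in> A \<Longrightarrow> f i \<in> I" for f :: "nat \<Rightarrow> 'a" and A
      using that by (induction A rule: infinite_finite_induct) (auto simp: zero add)
    define c where "c i = ((-1) ^ (m - i) :: 'a)" for i
    have eq: "of_nat (Suc m) * (fps_nth E (Suc m) - fps_nth F (Suc m)) =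
      (\<Sum>i\<le>m. fps_nth E i * (c i * p (Suc (m - i))) - fps_nth F i * (c i * q (Suc (m - i))))"
      using newton_rec[OF assms(1), of m] newton_rec[OF assms(2), of m]
      by (simp only: sum_subtractf right_diff_distrib c_def)
    have "fps_nth E i * (c i * p (Suc (m - i))) - fps_nth F i * (c i * q (Suc (m - i))) \<in> I"
      if "i \<le> m" for i
    proof -
      have "fps_nth E i * (c i * p (Suc (m - i))) - fps_nth F i * (c i * q (Suc (m - i))) =
        (c i * p (Suc (m - i))) * (fps_nth E i - fps_nth F i) +
        (fps_nth F i * c i) * (p (Suc (m - i)) - q (Suc (m - i)))"
        by (simp add: algebra_simps)
      thus ?thesis using less.IH[of i] that Suc by (simp add: add mult pq)
    qed
    hence "of_nat (Suc m) * (fps_nth E (Suc m) - fps_nth F (Suc m)) \<in> I"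
      unfolding eq by (intro sum) auto
    thus ?thesis using sat Suc by blast
  qed
qed

lemma newton_unique:
  fixes E F :: "'a::torsion_free_ring fps"
  assumes "newton p E" "newton p F"
  shows "E = F"
proof (rule fps_ext)
  fix k
  have "fps_nth E k - fps_nth F k \<in> {0}"
    using assms by (rule newton_cong_ideal) (auto dest: of_nat_mult_eq_0 simp del: of_nat_Suc)
  thus "fps_nth E k = fps_nth F k" by simp
qed

subsection \<open>Lambda operations from commuting Frobenius lifts\<close>

text \<open>Dwork's lemma: a sequence with \<open>p (q * n) = \<psi> q (p n)\<close> is the ghost
  vector of a Witt vector \<open>w\<close>. The coordinate \<open>w n\<close> is found by recursion,
  once n is known to divide \<open>p n\<close> minus the contribution of the proper divisors of
  n.\<close>

lemma exists_witt_coordinates: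
  fixes p :: "nat \<Rightarrow> 'a::comm_ring_1" and \<psi> :: "nat \<Rightarrow> 'a \<Rightarrow> 'a"
  assumes hom: "\<And>q. prime q \<Longrightarrow> \<psi> q 1 = 1"
      "\<And>q x y. prime q \<Longrightarrow> \<psi> q (x + y) = \<psi> q x + \<psi> q y"
      "\<And>q x y. prime q \<Longrightarrow> \<psi> q (x * y) = \<psi> q x * \<psi> q y"
    and frob: "\<And>q x. prime q \<Longrightarrow> of_nat q dvd \<psi> q x - x ^ q"
    and p: "\<And>q n. prime q \<Longrightarrow> n > 0 \<Longrightarrow> p (q * n) = \<psi> q (p n)"
  shows "\<exists>w. \<forall>n>0. p n = (\<Sum>d | d dvd n. of_nat d * w d ^ (n div d))"
proof -
  define R :: "(nat \<Rightarrow> 'a) \<Rightarrow> nat \<Rightarrow> 'a \<Rightarrow> bool" where "R w n x \<longleftrightarrow> (n > 0 \<longrightarrow>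
    of_nat n * x = p n - (\<Sum>d | d dvd n \<and> d < n. of_nat d * w d ^ (n div d)))" for w n x
  have "\<exists>w. \<forall>n. R w n (w n)"
  proof (rule dependent_wf_choice[of "{(x, y). x < y}"])
    show "wf {(x::nat, y). x < y}" by (rule wf)
  next
    fix f g :: "nat \<Rightarrow> 'a" and n and r :: 'a
    assume "\<And>z. (z, n) \<in> {(x, y). x < y} \<Longrightarrow> f z = g z"
    hence "(\<Sum>d | d dvd n \<and> d < n. of_nat d * f d ^ (n div d)) = (\<Sum>d | d dvd n \<and> d < n. of_nat d * g d ^ (n div d))"
      by (intro sum.cong) auto
    thus "R f n r = R g n r" by (simp add: R_def)
  next
    fix n w assume IH: "\<And>m. (m, n) \<in> {(x, y). x < y} \<Longrightarrow> R w m (w m)"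
    show "\<exists>x. R w n x"
    proof (cases "n = 0")
      case False
      define z where "z = p n - (\<Sum>d | d dvd n \<and> d < n. of_nat d * w d ^ (n div d))"
      have "of_nat n dvd z"
      proof (rule of_nat_dvd_by_prime_powers)
        fix q j assume q: "prime q" and "q ^ j dvd n"
        show "of_nat (q ^ j) dvd z"
        proof (cases "q dvd n")
          case False
          hence "j = 0" using \<open>q ^ j dvd n\<close> by (metis dvd_power dvd_trans gr0I)
          thus ?thesis by simp
        next
          case True
          then obtain m where m: "n = q * m" by blast
          have m0: "0 < m" "m < n" using \<open>n \<noteq> 0\<close> m prime_gt_1_nat[OF q] by auto
          define k where "k = multiplicity q n"
          have "j \<le> k" unfolding k_def
            by (rule multiplicity_geI) (use q \<open>n \<noteq> 0\<close> \<open>q ^ j dvd n\<close> in auto)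
          have add0: "\<psi> q 0 = 0" using hom(2)[OF q, of 0 0] by simp
          have \<psi>sum: "\<psi> q (\<Sum>d\<in>A. f d) = (\<Sum>d\<in>A. \<psi> q (f d))" for f :: "nat \<Rightarrow> 'a" and A
            by (induction A rule: infinite_finite_induct) (simp_all add: hom q add0)
          have \<psi>nat: "\<psi> q (of_nat d) = of_nat d" for d
            by (induction d) (simp_all add: hom q add0)
          have \<psi>pow: "\<psi> q (x ^ d) = \<psi> q x ^ d" for x d
            by (induction d) (simp_all add: hom q)
          have "of_nat m * w m = p m - (\<Sum>d | d dvd m \<and> d < m. of_nat d * w d ^ (m div d))"
            using IH[of m] m0 by (simp add: R_def)
          moreover have "{d. d dvd m} = insert m {d. d dvd m \<and> d < m}"
            using m0 by (auto dest: dvd_imp_le)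
          ultimately have "p m = (\<Sum>d | d dvd m. of_nat d * w d ^ (m div d))"
            using m0 by simp
          hence pn: "p n = (\<Sum>d | d dvd m. of_nat d * \<psi> q (w d) ^ (m div d))"
            unfolding m by (simp add: p q m0 \<psi>sum hom \<psi>nat \<psi>pow)
          define D where "D = {d. d dvd n \<and> d < n}"
          have "d < n" if "d dvd m" for d
            using dvd_imp_le[OF that] m0 by linarith
          \<comment> \<open>With n = q m, the proper divisors of n that divide m are compared with
            the expansion of \<open>\<psi> q (p m)\<close>; the others are divisible by the full
            power of q in n.\<close>
          hence split: "D = {d. d dvd m} \<union> (D - {d. d dvd m})"
            using m by (auto simp: D_def)
          have finD: "finite D" unfolding D_def by simp
          have "(\<Sum>d\<in>D. of_nat d * w d ^ (n div d)) =
            (\<Sum>d | d dvd m. of_nat d * w d ^ (n div d)) + (\<Sum>d\<in>D - {d. d dvd m}. of_nat d * w d ^ (n div d))"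
            by (subst split, subst sum.union_disjoint) (use finD m0 in auto)
          hence z: "z = (\<Sum>d | d dvd m. of_nat d * (\<psi> q (w d) ^ (m div d) - w d ^ (n div d)))
             - (\<Sum>d\<in>D - {d. d dvd m}. of_nat d * w d ^ (n div d))"
            unfolding z_def pn D_def[symmetric] by (simp add: sum_subtractf right_diff_distrib)
          \<comment> \<open>If q^v and q^u are the exact powers of q in d and m div d, then d
            contributes q^v, the Frobenius congruence raised to the power m div d contributes
            q^(u+1), and v + u + 1 = k.\<close>
          have "of_nat (q ^ k) dvd of_nat d * (\<psi> q (w d) ^ (m div d) - w d ^ (n div d))" if d: "d dvd m" for d
          proof -
            obtain e where e: "m = d * e" using d by blast
            define u where "u = multiplicity q e"
            obtain e' where e': "e = q ^ u * e'" using multiplicity_dvd[of q e] unfolding u_def by blast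
            have d0: "d > 0" "e > 0" using m0 e by auto
            define v where "v = multiplicity q d"
            obtain d' where d': "d = q ^ v * d'" using multiplicity_dvd[of q d] unfolding v_def by blast
            have kuv: "k = Suc (v + u)"
              unfolding k_def v_def u_def m e using q d0 prime_elem_multiplicity_mult_distrib[of q]
              by (simp add: prime_elem_multiplicity_mult_distrib multiplicity_self)
            have "n div d = q * (q ^ u * e')" using m e d0 e' by simp
            moreover have "m div d = q ^ u * e'" using e d0 e' by simp
            ultimately have "of_nat (q ^ Suc u) dvd \<psi> q (w d) ^ (m div d) - w d ^ (n div d)"
              using dvd_diff_power_prime_power_mult[OF frob[OF q, of "w d"], of u e']
              by (simp add: power_mult)
            moreover have "of_nat (q ^ v) dvd (of_nat d :: 'a)"
              unfolding d' of_nat_mult by (rule dvd_triv_left)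
            ultimately have "of_nat (q ^ v) * of_nat (q ^ Suc u) dvd of_nat d * (\<psi> q (w d) ^ (m div d) - w d ^ (n div d))"
              by (intro mult_dvd_mono)
            thus ?thesis by (simp add: kuv power_add mult_ac)
          qed
          moreover have "of_nat (q ^ k) dvd of_nat d * w d ^ (n div d)" if d: "d \<in> D" "\<not> d dvd m" for d
          proof -
            obtain e where e: "n = d * e" using d by (auto simp: D_def)
            have "\<not> q dvd e"
            proof
              assume "q dvd e"
              then obtain e' where "e = q * e'" by blast
              hence "q * m = q * (d * e')" using e m by (simp only: mult.left_commute)
              hence "m = d * e'" using prime_gt_0_nat[OF q] by simp
              thus False using d by simp
            qed
            hence "coprime (q ^ k) e" using q by (simp add: prime_imp_coprime)
            moreover have "q ^ k dvd d * e" unfolding k_def e[symmetric] by (rule multiplicity_dvd)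
            ultimately have "q ^ k dvd d" by (simp add: coprime_dvd_mult_left_iff)
            thus ?thesis by (metis dvd_mult2 of_nat_dvd_of_nat)
          qed
          ultimately have "of_nat (q ^ k) dvd z"
            unfolding z by (intro dvd_diff dvd_sum) auto
          thus ?thesis using \<open>j \<le> k\<close> by (metis dvd_trans le_imp_power_dvd of_nat_dvd_of_nat)
        qed
      qed (use False in auto)
      then obtain x where "z = of_nat n * x" by blast
      thus ?thesis unfolding R_def z_def by (intro exI[of _ x]) simp
    qed (simp add: R_def)
  qed
  then obtain w where w: "\<And>n. R w n (w n)" by blast
  have "p n = (\<Sum>d | d dvd n. of_nat d * w d ^ (n div d))" if "n > 0" for n
  proof -
    have "{d. d dvd n} = insert n {d. d dvd n \<and> d < n}" using that by (auto dest: dvd_imp_le)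
    thus ?thesis using w[of n] that by (simp add: R_def)
  qed
  thus ?thesis by blast
qed

text \<open>The factor 1 - w (-t)^d: its logarithmic derivative is a geometric series supported on
  exponents i with d dividing i, exactly the d-th summand of a ghost component.\<close>

lemma newton_monomial:
  fixes w :: "'a::comm_ring_1"
  assumes "d > 0"
  shows "newton (\<lambda>i. if d dvd i then of_nat d * w ^ (i div d) else 0)
           (1 - fps_const ((-1) ^ d * w) * fps_X ^ d)"
proof -
  define c where "c = (-1) ^ d * w"
  define L where "L = newton_log (\<lambda>i. if d dvd i then of_nat d * w ^ (i div d) else 0)"
  have L: "fps_nth L n = (if d dvd Suc n then - of_nat d * c ^ (Suc n div d) else 0)" for n
  proof (cases "d dvd Suc n")
    case True
    have "(-1) ^ n * w ^ (Suc n div d) = - ((-1) ^ Suc n * w ^ (Suc n div d))" by simp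
    also have "(-1) ^ Suc n = ((- (1::'a)) ^ d) ^ (Suc n div d)"
      using True by (metis dvd_mult_div_cancel power_mult)
    also have "\<dots> * w ^ (Suc n div d) = c ^ (Suc n div d)" by (simp add: c_def power_mult_distrib)
    finally have "(-1) ^ n * w ^ (Suc n div d) = - (c ^ (Suc n div d))" .
    thus ?thesis using True by (simp add: L_def newton_log_def mult.left_commute)
  qed (simp add: L_def newton_log_def)
  have "fps_deriv (1 - fps_const c * fps_X ^ d) = (1 - fps_const c * fps_X ^ d) * L"
  proof (rule fps_ext)
    fix n
    have 1: "fps_nth (fps_deriv (1 - fps_const c * fps_X ^ d)) n = (if Suc n = d then - of_nat d * c else 0)"
      by (auto simp: algebra_simps)
    have "fps_nth ((1 - fps_const c * fps_X ^ d) * L) n = fps_nth L n - c * (if n < d then 0 else fps_nth L (n - d))"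
      by (simp add: left_diff_distrib mult.assoc fps_X_power_mult_nth)
    also have "\<dots> = (if Suc n = d then - of_nat d * c else 0)"
    proof -
      consider "Suc n < d" | "Suc n = d" | "n \<ge> d" by linarith
      thus ?thesis
      proof cases
        case 1
        hence "\<not> d dvd Suc n" by (auto dest: dvd_imp_le)
        thus ?thesis using 1 by (simp add: L)
      next
        case 2
        thus ?thesis using assms by (simp add: L)
      next
        case 3
        then obtain m where m: "n = d + m" using le_Suc_ex by blast
        have "Suc (d + m) div d = Suc (Suc m div d)" "d dvd Suc (d + m) \<longleftrightarrow> d dvd Suc m"
          using assms by (metis add_Suc_right div_add_self1 not_gr0 Suc_eq_plus1_left add.commute)
             (metis add_Suc_right dvd_add_right_iff dvd_refl)
        thus ?thesis unfolding m by (simp add: L)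
      qed
    qed
    finally show "fps_nth (fps_deriv (1 - fps_const c * fps_X ^ d)) n = fps_nth ((1 - fps_const c * fps_X ^ d) * L) n"
      unfolding 1 by simp
  qed
  thus ?thesis using assms by (simp add: newton_def c_def L_def)
qed

text \<open>The solution is the infinite product of the factors 1 - w_d (-t)^d. The factor of index
  N + 1 does not affect coefficients up to N, so coefficient k can be read off the k-th partial
  product and no convergence is involved.\<close>

lemma newton_exists_of_witt_coordinates:
  fixes p w :: "nat \<Rightarrow> 'a::comm_ring_1"
  assumes "\<And>n. n > 0 \<Longrightarrow> p n = (\<Sum>d | d dvd n. of_nat d * w d ^ (n div d))"
  shows "\<exists>E. newton p E"
proof -
  define e where "e d = 1 - fps_const ((-1) ^ d * w d) * fps_X ^ d" for d
  define P where "P N = (\<Prod>d\<in>{1..N}. e d)" for N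
  define q where "q N i = (\<Sum>d\<in>{1..N}. if d dvd i then of_nat d * w d ^ (i div d) else 0)" for N i
  have newt: "newton (q N) (P N)" for N
    unfolding q_def[abs_def] P_def e_def by (intro newton_prod newton_monomial) auto
  have q: "q N i = p i" if "1 \<le> i" "i \<le> N" for i N
  proof -
    have "q N i = (\<Sum>d\<in>{d\<in>{1..N}. d dvd i}. of_nat d * w d ^ (i div d))"
      unfolding q_def by (subst sum.inter_filter) auto
    also have "{d\<in>{1..N}. d dvd i} = {d. d dvd i}"
    proof -
      have "1 \<le> d \<and> d \<le> N" if "d dvd i" for d
        using dvd_imp_le[OF that] dvd_pos_nat[OF _ that] \<open>1 \<le> i\<close> \<open>i \<le> N\<close> by simp
      thus ?thesis by auto
    qed
    finally show ?thesis using assms[of i] that by simp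
  qed
  have step: "fps_nth (P (Suc N)) k = fps_nth (P N) k" if "k \<le> N" for N k
  proof -
    have "P (Suc N) = P N * e (Suc N)" by (simp add: P_def)
    also have "\<dots> = P N - fps_const ((-1) ^ Suc N * w (Suc N)) * (P N * fps_X ^ Suc N)"
      unfolding e_def by (simp only: algebra_simps mult_1_left mult_1_right)
    finally show ?thesis using that
      by (simp only: fps_sub_nth fps_mult_left_const_nth fps_X_power_mult_right_nth) simp
  qed
  have stable: "fps_nth (P N) k = fps_nth (P k) k" if "k \<le> N" for N k
    using that by (induction N rule: dec_induct) (simp_all add: step)
  have "newton p (Abs_fps (\<lambda>k. fps_nth (P k) k))"
    unfolding newton_iff
  proof (intro conjI allI)
    show "fps_nth (Abs_fps (\<lambda>k. fps_nth (P k) k)) 0 = 1" by (simp add: P_def)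
    fix k
    have "(\<Sum>i\<le>k. fps_nth (P (Suc k)) i * ((- 1) ^ (k - i) * q (Suc k) (Suc (k - i)))) =
      (\<Sum>i\<le>k. fps_nth (P i) i * ((- 1) ^ (k - i) * p (Suc (k - i))))"
      by (intro sum.cong refl) (simp add: q stable[of _ "Suc k"])
    thus "of_nat (Suc k) * fps_nth (Abs_fps (\<lambda>k. fps_nth (P k) k)) (Suc k) =
      (\<Sum>i\<le>k. fps_nth (Abs_fps (\<lambda>k. fps_nth (P k) k)) i * ((- 1) ^ (k - i) * p (Suc (k - i))))"
      using newton_rec[OF newt, of k "Suc k"] by (simp only: fps_nth_Abs_fps)
  qed
  thus ?thesis by blast
qed

section \<open>Lambda operations whose power sums are given Adams operations\<close>

locale adams_operations =
  fixes \<psi> :: "nat \<Rightarrow> 'a::torsion_free_ring \<Rightarrow> 'a"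
  assumes psi_add: "n > 0 \<Longrightarrow> \<psi> n (x + y) = \<psi> n x + \<psi> n y"
    and psi_mult: "n > 0 \<Longrightarrow> \<psi> n (x * y) = \<psi> n x * \<psi> n y"
    and psi_one: "n > 0 \<Longrightarrow> \<psi> n 1 = 1"
    and psi_1: "\<psi> 1 x = x"
    and psi_psi: "m > 0 \<Longrightarrow> n > 0 \<Longrightarrow> \<psi> m (\<psi> n x) = \<psi> (m * n) x"
    and psi_frobenius: "prime p \<Longrightarrow> of_nat p dvd \<psi> p x - x ^ p"
begin

text \<open>The description is proper: existence is Dwork's lemma applied to the sequence
  \<open>\<psi> n x\<close>, uniqueness comes from torsion-freeness.\<close>

definition lam_series :: "'a \<Rightarrow> 'a fps" where
  "lam_series x = (THE E. newton (\<lambda>n. \<psi> n x) E)"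

definition lam :: "nat \<Rightarrow> 'a \<Rightarrow> 'a" where
  "lam k x = fps_nth (lam_series x) k"

lemma newton_lam_series: "newton (\<lambda>n. \<psi> n x) (lam_series x)"
proof -
  have "\<exists>w. \<forall>n>0. \<psi> n x = (\<Sum>d | d dvd n. of_nat d * w d ^ (n div d))"
    by (rule exists_witt_coordinates[of \<psi>])
       (auto simp: psi_one psi_add psi_mult psi_frobenius psi_psi prime_gt_0_nat)
  then obtain w where "\<And>n. n > 0 \<Longrightarrow> \<psi> n x = (\<Sum>d | d dvd n. of_nat d * w d ^ (n div d))" by blast
  from newton_exists_of_witt_coordinates[OF this]
  obtain E where E: "newton (\<lambda>n. \<psi> n x) E" ..
  show ?thesis unfolding lam_series_def
    by (rule theI[where P = "newton (\<lambda>n. \<psi> n x)"]) (rule E, rule newton_unique[OF _ E])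
qed

lemma lam_seriesI: "newton p E \<Longrightarrow> (\<And>n. n \<ge> 1 \<Longrightarrow> p n = \<psi> n x) \<Longrightarrow> lam_series x = E"
  by (rule newton_unique[OF newton_lam_series]) (rule newton_cong)

lemma lam_0: "lam 0 x = 1"
  unfolding lam_def by (rule newton_0[OF newton_lam_series])

lemma lam_1: "lam 1 x = x"
  unfolding lam_def using newton_1[OF newton_lam_series] psi_1 by simp

lemma lam_one: "k > 1 \<Longrightarrow> lam k 1 = 0"
proof -
  assume k: "k > 1"
  have "lam_series 1 = 1 + fps_const 1 * fps_X"
    by (rule lam_seriesI[OF newton_linear]) (simp add: psi_one)
  thus ?thesis using k by (simp add: lam_def)
qed

lemma lam_zero:
  assumes "k \<ge> 1"
  shows "lam k 0 = 0"
proof -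
  have "\<psi> i 0 = 0" if "i \<ge> 1" for i using psi_add[of i 0 0] that by simp
  hence "lam_series 0 = 1" by (intro lam_seriesI[OF newton_zero]) simp
  thus ?thesis using assms by (simp add: lam_def)
qed

lemma lam_series_add: "lam_series (x + y) = lam_series x * lam_series y"
  by (rule lam_seriesI[OF newton_mult[OF newton_lam_series newton_lam_series]]) (simp add: psi_add)

lemma lam_add: "lam k (x + y) = (\<Sum>i=0..k. lam i x * lam (k - i) y)"
  by (simp add: lam_def lam_series_add fps_mult_nth)

text \<open>In terms of formal roots of x, \<psi>_j replaces every root by its j-th power, so
  \<psi>_j(\<lambda>^n x) is the n-th elementary symmetric function of the j-th powers. This feeds
  the composition axiom.\<close>

lemma newton_psi_lam:
  assumes "j > 0"
  shows "newton (\<lambda>i. \<psi> (i * j) x) (Abs_fps (\<lambda>n. \<psi> j (lam n x)))"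
proof -
  have "newton (\<lambda>i. \<psi> j (\<psi> i x)) (Abs_fps (\<lambda>n. \<psi> j (lam n x)))"
    unfolding lam_def using newton_lam_series
    by (rule newton_hom) (use assms in \<open>auto simp: psi_add psi_mult psi_one\<close>)
  thus ?thesis by (rule newton_cong) (use assms in \<open>simp add: psi_psi mult.commute\<close>)
qed

end

subsection \<open>Evaluation of integer polynomials\<close>

definition mval :: "(nat \<Rightarrow> 'a::comm_ring_1) \<Rightarrow> (nat \<Rightarrow>\<^sub>0 nat) \<Rightarrow> 'a" where
  "mval v m = (\<Prod>i\<in>Poly_Mapping.keys m. v i ^ Poly_Mapping.lookup m i)"

definition peval :: "(nat \<Rightarrow> 'a::comm_ring_1) \<Rightarrow> ipoly \<Rightarrow> 'a" where
  "peval v p = (\<Sum>m\<in>Poly_Mapping.keys p. of_int (Poly_Mapping.lookup p m) * mval v m)"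

lemma psubst_eq_peval: "psubst = peval"
  by (simp add: fun_eq_iff psubst_def peval_def mval_def)

lemma mval_superset:
  assumes "finite A" "Poly_Mapping.keys m \<subseteq> A"
  shows "mval v m = (\<Prod>i\<in>A. v i ^ Poly_Mapping.lookup m i)"
  unfolding mval_def using assms
  by (intro prod.mono_neutral_left) (auto simp: in_keys_iff)

lemma mval_add: "mval v (m + m') = mval v m * mval v m'"
proof -
  let ?A = "Poly_Mapping.keys m \<union> Poly_Mapping.keys m'"
  have "mval v (m + m') = (\<Prod>i\<in>?A. v i ^ Poly_Mapping.lookup (m + m') i)"
    using keys_add[of m m'] by (intro mval_superset) auto
  thus ?thesis
    by (simp add: mval_superset[of ?A m] mval_superset[of ?A m'] lookup_add power_add prod.distrib)
qed

lemma mval_0: "mval v 0 = 1"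
  by (simp add: mval_def)

lemma peval_superset:
  assumes "finite A" "Poly_Mapping.keys p \<subseteq> A"
  shows "peval v p = (\<Sum>m\<in>A. of_int (Poly_Mapping.lookup p m) * mval v m)"
  unfolding peval_def using assms
  by (intro sum.mono_neutral_left) (auto simp: in_keys_iff)

lemma peval_add: "peval v (p + q) = peval v p + peval v q"
proof -
  let ?A = "Poly_Mapping.keys p \<union> Poly_Mapping.keys q"
  have "peval v (p + q) = (\<Sum>m\<in>?A. of_int (Poly_Mapping.lookup (p + q) m) * mval v m)"
    using keys_add[of p q] by (intro peval_superset) auto
  thus ?thesis
    by (simp add: peval_superset[of ?A p] peval_superset[of ?A q] lookup_add distrib_right sum.distrib)
qed

lemma peval_0: "peval v 0 = 0"
  by (simp add: peval_def)

lemma peval_sum: "peval v (\<Sum>a\<in>A. f a) = (\<Sum>a\<in>A. peval v (f a))"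
  by (induction A rule: infinite_finite_induct) (simp_all add: peval_0 peval_add)

lemma peval_single: "peval v (Poly_Mapping.single m c) = of_int c * mval v m"
  by (simp add: peval_def)

lemma peval_pvar: "peval v (pvar i) = v i"
  by (simp add: pvar_def peval_single mval_def)

lemma peval_1: "peval v 1 = 1"
  by (simp add: peval_single mval_0 flip: single_one)

lemma poly_mapping_expansion:
  "p = (\<Sum>m\<in>Poly_Mapping.keys p. Poly_Mapping.single m (Poly_Mapping.lookup p m))"
  by (rule poly_mapping_eqI) (simp add: lookup_sum lookup_single when_def in_keys_iff)

lemma peval_mult: "peval v (p * q) = peval v p * peval v q"
proof -
  let ?s = "\<lambda>p m. Poly_Mapping.single m (Poly_Mapping.lookup p m)"
  have "p * q = (\<Sum>m\<in>Poly_Mapping.keys p. ?s p m) * (\<Sum>m\<in>Poly_Mapping.keys q. ?s q m)"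
    by (simp flip: poly_mapping_expansion)
  also have "\<dots> = (\<Sum>m\<in>Poly_Mapping.keys p. \<Sum>m'\<in>Poly_Mapping.keys q. ?s p m * ?s q m')"
    by (simp add: sum_product)
  finally have "peval v (p * q) = (\<Sum>m\<in>Poly_Mapping.keys p. \<Sum>m'\<in>Poly_Mapping.keys q.
      of_int (Poly_Mapping.lookup p m) * mval v m * (of_int (Poly_Mapping.lookup q m') * mval v m'))"
    by (simp add: peval_sum mult_single peval_single mval_add mult_ac)
  thus ?thesis by (simp add: peval_def sum_product)
qed

lemma peval_uminus: "peval v (- p) = - peval v p"
  using peval_add[of v p "-p"] by (simp add: peval_0 add_eq_0_iff)

lemma pvars_add: "pvars (p + q) \<subseteq> pvars p \<union> pvars q"
  using keys_add[of p q] by (auto simp: pvars_def)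

lemma pvars_mult: "pvars (p * q) \<subseteq> pvars p \<union> pvars q"
proof -
  have "Poly_Mapping.keys m \<subseteq> pvars p \<union> pvars q" if m: "m \<in> Poly_Mapping.keys (p * q)" for m
  proof -
    obtain a b where "m = a + b" "a \<in> Poly_Mapping.keys p" "b \<in> Poly_Mapping.keys q"
      using keys_mult[of p q] m by blast
    thus ?thesis using keys_add[of a b] by (auto simp: pvars_def)
  qed
  thus ?thesis by (auto simp: pvars_def)
qed

lemma pvars_pvar: "pvars (pvar i) = {i}"
  by (simp add: pvars_def pvar_def)

lemma pvars_uminus: "pvars (- p) = pvars p"
  by (simp add: pvars_def)

lemma pvars_1: "pvars 1 = {}"
  by (simp add: pvars_def)

lemma pvars_0: "pvars 0 = {}"
  by (simp add: pvars_def)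

text \<open>\<open>a\<close> and \<open>b\<close> are values of one and the same polynomial with rational coefficients, in
  the variables of \<open>V\<close>.\<close>
definition rationally_related ::
  "nat set \<Rightarrow> (nat \<Rightarrow> 'a::comm_ring_1) \<Rightarrow> (nat \<Rightarrow> 'b::comm_ring_1) \<Rightarrow> 'a \<Rightarrow> 'b \<Rightarrow> bool" where
  "rationally_related V v w a b \<longleftrightarrow>
     (\<exists>M>0. \<exists>Q. pvars Q \<subseteq> V \<and> peval v Q = of_nat M * a \<and> peval w Q = of_nat M * b)"

context
  fixes V :: "nat set" and v :: "nat \<Rightarrow> 'a::comm_ring_1" and w :: "nat \<Rightarrow> 'b::comm_ring_1"
begin

abbreviation (input) rr where "rr \<equiv> rationally_related V v w"

lemma peval_of_nat: "peval v (of_nat k) = of_nat k"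
  by (induction k) (simp_all add: peval_0 peval_1 peval_add)

lemma pvars_of_nat: "pvars (of_nat k) = {}"
  by (simp add: pvars_def flip: single_of_nat)

lemma rationally_related_1: "rr 1 1"
  unfolding rationally_related_def
  by (intro exI[of _ "1::nat"] conjI exI[of _ "1::ipoly"]) (simp_all add: pvars_1 peval_1)

lemma rationally_related_0: "rr 0 0"
  unfolding rationally_related_def
  by (intro exI[of _ "1::nat"] conjI exI[of _ "0::ipoly"]) (simp_all add: pvars_0 peval_0)

lemma rationally_related_var: "i \<in> V \<Longrightarrow> rr (v i) (w i)"
  unfolding rationally_related_def
  by (intro exI[of _ "1::nat"] conjI exI[of _ "pvar i"]) (simp_all add: pvars_pvar peval_pvar)

lemma rationally_related_uminus: "rr a b \<Longrightarrow> rr (- a) (- b)"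
  unfolding rationally_related_def by (metis pvars_uminus peval_uminus mult_minus_right)

lemma rationally_related_mult:
  assumes "rr a b" "rr c d"
  shows "rr (a * c) (b * d)"
proof -
  obtain M Q where 1: "M > 0" "pvars Q \<subseteq> V" "peval v Q = of_nat M * a" "peval w Q = of_nat M * b"
    using assms(1) unfolding rationally_related_def by blast
  obtain N R where 2: "N > 0" "pvars R \<subseteq> V" "peval v R = of_nat N * c" "peval w R = of_nat N * d"
    using assms(2) unfolding rationally_related_def by blast
  show ?thesis unfolding rationally_related_def
    using 1 2 pvars_mult[of Q R]
    by (intro exI[of _ "M * N"] conjI exI[of _ "Q * R"]) (auto simp: peval_mult mult_ac)
qed

end

lemma rationally_related_add:
  fixes v :: "nat \<Rightarrow> 'a::comm_ring_1" and w :: "nat \<Rightarrow> 'b::comm_ring_1"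
  assumes "rationally_related V v w a b" "rationally_related V v w c d"
  shows "rationally_related V v w (a + c) (b + d)"
proof -
  obtain M Q where 1: "M > 0" "pvars Q \<subseteq> V" "peval v Q = of_nat M * a" "peval w Q = of_nat M * b"
    using assms(1) unfolding rationally_related_def by blast
  obtain N R where 2: "N > 0" "pvars R \<subseteq> V" "peval v R = of_nat N * c" "peval w R = of_nat N * d"
    using assms(2) unfolding rationally_related_def by blast
  let ?P = "of_nat N * Q + of_nat M * R :: ipoly"
  have "pvars ?P \<subseteq> V"
    using pvars_add[of "of_nat N * Q" "of_nat M * R"] pvars_mult[of "of_nat N" Q] pvars_mult[of "of_nat M" R]
      1(2) 2(2) pvars_of_nat[of N] pvars_of_nat[of M] by blast
  moreover have "peval v ?P = of_nat (M * N) * (a + c)" "peval w ?P = of_nat (M * N) * (b + d)"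
    using 1 2 by (simp_all add: peval_add peval_mult peval_of_nat algebra_simps)
  ultimately show ?thesis unfolding rationally_related_def using 1(1) 2(1)
    by (intro exI[of _ "M * N"] conjI exI[of _ ?P]) auto
qed

lemma rationally_related_diff:
  assumes "rationally_related V v w a b" "rationally_related V v w c d"
  shows "rationally_related V v w (a - c) (b - d)"
  using rationally_related_add[OF assms(1) rationally_related_uminus[OF assms(2)]] by simp

lemma rationally_related_sum:
  assumes "\<And>i. i \<in> A \<Longrightarrow> rationally_related V v w (f i) (g i)"
  shows "rationally_related V v w (\<Sum>i\<in>A. f i) (\<Sum>i\<in>A. g i)"
  using assms by (induction A rule: infinite_finite_induct)
    (auto intro: rationally_related_0 rationally_related_add)

lemma rationally_related_minus1_power: "rationally_related V v w ((-1) ^ k) ((-1) ^ k)"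
  by (induction k) (auto intro: rationally_related_1 rationally_related_uminus)

lemma rationally_related_of_nat: "rationally_related V v w (of_nat k) (of_nat k)"
  by (induction k) (auto intro: rationally_related_0 rationally_related_1 rationally_related_add)

text \<open>The reason for the denominator M in the relation: it absorbs the division by k in
  Newton's recursion.\<close>

lemma rationally_related_divide:
  assumes "rationally_related V v w (of_nat k * a) (of_nat k * b)" "k > 0"
  shows "rationally_related V v w a b"
proof -
  obtain M Q where 1: "M > 0" "pvars Q \<subseteq> V" "peval v Q = of_nat M * (of_nat k * a)"
      "peval w Q = of_nat M * (of_nat k * b)"
    using assms(1) unfolding rationally_related_def by blast
  thus ?thesis unfolding rationally_related_def using assms(2)
    by (intro exI[of _ "M * k"] conjI exI[of _ Q]) (auto simp: mult.assoc)
qed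

lemma rationally_related_newton_coeff:
  assumes "newton p E" "newton q F" "\<And>i. 1 \<le> i \<Longrightarrow> i \<le> n \<Longrightarrow> rationally_related V v w (p i) (q i)" "k \<le> n"
  shows "rationally_related V v w (fps_nth E k) (fps_nth F k)"
  using assms(4)
proof (induction k rule: less_induct)
  case (less k)
  show ?case
  proof (cases k)
    case 0
    thus ?thesis using assms(1,2) by (simp add: newton_0 rationally_related_1)
  next
    case (Suc m)
    have "rationally_related V v w (of_nat (Suc m) * fps_nth E (Suc m)) (of_nat (Suc m) * fps_nth F (Suc m))"
      unfolding newton_rec[OF assms(1)] newton_rec[OF assms(2)]
      by (intro rationally_related_sum rationally_related_mult rationally_related_minus1_power
            less.IH assms(3)) (use Suc less.prems in auto)
    thus ?thesis unfolding Suc by (rule rationally_related_divide) simp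
  qed
qed

text \<open>Newton's recursion solved for \<open>p k\<close> instead: its coefficient there is a
  sign, because the constant term of E is 1. The bound n keeps the relation within finitely many
  variables.\<close>

lemma rationally_related_newton_power_sum:
  assumes "newton p E" "newton q F" "\<And>i. 1 \<le> i \<Longrightarrow> i \<le> n \<Longrightarrow> rationally_related V v w (fps_nth E i) (fps_nth F i)"
    "1 \<le> k" "k \<le> n"
  shows "rationally_related V v w (p k) (q k)"
  using assms(4,5)
proof (induction k rule: less_induct)
  case (less k)
  then obtain m where m: "k = Suc m" by (cases k) auto
  have eq: "p' k = (-1) ^ m * (of_nat (Suc m) * fps_nth E' (Suc m) -
      (\<Sum>i=1..m. fps_nth E' i * ((-1) ^ (m - i) * p' (Suc (m - i)))))"
    if "newton p' E'" for p' :: "nat \<Rightarrow> 'c::comm_ring_1" and E'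
  proof -
    have "{..m} = insert 0 {1..m}" by auto
    hence "of_nat (Suc m) * fps_nth E' (Suc m) - (\<Sum>i=1..m. fps_nth E' i * ((-1) ^ (m - i) * p' (Suc (m - i))))
      = (-1) ^ m * p' k"
      unfolding newton_rec[OF that] m by (simp add: newton_0[OF that])
    thus ?thesis by (simp add: mult.assoc[symmetric] flip: power_add)
  qed
  have "rationally_related V v w (fps_nth E i) (fps_nth F i)" if "i \<le> n" for i
    using assms(3)[of i] that assms(1,2)
    by (cases "i = 0") (auto simp: newton_0 rationally_related_1)
  thus ?case unfolding eq[OF assms(1)] eq[OF assms(2)]
    by (intro rationally_related_sum rationally_related_mult rationally_related_minus1_power
          rationally_related_diff rationally_related_of_nat less.IH) (use m less.prems in auto)
qed

subsection \<open>Leading monomials of elementary symmetric polynomials\<close>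

text \<open>Exponents are compared lexicographically, the smallest index at which they differ
  deciding. This linear order is compatible with addition, so leading exponents add under products;
  leading coefficient 1 keeps divisibility by any integer intact.\<close>

definition monic_lead :: "ipoly \<Rightarrow> (nat \<Rightarrow>\<^sub>0 nat) \<Rightarrow> bool" where
  "monic_lead f \<mu> \<longleftrightarrow> Poly_Mapping.lookup f \<mu> = 1 \<and> (\<forall>\<nu>\<in>Poly_Mapping.keys f. \<nu> \<le> \<mu>)"

lemma lookup_mult_finite:
  fixes f g :: ipoly
  shows "Poly_Mapping.lookup (f * g) m = (\<Sum>(a, b)\<in>Poly_Mapping.keys f \<times> Poly_Mapping.keys g.
     Poly_Mapping.lookup f a * Poly_Mapping.lookup g b when a + b = m)"
proof -
  let ?s = "\<lambda>p m. Poly_Mapping.single m (Poly_Mapping.lookup p m)"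
  have "f * g = (\<Sum>m\<in>Poly_Mapping.keys f. ?s f m) * (\<Sum>m\<in>Poly_Mapping.keys g. ?s g m)"
    by (simp flip: poly_mapping_expansion)
  also have "\<dots> = (\<Sum>(a, b)\<in>Poly_Mapping.keys f \<times> Poly_Mapping.keys g. ?s f a * ?s g b)"
    by (simp add: sum_product sum.cartesian_product)
  finally show ?thesis
    by (simp add: lookup_sum case_prod_unfold mult_single lookup_single)
qed

lemma monic_lead_mult:
  assumes "monic_lead f \<mu>" "monic_lead g \<nu>"
  shows "monic_lead (f * g) (\<mu> + \<nu>)"
proof -
  have mem: "\<mu> \<in> Poly_Mapping.keys f" "\<nu> \<in> Poly_Mapping.keys g"
    using assms by (simp_all add: monic_lead_def in_keys_iff)
  have uniq: "a = \<mu> \<and> b = \<nu>"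
    if "a \<in> Poly_Mapping.keys f" "b \<in> Poly_Mapping.keys g" "a + b = \<mu> + \<nu>" for a b
  proof -
    have le: "a \<le> \<mu>" "b \<le> \<nu>" using that assms by (auto simp: monic_lead_def)
    have "a = \<mu>"
    proof (rule ccontr)
      assume "a \<noteq> \<mu>"
      hence "a + b < \<mu> + \<nu>" using le by (intro add_less_le_mono) auto
      thus False using that by simp
    qed
    thus ?thesis using that by simp
  qed
  have "Poly_Mapping.lookup (f * g) (\<mu> + \<nu>) =
    (\<Sum>(a, b)\<in>{(\<mu>, \<nu>)}. Poly_Mapping.lookup f a * Poly_Mapping.lookup g b when a + b = \<mu> + \<nu>)"
    unfolding lookup_mult_finite
  proof (intro sum.mono_neutral_right ballI)
    fix ab assume "ab \<in> Poly_Mapping.keys f \<times> Poly_Mapping.keys g - {(\<mu>, \<nu>)}"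
    thus "(case ab of (a, b) \<Rightarrow> Poly_Mapping.lookup f a * Poly_Mapping.lookup g b when a + b = \<mu> + \<nu>) = 0"
      using uniq[of "fst ab" "snd ab"] by (cases ab) (simp add: when_def, blast)
  qed (use mem in simp_all)
  moreover have "\<xi> \<le> \<mu> + \<nu>" if "\<xi> \<in> Poly_Mapping.keys (f * g)" for \<xi>
    using that keys_mult[of f g] assms unfolding monic_lead_def by (blast intro: add_mono)
  ultimately show ?thesis using assms by (simp add: monic_lead_def)
qed

lemma monic_lead_1: "monic_lead 1 0"
  by (simp add: monic_lead_def)

lemma monic_lead_power: "monic_lead f \<mu> \<Longrightarrow> monic_lead (f ^ n) (\<Sum>j<n. \<mu>)"
  by (induction n) (simp_all add: monic_lead_1 monic_lead_mult add.commute mult.commute del: sum_constant)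

lemma monic_lead_prod:
  "(\<And>i. i \<in> A \<Longrightarrow> monic_lead (f i) (\<mu> i)) \<Longrightarrow> monic_lead (\<Prod>i\<in>A. f i) (\<Sum>i\<in>A. \<mu> i)"
  by (induction A rule: infinite_finite_induct) (simp_all add: monic_lead_1 monic_lead_mult)

text \<open>By unitriangularity distinct monomials in the \<open>v i\<close> have distinct leading
  exponents. Among the monomials of Q whose coefficient is not divisible by M, take the one with
  greatest leading exponent: at that exponent all other contributions are multiples of M, so its own
  coefficient is one too, a contradiction.\<close>

lemma dvd_coeffs_of_dvd_coeffs_peval:
  fixes v :: "nat \<Rightarrow> ipoly" and \<mu> :: "nat \<Rightarrow> (nat \<Rightarrow>\<^sub>0 nat)"
  assumes lead: "\<And>i. i \<in> V \<Longrightarrow> monic_lead (v i) (\<mu> i)"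
    and diag: "\<And>i. i \<in> V \<Longrightarrow> Poly_Mapping.lookup (\<mu> i) i = 1"
    and upper: "\<And>i t. i \<in> V \<Longrightarrow> i < t \<Longrightarrow> Poly_Mapping.lookup (\<mu> i) t = 0"
    and Q: "pvars Q \<subseteq> V" and dvd: "\<And>t. M dvd Poly_Mapping.lookup (peval v Q) t"
  shows "M dvd Poly_Mapping.lookup Q m"
proof (rule ccontr)
  define L where "L m = (\<Sum>i\<in>Poly_Mapping.keys m. \<Sum>j<Poly_Mapping.lookup m i. \<mu> i)"
    for m :: "nat \<Rightarrow>\<^sub>0 nat"
  have look: "Poly_Mapping.lookup (L m) t = (\<Sum>i\<in>A. Poly_Mapping.lookup m i * Poly_Mapping.lookup (\<mu> i) t)"
    if "finite A" "Poly_Mapping.keys m \<subseteq> A" for m t A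
  proof -
    have "Poly_Mapping.lookup (L m) t = (\<Sum>i\<in>Poly_Mapping.keys m. Poly_Mapping.lookup m i * Poly_Mapping.lookup (\<mu> i) t)"
      by (simp add: L_def lookup_sum del: sum_constant) simp
    also have "\<dots> = (\<Sum>i\<in>A. Poly_Mapping.lookup m i * Poly_Mapping.lookup (\<mu> i) t)"
      using that by (intro sum.mono_neutral_left) (simp_all add: in_keys_iff)
    finally show ?thesis .
  qed
  have inj: "a = b" if a: "Poly_Mapping.keys a \<subseteq> V" and b: "Poly_Mapping.keys b \<subseteq> V" and eq: "L a = L b" for a b
  proof (rule ccontr)
    assume "a \<noteq> b"
    define A where "A = Poly_Mapping.keys a \<union> Poly_Mapping.keys b"
    define D where "D = {i\<in>A. Poly_Mapping.lookup a i \<noteq> Poly_Mapping.lookup b i}"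
    have "finite A" "finite D" by (simp_all add: A_def D_def)
    obtain i0 where i0: "Poly_Mapping.lookup a i0 \<noteq> Poly_Mapping.lookup b i0"
      using \<open>a \<noteq> b\<close> poly_mapping_eqI[of a b] by blast
    hence "i0 \<in> D" unfolding D_def A_def by (cases "Poly_Mapping.lookup a i0 = 0") (auto simp: in_keys_iff)
    hence "D \<noteq> {}" by blast
    \<comment> \<open>At the largest index where a and b differ, smaller indices contribute nothing
      since the matrix of the \<mu> vanishes there, and larger ones contribute equally.\<close>
    define t where "t = Max D"
    have tD: "t \<in> D" unfolding t_def by (rule Max_in) fact+
    hence tA: "t \<in> A" "t \<in> V" using a b unfolding D_def A_def by blast+
    have split: "Poly_Mapping.lookup (L c) t =
        Poly_Mapping.lookup c t + (\<Sum>i\<in>A - {t}. Poly_Mapping.lookup c i * Poly_Mapping.lookup (\<mu> i) t)"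
      if "Poly_Mapping.keys c \<subseteq> A" for c
      using look[OF \<open>finite A\<close> that] diag[OF tA(2)] \<open>finite A\<close> tA by (simp add: sum.remove)
    have rest: "(\<Sum>i\<in>A - {t}. Poly_Mapping.lookup a i * Poly_Mapping.lookup (\<mu> i) t) =
      (\<Sum>i\<in>A - {t}. Poly_Mapping.lookup b i * Poly_Mapping.lookup (\<mu> i) t)"
    proof (intro sum.cong refl)
      fix i assume i: "i \<in> A - {t}"
      show "Poly_Mapping.lookup a i * Poly_Mapping.lookup (\<mu> i) t = Poly_Mapping.lookup b i * Poly_Mapping.lookup (\<mu> i) t"
      proof (cases "i < t")
        case True
        moreover have "i \<in> V" using i a b unfolding A_def by blast
        ultimately have "Poly_Mapping.lookup (\<mu> i) t = 0" by (intro upper)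
        thus ?thesis by (simp only: mult_0_right)
      next
        case False
        hence "i \<notin> D" using i Max_ge[OF \<open>finite D\<close>, of i] unfolding t_def[symmetric] by force
        thus ?thesis using i by (simp add: D_def)
      qed
    qed
    have "Poly_Mapping.lookup a t = Poly_Mapping.lookup b t"
      using split[of a] split[of b] rest eq by (simp add: A_def)
    thus False using tD by (simp add: D_def)
  qed
  assume "\<not> M dvd Poly_Mapping.lookup Q m"
  define K where "K = {m \<in> Poly_Mapping.keys Q. \<not> M dvd Poly_Mapping.lookup Q m}"
  have "m \<in> K" using \<open>\<not> M dvd _\<close> unfolding K_def by (auto simp: in_keys_iff)
  hence K: "finite K" "K \<noteq> {}" by (auto simp: K_def)
  define \<Lambda> where "\<Lambda> = Max (L ` K)"
  have "\<Lambda> \<in> L ` K" unfolding \<Lambda>_def using K by (intro Max_in) auto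
  then obtain k where k: "k \<in> K" "\<Lambda> = L k" by blast
  have keysV: "Poly_Mapping.keys a \<subseteq> V" if "a \<in> Poly_Mapping.keys Q" for a
    using Q that by (auto simp: pvars_def)
  have mlead: "monic_lead (mval v a) (L a)" if "a \<in> Poly_Mapping.keys Q" for a
    unfolding mval_def L_def using keysV[OF that]
    by (intro monic_lead_prod monic_lead_power lead) auto
  have coeff: "Poly_Mapping.lookup (of_int c * f) t = c * Poly_Mapping.lookup f t" for c and f :: ipoly and t
    by (simp only: single_of_int[symmetric] mult_map_scale_conv_mult[symmetric]) (simp add: Poly_Mapping.map.rep_eq when_def)
  have kQ: "k \<in> Poly_Mapping.keys Q" using k by (simp add: K_def)
  have "Poly_Mapping.lookup (peval v Q) (L k) =
     (\<Sum>a\<in>Poly_Mapping.keys Q. Poly_Mapping.lookup Q a * Poly_Mapping.lookup (mval v a) (L k))"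
    by (simp add: peval_def lookup_sum coeff)
  also have "\<dots> = Poly_Mapping.lookup Q k +
     (\<Sum>a\<in>Poly_Mapping.keys Q - {k}. Poly_Mapping.lookup Q a * Poly_Mapping.lookup (mval v a) (L k))"
    using kQ mlead[OF kQ] by (simp add: sum.remove monic_lead_def)
  finally have eq: "Poly_Mapping.lookup Q k = Poly_Mapping.lookup (peval v Q) (L k) -
     (\<Sum>a\<in>Poly_Mapping.keys Q - {k}. Poly_Mapping.lookup Q a * Poly_Mapping.lookup (mval v a) (L k))"
    by simp
  \<comment> \<open>A monomial in K has a strictly smaller leading exponent and does not reach
    \<open>L k\<close>; one outside K has a coefficient divisible by M.\<close>
  have "M dvd Poly_Mapping.lookup Q a * Poly_Mapping.lookup (mval v a) (L k)"
    if a: "a \<in> Poly_Mapping.keys Q - {k}" for a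
  proof (cases "a \<in> K")
    case True
    hence "L a \<le> L k" using K k(2) unfolding \<Lambda>_def by (metis Max_ge finite_imageI imageI)
    moreover have "L a \<noteq> L k" using inj[of a k] keysV a kQ by auto
    ultimately have "\<not> L k \<le> L a" by simp
    hence "L k \<notin> Poly_Mapping.keys (mval v a)" using mlead[of a] a by (auto simp: monic_lead_def)
    thus ?thesis by (simp add: in_keys_iff)
  next
    case False
    thus ?thesis using a by (simp add: K_def)
  qed
  hence "M dvd Poly_Mapping.lookup Q k" unfolding eq using dvd by (intro dvd_diff dvd_sum)
  thus False using k by (simp add: K_def)
qed

lemma lookup_sum_single:
  "finite S \<Longrightarrow> Poly_Mapping.lookup (\<Sum>i\<in>S. Poly_Mapping.single i (1::nat)) t = (if t \<in> S then 1 else 0)"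
  by (simp add: lookup_sum lookup_single when_def)

lemma prod_pvar: "(\<Prod>i\<in>S. pvar i) = Poly_Mapping.single (\<Sum>i\<in>S. Poly_Mapping.single i 1) 1"
  by (induction S rule: infinite_finite_induct) (simp_all add: pvar_def mult_single)

text \<open>The product of the first j variables of the block dominates: at the least index t of T
  missing from another j-subset S, the two agree before t because T is an initial segment. The last
  index of T is a + j - 1, whence the unitriangular shape for j = 1, 2, ... The offset a serves the
  second block of variables in the product axiom.\<close>

lemma monic_lead_esym:
  assumes "j \<le> k"
  shows "monic_lead (esym {a..<a+k} j) (\<Sum>i\<in>{a..<a+j}. Poly_Mapping.single i 1)"
proof -
  define \<chi> where "\<chi> S = (\<Sum>i\<in>S. Poly_Mapping.single i (1::nat))" for S :: "nat set"
  define F where "F = {S. S \<subseteq> {a..<a+k} \<and> card S = j}"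
  define T where "T = {a..<a+j}"
  have finS: "finite S" if "S \<in> F" for S using that finite_subset[of S "{a..<a+k}"] by (auto simp: F_def)
  have finF: "finite F" unfolding F_def by (rule finite_subset[of _ "Pow {a..<a+k}"]) auto
  have T: "T \<in> F" using assms by (auto simp: T_def F_def)
  have lookup: "Poly_Mapping.lookup (\<chi> S) t = (if t \<in> S then 1 else 0)" if "finite S" for S t
    unfolding \<chi>_def by (rule lookup_sum_single[OF that])
  have lt: "\<chi> S < \<chi> T" if S: "S \<in> F" "S \<noteq> T" for S
  proof -
    have "\<not> T \<subseteq> S"
      using S T card_subset_eq[OF finS[OF S(1)], of T] by (auto simp: F_def)
    hence ne: "\<exists>t. t \<in> T \<and> t \<notin> S" by blast
    define t where "t = (LEAST t. t \<in> T \<and> t \<notin> S)"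
    have t: "t \<in> T" "t \<notin> S" unfolding t_def using LeastI_ex[OF ne] by auto
    have before: "s \<in> S \<longleftrightarrow> s \<in> T" if "s < t" for s
    proof
      assume "s \<in> S"
      thus "s \<in> T" using S(1) t(1) that by (auto simp: F_def T_def)
    next
      assume "s \<in> T"
      thus "s \<in> S" using not_less_Least[OF that[unfolded t_def]] by blast
    qed
    have "less_fun (Poly_Mapping.lookup (\<chi> S)) (Poly_Mapping.lookup (\<chi> T))"
      unfolding less_fun_def
      by (rule exI[of _ t]) (use t before lookup finS[OF S(1)] finS[OF T] in auto)
    thus ?thesis by (simp add: less_poly_mapping.rep_eq)
  qed
  have es: "esym {a..<a+k} j = (\<Sum>S\<in>F. Poly_Mapping.single (\<chi> S) 1)"
    unfolding esym_def F_def \<chi>_def by (simp add: prod_pvar)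
  have "Poly_Mapping.lookup (esym {a..<a+k} j) (\<chi> T) = (\<Sum>S\<in>F. if S = T then 1 else 0)"
    unfolding es lookup_sum lookup_single by (intro sum.cong refl) (use lt in \<open>force simp: when_def\<close>)
  also have "\<dots> = 1" using finF T by simp
  finally have "Poly_Mapping.lookup (esym {a..<a+k} j) (\<chi> T) = 1" .
  moreover have "\<nu> \<le> \<chi> T" if "\<nu> \<in> Poly_Mapping.keys (esym {a..<a+k} j)" for \<nu>
  proof -
    have "\<nu> \<in> \<chi> ` F"
      using that keys_sum[of "\<lambda>S. Poly_Mapping.single (\<chi> S) (1::int)" F] unfolding es by auto
    thus ?thesis using lt by (auto simp: le_less)
  qed
  ultimately show ?thesis by (simp add: monic_lead_def \<chi>_def T_def)
qed

instance poly_mapping :: (comm_monoid_add, torsion_free_ring) torsion_free_ring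
proof
  fix n :: nat and x :: "'a \<Rightarrow>\<^sub>0 'b"
  assume "of_nat n * x = 0"
  have "Poly_Mapping.lookup (of_nat n * x) k = of_nat n * Poly_Mapping.lookup x k" for k
    by (induction n) (simp_all add: lookup_add algebra_simps)
  hence "of_nat n * Poly_Mapping.lookup x k = 0" for k using \<open>of_nat n * x = 0\<close> by (metis lookup_zero)
  hence "n = 0 \<or> Poly_Mapping.lookup x k = 0" for k using of_nat_mult_eq_0 by blast
  thus "n = 0 \<or> x = 0" by (metis lookup_zero poly_mapping_eqI)
qed

instance int :: torsion_free_ring
  by standard auto

text \<open>A relation with denominator M gives Q' whose value at \<sigma> is M T; then M divides Q'
  coefficientwise and Q' / M is the described polynomial. Torsion-freeness cancels M on the side of
  \<open>v\<close> as well, so the value there is a.\<close>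

lemma peval_universal_polynomial:
  fixes v :: "nat \<Rightarrow> 'a::torsion_free_ring" and \<sigma> :: "nat \<Rightarrow> ipoly"
  assumes lead: "\<And>i. i \<in> V \<Longrightarrow> monic_lead (\<sigma> i) (\<mu> i)"
    and diag: "\<And>i. i \<in> V \<Longrightarrow> Poly_Mapping.lookup (\<mu> i) i = 1"
    and upper: "\<And>i t. i \<in> V \<Longrightarrow> i < t \<Longrightarrow> Poly_Mapping.lookup (\<mu> i) t = 0"
    and rr: "rationally_related V v \<sigma> a T"
  shows "peval v (THE Q. pvars Q \<subseteq> V \<and> psubst \<sigma> Q = T) = a"
proof -
  obtain M Q' where Q': "M > 0" "pvars Q' \<subseteq> V" "peval v Q' = of_nat M * a" "peval \<sigma> Q' = of_nat M * T"
    using rr unfolding rationally_related_def by blast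
  have lookup_M: "Poly_Mapping.lookup (of_nat M * f) k = of_nat M * Poly_Mapping.lookup f k" for f :: ipoly and k
    by (induction M) (simp_all add: lookup_add algebra_simps)
  have dvd: "int M dvd Poly_Mapping.lookup Q' m" for m
    using lead diag upper Q'(2) by (rule dvd_coeffs_of_dvd_coeffs_peval) (auto simp: Q'(4) lookup_M)
  define Q where "Q = Poly_Mapping.map (\<lambda>c. c div int M) Q'"
  have lookup_Q: "Poly_Mapping.lookup Q m = Poly_Mapping.lookup Q' m div int M" for m
    by (simp add: Q_def Poly_Mapping.map.rep_eq when_def)
  have Q: "Q' = of_nat M * Q"
    by (rule poly_mapping_eqI) (simp add: lookup_M lookup_Q dvd)
  have varsQ: "pvars Q \<subseteq> V"
  proof -
    have "Poly_Mapping.keys Q \<subseteq> Poly_Mapping.keys Q'" by (auto simp: in_keys_iff lookup_Q)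
    thus ?thesis using Q'(2) unfolding pvars_def by blast
  qed
  have "of_nat M * peval \<sigma> Q = of_nat M * T" "of_nat M * peval v Q = of_nat M * a"
    using Q'(3,4) unfolding Q by (simp_all add: peval_mult peval_of_nat)
  hence eqs: "peval \<sigma> Q = T" "peval v Q = a"
    using of_nat_mult_cancel \<open>M > 0\<close> by blast+
  have "(THE Q. pvars Q \<subseteq> V \<and> psubst \<sigma> Q = T) = Q"
  proof (rule the_equality)
    show "pvars Q \<subseteq> V \<and> psubst \<sigma> Q = T" using varsQ eqs by (simp add: psubst_eq_peval)
  next
    fix R assume R: "pvars R \<subseteq> V \<and> psubst \<sigma> R = T"
    have "0 dvd Poly_Mapping.lookup (R - Q) m" for m
    proof (rule dvd_coeffs_of_dvd_coeffs_peval[OF lead diag upper])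
      show "pvars (R - Q) \<subseteq> V"
        using pvars_add[of R "- Q"] R varsQ by (auto simp: pvars_uminus)
      show "0 dvd Poly_Mapping.lookup (peval \<sigma> (R - Q)) t" for t
        using R eqs peval_add[of \<sigma> R "- Q"] by (simp add: psubst_eq_peval peval_uminus)
    qed
    thus "R = Q" by (intro poly_mapping_eqI) (simp add: lookup_minus)
  qed
  thus ?thesis using eqs by simp
qed

subsection \<open>The product and composition axioms\<close>

lemma newton_esym:
  assumes "finite V"
  shows "newton (\<lambda>i. \<Sum>a\<in>V. pvar a ^ i) (Abs_fps (esym V))"
  using newton_elementary_symmetric[OF assms, of pvar] by (simp add: esym_def[abs_def])

context adams_operations
begin

text \<open>The power sums of the products of roots from two families are products of the two power
  sums, matching multiplicativity of the Adams operations. Newton's recursions translate at both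
  ends by the same rational polynomials; indices up to k suffice, so k variables per family are
  enough.\<close>

lemma lam_mult:
  assumes "k \<ge> 1"
  shows "lam k (x * y) = peval (\<lambda>i. if i < k then lam (i + 1) x else lam (i - k + 1) y) (lam_P k)"
proof -
  let ?v = "\<lambda>i. if i < k then lam (i + 1) x else lam (i - k + 1) y"
  let ?\<sigma> = "\<lambda>i. if i < k then esym {0..<k} (i + 1) else esym {k..<2*k} (i - k + 1)"
  let ?rr = "rationally_related {0..<2*k} ?v ?\<sigma>"
  \<comment> \<open>The leading exponent at index i fills the block of i from its start up to i, so
    unitriangularity holds across both blocks.\<close>
  define \<mu> where "\<mu> i = (\<Sum>t\<in>{if i < k then 0 else k..<i+1}. Poly_Mapping.single t (1::nat))" for i
  define z where "z = (\<lambda>(i, j). pvar i * pvar (k + j))"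
  have "?rr (lam (i + 1) x) (esym {0..<k} (i + 1))" if "i < k" for i
    using rationally_related_var[of i "{0..<2*k}" ?v ?\<sigma>] that by simp
  hence ex: "?rr (lam i x) (esym {0..<k} i)" if "1 \<le> i" "i \<le> k" for i
    using that by (cases i) auto
  have "?rr (lam (i + 1) y) (esym {k..<2*k} (i + 1))" if "i < k" for i
    using rationally_related_var[of "k + i" "{0..<2*k}" ?v ?\<sigma>] that by simp
  hence ey: "?rr (lam i y) (esym {k..<2*k} i)" if "1 \<le> i" "i \<le> k" for i
    using that by (cases i) auto
  have px: "?rr (\<psi> i x) (\<Sum>a\<in>{0..<k}. pvar a ^ i)" if "1 \<le> i" "i \<le> k" for i
    using newton_lam_series newton_esym _ that
    by (rule rationally_related_newton_power_sum[where n = k]) (use ex in \<open>auto simp: lam_def\<close>)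
  have py: "?rr (\<psi> i y) (\<Sum>a\<in>{k..<2*k}. pvar a ^ i)" if "1 \<le> i" "i \<le> k" for i
    using newton_lam_series newton_esym _ that
    by (rule rationally_related_newton_power_sum[where n = k]) (use ey in \<open>auto simp: lam_def\<close>)
  have "(\<Sum>a\<in>{0..<k} \<times> {0..<k}. z a ^ i) = (\<Sum>a\<in>{0..<k}. pvar a ^ i) * (\<Sum>a\<in>{k..<2*k}. pvar a ^ i)" for i
  proof -
    have "(\<Sum>a\<in>{k..<2*k}. pvar a ^ i) = (\<Sum>a\<in>{0..<k}. pvar (k + a) ^ i)"
      by (rule sum.reindex_bij_witness[of _ "\<lambda>a. k + a" "\<lambda>a. a - k"]) auto
    thus ?thesis by (simp add: z_def sum_product sum.cartesian_product case_prod_unfold power_mult_distrib)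
  qed
  hence pxy: "?rr (\<psi> i (x * y)) (\<Sum>a\<in>{0..<k} \<times> {0..<k}. z a ^ i)" if "1 \<le> i" "i \<le> k" for i
    using px[OF that] py[OF that] that by (simp add: psi_mult rationally_related_mult)
  have "?rr (fps_nth (lam_series (x * y)) k)
      (fps_nth (Abs_fps (\<lambda>k'. \<Sum>S | S \<subseteq> {0..<k} \<times> {0..<k} \<and> card S = k'. \<Prod>a\<in>S. z a)) k)"
    using newton_lam_series newton_elementary_symmetric pxy
    by (rule rationally_related_newton_coeff[where n = k]) auto
  hence "?rr (lam k (x * y)) (lam_prod_coeff k)"
    by (simp add: lam_def lam_prod_coeff_def z_def)
  hence "peval ?v (THE Q. pvars Q \<subseteq> {0..<2*k} \<and> psubst ?\<sigma> Q = lam_prod_coeff k) = lam k (x * y)"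
  proof (rule peval_universal_polynomial[rotated 3])
    fix i assume i: "i \<in> {0..<2*k}"
    show "monic_lead (?\<sigma> i) (\<mu> i)"
      using monic_lead_esym[of "i + 1" k 0] monic_lead_esym[of "i - k + 1" k k] i
      by (auto simp: \<mu>_def mult_2)
    show "Poly_Mapping.lookup (\<mu> i) i = 1" unfolding \<mu>_def by (subst lookup_sum_single) auto
    show "Poly_Mapping.lookup (\<mu> i) t = 0" if "i < t" for t
      using that unfolding \<mu>_def by (subst lookup_sum_single) auto
  qed
  thus ?thesis unfolding lam_P_def by simp
qed

text \<open>The j-th power sum of the n-fold products of roots is the n-th elementary symmetric
  function of their j-th powers, which corresponds to \<psi>_j(\<lambda>^n x). Its computation uses
  \<psi>_(i j) x with i \<le> n and j \<le> m, so m n roots suffice.\<close>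

lemma lam_comp:
  assumes "m \<ge> 1" "n \<ge> 1"
  shows "lam m (lam n x) = peval (\<lambda>i. lam (i + 1) x) (lam_PP m n)"
proof -
  let ?N = "m * n"
  let ?v = "\<lambda>i. lam (i + 1) x"
  let ?\<sigma> = "\<lambda>i. esym {0..<?N} (i + 1)"
  let ?rr = "rationally_related {0..<?N} ?v ?\<sigma>"
  let ?A = "{S. S \<subseteq> {0..<?N} \<and> card S = n}"
  define \<mu> where "\<mu> i = (\<Sum>t\<in>{0..<i+1}. Poly_Mapping.single t (1::nat))" for i :: nat
  define z where "z = (\<lambda>S. \<Prod>i\<in>S. pvar i)"
  have finA: "finite ?A" by (rule finite_subset[of _ "Pow {0..<?N}"]) auto
  have "?rr (lam (i + 1) x) (esym {0..<?N} (i + 1))" if "i < ?N" for i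
    using rationally_related_var[of i "{0..<?N}" ?v ?\<sigma>] that by simp
  hence e: "?rr (lam i x) (esym {0..<?N} i)" if "1 \<le> i" "i \<le> ?N" for i
    using that by (cases i) auto
  have p: "?rr (\<psi> i x) (\<Sum>a\<in>{0..<?N}. pvar a ^ i)" if "1 \<le> i" "i \<le> ?N" for i
    using newton_lam_series newton_esym _ that
    by (rule rationally_related_newton_power_sum[where n = ?N]) (use e in \<open>auto simp: lam_def\<close>)
  have pl: "?rr (\<psi> j (lam n x)) (\<Sum>S\<in>?A. z S ^ j)" if j: "1 \<le> j" "j \<le> m" for j
  proof -
    have "?rr (fps_nth (Abs_fps (\<lambda>n. \<psi> j (lam n x))) n)
      (fps_nth (Abs_fps (\<lambda>k. \<Sum>S | S \<subseteq> {0..<?N} \<and> card S = k. \<Prod>a\<in>S. pvar a ^ j)) n)"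
    proof (rule rationally_related_newton_coeff[where n = n])
      show "newton (\<lambda>i. \<psi> (i * j) x) (Abs_fps (\<lambda>n. \<psi> j (lam n x)))"
        using j by (intro newton_psi_lam) simp
      show "newton (\<lambda>i. \<Sum>a\<in>{0..<?N}. (pvar a ^ j) ^ i)
          (Abs_fps (\<lambda>k. \<Sum>S | S \<subseteq> {0..<?N} \<and> card S = k. \<Prod>a\<in>S. pvar a ^ j))"
        by (rule newton_elementary_symmetric) simp
      show "?rr (\<psi> (i * j) x) (\<Sum>a\<in>{0..<?N}. (pvar a ^ j) ^ i)" if "1 \<le> i" "i \<le> n" for i
        using p[of "i * j"] that j mult_le_mono[of i n j m]
        by (simp add: mult.commute flip: power_mult)
    qed simp
    thus ?thesis by (simp add: z_def prod_power_distrib)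
  qed
  have "?rr (fps_nth (lam_series (lam n x)) m)
      (fps_nth (Abs_fps (\<lambda>k. \<Sum>F | F \<subseteq> ?A \<and> card F = k. \<Prod>S\<in>F. z S)) m)"
    using newton_lam_series newton_elementary_symmetric[OF finA] pl
    by (rule rationally_related_newton_coeff[where n = m]) auto
  hence "?rr (lam m (lam n x)) (lam_comp_coeff m n)"
    by (simp add: lam_def[of m] lam_comp_coeff_def z_def)
  hence "peval ?v (THE Q. pvars Q \<subseteq> {0..<?N} \<and> psubst ?\<sigma> Q = lam_comp_coeff m n) = lam m (lam n x)"
  proof (rule peval_universal_polynomial[rotated 3])
    fix i assume i: "i \<in> {0..<?N}"
    show "monic_lead (?\<sigma> i) (\<mu> i)"
      using monic_lead_esym[of "i + 1" ?N 0] i by (auto simp: \<mu>_def)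
    show "Poly_Mapping.lookup (\<mu> i) i = 1" unfolding \<mu>_def by (subst lookup_sum_single) auto
    show "Poly_Mapping.lookup (\<mu> i) t = 0" if "i < t" for t
      using that unfolding \<mu>_def by (subst lookup_sum_single) auto
  qed
  thus ?thesis unfolding lam_PP_def by simp
qed

end

subsection \<open>Rational numbers integral at a prime\<close>

definition qint :: "nat \<Rightarrow> rat \<Rightarrow> bool" where
  "qint q c \<longleftrightarrow> (\<exists>k::int. \<not> int q dvd k \<and> of_int k * c \<in> \<int>)"

lemma qint_of_int: "prime q \<Longrightarrow> qint q (of_int a)"
  unfolding qint_def by (intro exI[of _ 1]) (auto simp: prime_nat_iff)

lemma qint_add:
  assumes "prime q" "qint q a" "qint q b"
  shows "qint q (a + b)"
proof -
  obtain k where k: "\<not> int q dvd k" "of_int k * a \<in> \<int>" using assms(2) unfolding qint_def by blast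
  obtain m where m: "\<not> int q dvd m" "of_int m * b \<in> \<int>" using assms(3) unfolding qint_def by blast
  have "of_int (k * m) * (a + b) = of_int m * (of_int k * a) + of_int k * (of_int m * b)"
    by (simp add: algebra_simps)
  moreover have "of_int m * (of_int k * a) + of_int k * (of_int m * b) \<in> \<int>"
    by (intro Ints_add Ints_mult[OF Ints_of_int] k(2) m(2))
  moreover have "\<not> int q dvd k * m"
    using k m assms(1) by (simp add: prime_dvd_mult_iff)
  ultimately show ?thesis unfolding qint_def by metis
qed

lemma qint_mult:
  assumes "prime q" "qint q a" "qint q b"
  shows "qint q (a * b)"
proof -
  obtain k where k: "\<not> int q dvd k" "of_int k * a \<in> \<int>" using assms(2) unfolding qint_def by blast
  obtain m where m: "\<not> int q dvd m" "of_int m * b \<in> \<int>" using assms(3) unfolding qint_def by blast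
  have "of_int (k * m) * (a * b) = (of_int k * a) * (of_int m * b)"
    by (simp add: algebra_simps)
  moreover have "(of_int k * a) * (of_int m * b) \<in> \<int>"
    by (rule Ints_mult[OF k(2) m(2)])
  moreover have "\<not> int q dvd k * m"
    using k m assms(1) by (simp add: prime_dvd_mult_iff)
  ultimately show ?thesis unfolding qint_def by metis
qed

lemma qint_uminus: "prime q \<Longrightarrow> qint q a \<Longrightarrow> qint q (- a)"
  using qint_mult[of q "of_int (-1)" a] qint_of_int[of q "-1"] by simp

lemma qint_diff: "prime q \<Longrightarrow> qint q a \<Longrightarrow> qint q b \<Longrightarrow> qint q (a - b)"
  using qint_add[of q a "- b"] qint_uminus[of q b] by simp

lemma qint_sum: "prime q \<Longrightarrow> (\<And>i. i \<in> A \<Longrightarrow> qint q (f i)) \<Longrightarrow> qint q (\<Sum>i\<in>A. f i)"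
  using qint_of_int[of q 0] by (induction A rule: infinite_finite_induct) (auto intro: qint_add)

lemma qint_divide:
  assumes "n > 0" "\<not> q dvd n"
  shows "qint q (of_int a / of_nat n)"
  unfolding qint_def using assms by (intro exI[of _ "int n"]) auto

lemma qint_divide_prime_power:
  assumes "prime q" "n > 0" "int (q ^ multiplicity q n) dvd a"
  shows "qint q (of_int a / of_nat n)"
proof -
  obtain m where m: "n = q ^ multiplicity q n * m" "\<not> q dvd m"
    using multiplicity_decompose'[of n q] assms by (metis not_prime_unit not_gr0)
  define Q where "Q = q ^ multiplicity q n"
  obtain b where b: "a = int Q * b" using assms(3) unfolding Q_def by blast
  have "n = Q * m" using m(1) unfolding Q_def by blast
  moreover have "Q > 0" using assms(1) by (simp add: Q_def prime_gt_0_nat)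
  ultimately have "of_int a / of_nat n = (of_int b / of_nat m :: rat)" unfolding b by simp
  thus ?thesis using qint_divide[of m q b] m(2) \<open>n = Q * m\<close> assms(2) by simp
qed

lemma Ints_if_all_qint:
  assumes "\<And>q. prime q \<Longrightarrow> qint q c"
  shows "c \<in> \<int>"
proof -
  obtain a b where ab: "quotient_of c = (a, b)" by force
  have c: "c = of_int a / of_int b" "b > 0" "coprime a b"
    using quotient_of_div[OF ab] quotient_of_denom_pos[OF ab] quotient_of_coprime[OF ab] by auto
  have "b = 1"
  proof (rule ccontr)
    assume "b \<noteq> 1"
    hence "nat b \<noteq> 1" using c by simp
    then obtain q where q: "prime q" "q dvd nat b" using prime_factor_nat by blast
    hence "int q dvd int (nat b)" by (simp only: int_dvd_int_iff)
    hence qb: "int q dvd b" using c(2) by simp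
    obtain k where k: "\<not> int q dvd k" "of_int k * c \<in> \<int>" using assms[OF q(1)] unfolding qint_def by blast
    then obtain z where "of_int k * c = of_int z" by (auto elim: Ints_cases)
    hence "of_int (k * a) = (of_int (z * b) :: rat)" using c(1,2) by (simp add: field_simps)
    hence "k * a = z * b" by (simp only: of_int_eq_iff)
    hence "int q dvd k * a" using qb by simp
    hence "int q dvd a" using k(1) q(1) by (simp add: prime_dvd_mult_iff)
    thus False using c(3) qb q(1) by (metis coprime_common_divisor not_prime_unit prime_nat_int_transfer)
  qed
  thus ?thesis using c(1) by simp
qed

lemma int_dvd_of_qint:
  assumes "prime q" "qint q (of_int a / of_nat q)"
  shows "int q dvd a"
proof -
  obtain k where k: "\<not> int q dvd k" "of_int k * (of_int a / of_nat q) \<in> (\<int> :: rat set)"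
    using assms(2) unfolding qint_def by blast
  then obtain z where "of_int k * (of_int a / of_nat q) = (of_int z :: rat)" by (auto elim: Ints_cases)
  hence "of_int (k * a) = (of_int (z * int q) :: rat)"
    using prime_gt_0_nat[OF assms(1)] by (simp add: field_simps)
  hence "k * a = z * int q" by (simp only: of_int_eq_iff)
  hence "int q dvd k * a" by simp
  thus ?thesis using k(1) assms(1) by (simp add: prime_dvd_mult_iff)
qed

lemma multiplicity_Suc: "prime (q :: nat) \<Longrightarrow> (n :: nat) > 0 \<Longrightarrow> multiplicity q (q * n) = Suc (multiplicity q n)"
  by (rule multiplicity_times_same) auto

lemma multiplicity_cofactor: "\<exists>m. n = q ^ multiplicity q n * m"
  using multiplicity_dvd[of q n] by blast

subsection \<open>Integral power series\<close>

definition fps_of_int :: "int fps \<Rightarrow> rat fps" where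
  "fps_of_int f = Abs_fps (\<lambda>n. of_int (fps_nth f n))"

lemma fps_of_int_nth [simp]: "fps_nth (fps_of_int f) n = of_int (fps_nth f n)"
  by (simp add: fps_of_int_def)

lemma fps_of_int_mult: "fps_of_int (f * g) = fps_of_int f * fps_of_int g"
  by (simp add: fps_eq_iff fps_mult_nth)

lemma fps_of_int_power: "fps_of_int (f ^ n) = fps_of_int f ^ n"
proof (induction n)
  case 0
  show ?case by (simp add: fps_eq_iff)
qed (simp add: fps_of_int_mult)

lemma fps_of_int_compose: "fps_of_int (f oo g) = fps_of_int f oo fps_of_int g"
  by (simp add: fps_eq_iff fps_compose_nth flip: fps_of_int_power)

lemma fps_of_int_inject: "fps_of_int f = fps_of_int g \<longleftrightarrow> f = g"
  by (simp add: fps_eq_iff)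

lemma dvd_int_fps_iff:
  fixes F :: "int fps"
  shows "of_nat q dvd F \<longleftrightarrow> (\<forall>n. int q dvd fps_nth F n)"
proof
  assume "\<forall>n. int q dvd fps_nth F n"
  hence "F = fps_const (of_nat q) * Abs_fps (\<lambda>n. fps_nth F n div int q)"
    by (intro fps_ext) simp
  thus "of_nat q dvd F" unfolding fps_of_nat by (rule dvdI)
next
  assume "of_nat q dvd F"
  then obtain G where "F = fps_const (of_nat q) * G" unfolding fps_of_nat by blast
  thus "\<forall>n. int q dvd fps_nth F n" by simp
qed

lemma fps_power_nth_cong:
  fixes f g :: "'a::comm_ring_1 fps"
  assumes "\<And>j. j \<le> N \<Longrightarrow> fps_nth f j = fps_nth g j"
  shows "fps_nth (f ^ n) N = fps_nth (g ^ n) N"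
  using assms
proof (induction n arbitrary: N)
  case (Suc n)
  show ?case unfolding power_Suc fps_mult_nth
    by (intro sum.cong refl arg_cong2[where f = "(*)"] Suc.IH Suc.prems) (use Suc.prems in auto)
qed simp

text \<open>With at least two factors and no constant terms, each factor contributes degree less
  than N to the coefficient of degree N. Hence in a composition with a logarithm only the linear
  term sees the unknown coefficient of degree N, which makes induction on N possible.\<close>

lemma fps_power_nth_cong_less:
  fixes f g :: "'a::comm_ring_1 fps"
  assumes eq: "\<And>j. j < N \<Longrightarrow> fps_nth f j = fps_nth g j"
    and zero: "fps_nth f 0 = 0" "fps_nth g 0 = 0" and n: "n \<ge> 2"
  shows "fps_nth (f ^ n) N = fps_nth (g ^ n) N"
proof -
  obtain k where k: "n = Suc k" "k \<ge> 1" using n by (cases n) auto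
  have k0: "fps_nth (f ^ k) 0 = 0" "fps_nth (g ^ k) 0 = 0"
    using zero k(2) by (simp_all add: fps_nth_power_0 power_0_left)
  have "fps_nth f i * fps_nth (f ^ k) (N - i) = fps_nth g i * fps_nth (g ^ k) (N - i)" if i: "i \<le> N" for i
  proof -
    consider "i = 0" | "i = N" | "0 < i" "i < N" using i by linarith
    thus ?thesis
    proof cases
      case 3
      hence "fps_nth (f ^ k) (N - i) = fps_nth (g ^ k) (N - i)"
        by (intro fps_power_nth_cong eq) auto
      thus ?thesis using eq[OF 3(2)] by simp
    qed (use zero k0 in simp_all)
  qed
  thus ?thesis unfolding k(1) power_Suc fps_mult_nth by (intro sum.cong refl) auto
qed

lemma fps_compose_X_power_nth:
  fixes f :: "'a::comm_ring_1 fps"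
  assumes "q > 0"
  shows "fps_nth (f oo fps_X ^ q) n = (if q dvd n then fps_nth f (n div q) else 0)"
proof -
  have "fps_nth (f oo fps_X ^ q) n = (\<Sum>i=0..n. if i * q = n then fps_nth f i else 0)"
    unfolding fps_compose_nth
    by (intro sum.cong refl) (auto simp: power_mult[symmetric] fps_X_power_nth mult.commute)
  also have "\<dots> = (if q dvd n then fps_nth f (n div q) else 0)"
  proof (cases "q dvd n")
    case True
    then obtain m where "n = q * m" by blast
    hence m: "n = m * q" by simp
    have "(\<Sum>i=0..n. if i * q = n then fps_nth f i else 0) = (\<Sum>i=0..n. if i = m then fps_nth f i else 0)"
      using assms by (intro sum.cong refl) (simp add: m)
    thus ?thesis using assms by (simp add: m)
  next
    case False
    thus ?thesis by (auto intro!: sum.neutral)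
  qed
  finally show ?thesis .
qed

section \<open>Frobenius congruences for integral power series in one variable\<close>

lemma fermat_int:
  assumes "prime q"
  shows "int q dvd a ^ q - a"
proof -
  define b where "b = nat (a mod int q)"
  have q: "int q > 0" using prime_gt_0_nat[OF assms] by simp
  have b: "int b = a mod int q" using q by (simp add: b_def)
  have ab: "int q dvd a - int b" unfolding b by (simp add: minus_mod_eq_mult_div)
  have "a - int b dvd a ^ q - int b ^ q" by (simp only: power_diff_sumr2 dvd_triv_left)
  hence "int q dvd a ^ q - int b ^ q" by (rule dvd_trans[OF ab])
  moreover have "int q dvd int b ^ q - int b"
    using prime_dvd_frobenius_sum[OF assms, of "\<lambda>i. 1 :: int" "{..<b}"] by simp
  ultimately have "int q dvd (a ^ q - int b ^ q) + (int b ^ q - int b) - (a - int b)"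
    by (rule dvd_diff[OF dvd_add ab])
  thus ?thesis by simp
qed

text \<open>The coefficient of degree N depends only on the polynomial g truncated at N. There
  additivity of the p-th power modulo p reduces to monomials, and Fermat's little theorem handles
  their coefficients.\<close>

lemma prime_dvd_fps_frobenius:
  fixes f :: "int fps"
  assumes "prime q"
  shows "of_nat q dvd f ^ q - (f oo fps_X ^ q)"
  unfolding dvd_int_fps_iff
proof
  fix N
  define g where "g = (\<Sum>i\<le>N. fps_const (fps_nth f i) * fps_X ^ i)"
  define h where "h = (\<Sum>i\<le>N. fps_const (fps_nth f i) * fps_X ^ (i * q))"
  have q: "q > 0" using assms by (rule prime_gt_0_nat)
  have "fps_nth g j = fps_nth f j" if "j \<le> N" for j
    using that by (simp add: g_def fps_sum_nth if_distrib[of "\<lambda>x. _ * x"] cong: if_cong)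
  hence 1: "fps_nth (f ^ q) N = fps_nth (g ^ q) N" by (intro fps_power_nth_cong) simp
  have "of_nat q dvd g ^ q - (\<Sum>i\<le>N. (fps_const (fps_nth f i) * fps_X ^ i) ^ q)"
    unfolding g_def by (rule prime_dvd_frobenius_sum[OF assms])
  moreover have "of_nat q dvd (\<Sum>i\<le>N. (fps_const (fps_nth f i) * fps_X ^ i) ^ q) - h"
    unfolding h_def sum_subtractf[symmetric]
  proof (rule dvd_sum)
    fix i
    have "(fps_const (fps_nth f i) * fps_X ^ i) ^ q - fps_const (fps_nth f i) * fps_X ^ (i * q)
      = fps_const (fps_nth f i ^ q - fps_nth f i) * fps_X ^ (i * q)"
      by (simp add: power_mult_distrib power_mult fps_const_power left_diff_distrib flip: fps_const_sub)
    moreover obtain c where "fps_nth f i ^ q - fps_nth f i = int q * c"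
      using fermat_int[OF assms] by blast
    ultimately have "(fps_const (fps_nth f i) * fps_X ^ i) ^ q - fps_const (fps_nth f i) * fps_X ^ (i * q)
      = fps_const (of_nat q) * (fps_const c * fps_X ^ (i * q))"
      by (simp only: mult.assoc[symmetric] fps_const_mult)
    thus "of_nat q dvd (fps_const (fps_nth f i) * fps_X ^ i) ^ q - fps_const (fps_nth f i) * fps_X ^ (i * q)"
      unfolding fps_of_nat by simp
  qed
  ultimately have "of_nat q dvd (g ^ q - (\<Sum>i\<le>N. (fps_const (fps_nth f i) * fps_X ^ i) ^ q)) +
      ((\<Sum>i\<le>N. (fps_const (fps_nth f i) * fps_X ^ i) ^ q) - h)" by (rule dvd_add)
  hence "int q dvd fps_nth (g ^ q - h) N" unfolding dvd_int_fps_iff by simp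
  moreover have "fps_nth h N = fps_nth (f oo fps_X ^ q) N"
  proof -
    have "fps_nth h N = (\<Sum>i\<le>N. if i * q = N then fps_nth f i else 0)"
      unfolding h_def fps_sum_nth by (intro sum.cong refl) simp
    also have "\<dots> = fps_nth (f oo fps_X ^ q) N"
      unfolding fps_compose_nth atLeast0AtMost
      by (intro sum.cong refl) (auto simp: power_mult[symmetric] fps_X_power_nth mult.commute)
    finally show ?thesis .
  qed
  ultimately show "int q dvd fps_nth (f ^ q - (f oo fps_X ^ q)) N" using 1 by simp
qed

subsection \<open>Commuting power series attached to a sign character\<close>

locale sign_character =
  fixes \<epsilon> :: "nat \<Rightarrow> int"
  assumes eps_1: "\<epsilon> 1 = 1"
    and eps_mult: "m > 0 \<Longrightarrow> n > 0 \<Longrightarrow> \<epsilon> (m * n) = \<epsilon> m * \<epsilon> n"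
    and eps_sq: "n > 0 \<Longrightarrow> \<epsilon> n * \<epsilon> n = 1"
begin

text \<open>For \<epsilon> = 1 this is -log(1 - x). The constant term is 0, whatever
  \<open>\<epsilon> 0\<close> is, since division by zero yields 0.\<close>

definition log_series :: "rat fps" where
  "log_series = Abs_fps (\<lambda>n. of_int (\<epsilon> n) / of_nat n)"

text \<open>Conjugating the scalar \<epsilon>(m) m by the logarithm gives an endomorphism of the
  corresponding formal group; multiplicativity of the scalar in m becomes the composition
  law.\<close>

definition rat_mult_series :: "nat \<Rightarrow> rat fps" where
  "rat_mult_series m = fps_inv log_series oo (fps_const (of_int (\<epsilon> m) * of_nat m) * log_series)"

lemma log_series_nth: "fps_nth log_series n = of_int (\<epsilon> n) / of_nat n"
  by (simp add: log_series_def)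

lemma log_series_0 [simp]: "fps_nth log_series 0 = 0"
  by (simp add: log_series_nth)

lemma log_series_1 [simp]: "fps_nth log_series (Suc 0) = 1"
  using eps_1 by (simp add: log_series_nth)

lemma fps_inv_log_series_0 [simp]: "fps_nth (fps_inv log_series) 0 = 0"
  by (simp add: fps_inv_def)

lemma rat_mult_series_0 [simp]: "fps_nth (rat_mult_series m) 0 = 0"
  by (simp add: rat_mult_series_def)

lemma log_compose_rat_mult_series:
  "log_series oo rat_mult_series m = fps_const (of_int (\<epsilon> m) * of_nat m) * log_series"
proof -
  have "log_series oo rat_mult_series m =
    (log_series oo fps_inv log_series) oo (fps_const (of_int (\<epsilon> m) * of_nat m) * log_series)"
    unfolding rat_mult_series_def by (rule fps_compose_assoc) simp_all
  also have "log_series oo fps_inv log_series = fps_X" by (rule fps_inv_right) simp_all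
  finally show ?thesis by (simp add: fps_X_fps_compose_startby0)
qed

lemma log_series_cancel:
  assumes "log_series oo f = log_series oo g" "fps_nth f 0 = 0" "fps_nth g 0 = 0"
  shows "f = g"
proof -
  have "fps_inv log_series oo (log_series oo h) = h" if "fps_nth h 0 = 0" for h
  proof -
    have "fps_inv log_series oo (log_series oo h) = (fps_inv log_series oo log_series) oo h"
      by (rule fps_compose_assoc) (simp_all add: that)
    also have "fps_inv log_series oo log_series = fps_X" by (rule fps_inv) simp_all
    finally show ?thesis using that by (simp add: fps_X_fps_compose_startby0)
  qed
  thus ?thesis using assms by metis
qed

lemma rat_mult_series_compose:
  assumes "m > 0" "n > 0"
  shows "rat_mult_series m oo rat_mult_series n = rat_mult_series (m * n)"
proof (rule log_series_cancel)
  have "log_series oo (rat_mult_series m oo rat_mult_series n) =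
      (log_series oo rat_mult_series m) oo rat_mult_series n"
    by (rule fps_compose_assoc) simp_all
  also have "\<dots> = fps_const (of_int (\<epsilon> m) * of_nat m) * (log_series oo rat_mult_series n)"
    unfolding log_compose_rat_mult_series[of m] by (rule fps_const_mult_apply_left[symmetric])
  also have "\<dots> = log_series oo rat_mult_series (m * n)"
  proof -
    have "of_int (\<epsilon> (m * n)) * of_nat (m * n) = of_int (\<epsilon> m) * of_nat m * (of_int (\<epsilon> n) * of_nat n :: rat)"
      using assms by (simp add: eps_mult)
    thus ?thesis
      unfolding log_compose_rat_mult_series by (simp only: mult.assoc[symmetric] fps_const_mult)
  qed
  finally show "log_series oo (rat_mult_series m oo rat_mult_series n) = log_series oo rat_mult_series (m * n)" .
qed simp_all

lemma log_compose_nth: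
  assumes "N > 0"
  shows "fps_nth (log_series oo f) N = (\<Sum>n=1..N. of_int (\<epsilon> n) / of_nat n * fps_nth (f ^ n) N)"
proof -
  have "{0..N} = insert 0 {1..N}" by auto
  thus ?thesis by (simp add: fps_compose_nth log_series_nth)
qed

lemma rat_mult_series_rec:
  assumes "N > 0"
  shows "(\<Sum>n=1..N. of_int (\<epsilon> n) / of_nat n * fps_nth (rat_mult_series m ^ n) N) =
     of_int (\<epsilon> m) * of_nat m * (of_int (\<epsilon> N) / of_nat N)"
  using log_compose_nth[OF assms, of "rat_mult_series m"]
  unfolding log_compose_rat_mult_series by (simp add: log_series_nth)

lemma rat_mult_series_1: "fps_nth (rat_mult_series m) 1 = of_int (\<epsilon> m) * of_nat m"
  using rat_mult_series_rec[of 1 m] eps_1 by simp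

text \<open>The induction behind the functional equation lemma: modulo \<open>q\<close>-integral rationals, the terms
  of \<open>log_series oo h\<close> with index divisible by \<open>q\<close> depend on \<open>h(x\<^sup>q)\<close> only, and they add up to the
  coefficient of the right-hand side.\<close>
lemma rat_mult_series_integral: "m > 0 \<Longrightarrow> fps_nth (rat_mult_series m) N \<in> \<int>"
proof (induction N rule: less_induct)
  case (less N)
  show ?case
  proof (cases "N = 0")
    case False
    hence N: "N > 0" by simp
    define h where "h = rat_mult_series m"
    \<comment> \<open>Below degree N the series is integral by induction. The unknown coefficient of
      degree N is replaced by 0, which does not change degree N of the powers with exponent at least
      2.\<close>
    define g where "g = Abs_fps (\<lambda>j. if j < N then \<lfloor>fps_nth h j\<rfloor> else 0)"
    have gh: "fps_nth (fps_of_int g) j = fps_nth h j" if "j < N" for j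
      using less.IH[OF that less.prems] that by (auto simp: g_def h_def elim: Ints_cases)
    have g0: "fps_nth g 0 = 0" using gh[OF N] by (simp add: h_def)
    have gpow: "fps_nth (h ^ n) N = of_int (fps_nth (g ^ n) N)" if "n \<ge> 2" for n
      using fps_power_nth_cong_less[of N h "fps_of_int g" n] gh g0 that
      by (simp add: h_def fps_of_int_power[symmetric])
    define t :: "nat \<Rightarrow> rat" where "t n = of_int (\<epsilon> n) / of_nat n * of_int (fps_nth (g ^ n) N)" for n
    have hN: "fps_nth h N = of_int (\<epsilon> m) * of_nat m * (of_int (\<epsilon> N) / of_nat N) - (\<Sum>n=2..N. t n)"
    proof -
      have "{1..N} = insert 1 {2..N}" using N by auto
      moreover have "(\<Sum>n=2..N. of_int (\<epsilon> n) / of_nat n * fps_nth (h ^ n) N) = (\<Sum>n=2..N. t n)"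
        by (intro sum.cong refl) (simp add: t_def gpow)
      ultimately show ?thesis using rat_mult_series_rec[OF N, of m] eps_1 by (simp add: h_def)
    qed
    have "qint q (fps_nth h N)" if q: "prime q" for q
    proof -
      have q2: "q \<ge> 2" using q by (rule prime_ge_2_nat)
      define G where "G = g oo fps_X ^ q"
      define s where "s n = of_int (\<epsilon> (q * n)) / of_nat (q * n) * (of_int (fps_nth (G ^ n) N) :: rat)" for n
      have split: "(\<Sum>n=2..N. t n) =
          (\<Sum>n\<in>{n\<in>{2..N}. \<not> q dvd n}. t n) + (\<Sum>n=1..N div q. t (q * n))"
      proof -
        have "(\<Sum>n=2..N. t n) = (\<Sum>n\<in>{n\<in>{2..N}. \<not> q dvd n}. t n) + (\<Sum>n\<in>{n\<in>{2..N}. q dvd n}. t n)"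
          by (subst sum.union_disjoint[symmetric]) (auto intro!: sum.cong)
        also have "(\<Sum>n\<in>{n\<in>{2..N}. q dvd n}. t n) = (\<Sum>n=1..N div q. t (q * n))"
        proof (rule sum.reindex_bij_witness[of _ "\<lambda>n. q * n" "\<lambda>n. n div q"])
          fix n assume n: "n \<in> {n\<in>{2..N}. q dvd n}"
          then obtain j where j: "n = q * j" by blast
          have "j > 0" using n j by (cases j) auto
          moreover have "j \<le> N div q" using n j q2 by (simp add: less_eq_div_iff_mult_less_eq mult.commute)
          ultimately show "q * (n div q) = n" "n div q \<in> {1..N div q}" "t (q * (n div q)) = t n"
            using j q2 by simp_all
        next
          fix n assume n: "n \<in> {1..N div q}"
          have "2 * 1 \<le> q * n" using n q2 by (intro mult_le_mono) auto
          moreover have "q * n \<le> N" using n q2 by (simp add: less_eq_div_iff_mult_less_eq mult.commute)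
          ultimately show "q * n \<in> {n\<in>{2..N}. q dvd n}" "q * n div q = n" using q2 by auto
        qed
        finally show ?thesis .
      qed
      \<comment> \<open>Since g^q and g(x^q) agree modulo q, their n-th powers agree modulo q^(v+1),
        where q^v is the exact power of q in n. This clears the q-part of the denominator q
        n.\<close>
      have ts: "qint q (t (q * n) - s n)" if n: "n > 0" for n
      proof -
        have "of_nat q dvd g ^ q - G" unfolding G_def by (rule prime_dvd_fps_frobenius[OF q])
        moreover obtain n' where n': "n = q ^ multiplicity q n * n'" using multiplicity_cofactor by blast
        ultimately have "of_nat (q ^ Suc (multiplicity q n)) dvd (g ^ q) ^ n - G ^ n"
          using dvd_diff_power_prime_power_mult[of q "g ^ q" G "multiplicity q n" n'] by simp
        hence "int (q ^ multiplicity q (q * n)) dvd fps_nth (g ^ (q * n)) N - fps_nth (G ^ n) N"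
          unfolding dvd_int_fps_iff power_mult[symmetric] multiplicity_Suc[OF q n] by simp
        hence "int (q ^ multiplicity q (q * n)) dvd \<epsilon> (q * n) * (fps_nth (g ^ (q * n)) N - fps_nth (G ^ n) N)"
          by (rule dvd_mult)
        hence "qint q (of_int (\<epsilon> (q * n) * (fps_nth (g ^ (q * n)) N - fps_nth (G ^ n) N)) / of_nat (q * n))"
          using n q by (intro qint_divide_prime_power) (auto simp: prime_gt_0_nat)
        thus ?thesis by (simp add: t_def s_def diff_divide_distrib right_diff_distrib)
      qed
      \<comment> \<open>If q divides N, the coefficient of x^N in g(x^q)^n is that of x^(N/q) in
        h^n; multiplicativity of \<epsilon> pulls out \<epsilon>(q)/q, and the recursion in degree
        N/q shows that the difference is exactly 0. Otherwise the sum vanishes and the remaining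
        term has denominator prime to q.\<close>
      have main: "qint q (of_int (\<epsilon> m) * of_nat m * (of_int (\<epsilon> N) / of_nat N) - (\<Sum>n=1..N div q. s n))"
      proof (cases "q dvd N")
        case False
        have "s n = 0" if "n > 0" for n
        proof -
          have "G ^ n = (g ^ n) oo fps_X ^ q" unfolding G_def using q2 by (intro fps_compose_power) auto
          thus ?thesis using False q2 by (simp add: s_def fps_compose_X_power_nth)
        qed
        hence "(\<Sum>n=1..N div q. s n) = 0" by (intro sum.neutral) auto
        moreover have "qint q (of_int (\<epsilon> m * int m) * (of_int (\<epsilon> N) / of_nat N))"
          using False N q by (intro qint_mult qint_of_int qint_divide)
        ultimately show ?thesis by simp
      next
        case True
        then obtain N' where N': "N = q * N'" by blast
        have N'0: "N' > 0" "N' < N" using N N' q2 by auto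
        have "s n = of_int (\<epsilon> q) / of_nat q * (of_int (\<epsilon> n) / of_nat n * fps_nth (h ^ n) N')" if "n > 0" for n
        proof -
          have "G ^ n = (g ^ n) oo fps_X ^ q" unfolding G_def using q2 by (intro fps_compose_power) auto
          hence "fps_nth (G ^ n) N = fps_nth (g ^ n) N'" using q2 N' by (simp add: fps_compose_X_power_nth)
          moreover have "fps_nth (fps_of_int g ^ n) N' = fps_nth (h ^ n) N'"
            using N'0 by (intro fps_power_nth_cong gh) auto
          ultimately have "of_int (fps_nth (G ^ n) N) = fps_nth (h ^ n) N'"
            by (simp flip: fps_of_int_power)
          thus ?thesis using that q2 by (simp add: s_def eps_mult)
        qed
        hence "(\<Sum>n=1..N'. s n) = of_int (\<epsilon> q) / of_nat q *
            (\<Sum>n=1..N'. of_int (\<epsilon> n) / of_nat n * fps_nth (h ^ n) N')"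
          by (simp add: sum_distrib_left)
        also have "\<dots> = of_int (\<epsilon> q) / of_nat q * (of_int (\<epsilon> m) * of_nat m * (of_int (\<epsilon> N') / of_nat N'))"
          unfolding h_def rat_mult_series_rec[OF N'0(1)] ..
        also have "\<dots> = of_int (\<epsilon> m) * of_nat m * (of_int (\<epsilon> N) / of_nat N)"
          using N'0 q2 by (simp add: N' eps_mult)
        finally show ?thesis using N' q2 qint_of_int[OF q, of 0] by simp
      qed
      have 1: "qint q (\<Sum>n\<in>{n\<in>{2..N}. \<not> q dvd n}. t n)"
      proof (rule qint_sum[OF q])
        fix n assume n: "n \<in> {n\<in>{2..N}. \<not> q dvd n}"
        thus "qint q (t n)" unfolding t_def using q by (intro qint_mult qint_divide qint_of_int) auto
      qed
      have 2: "qint q (\<Sum>n=1..N div q. t (q * n) - s n)"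
        by (rule qint_sum[OF q]) (rule ts, simp)
      have 3: "fps_nth h N = (of_int (\<epsilon> m) * of_nat m * (of_int (\<epsilon> N) / of_nat N) - (\<Sum>n=1..N div q. s n))
        - (\<Sum>n\<in>{n\<in>{2..N}. \<not> q dvd n}. t n) - (\<Sum>n=1..N div q. t (q * n) - s n)"
        unfolding hN split by (simp add: sum_subtractf)
      show ?thesis unfolding 3 by (rule qint_diff[OF q qint_diff[OF q main 1] 2])
    qed
    thus ?thesis unfolding h_def by (rule Ints_if_all_qint)
  qed simp
qed

definition mult_series :: "nat \<Rightarrow> int fps" where
  "mult_series m = Abs_fps (\<lambda>n. \<lfloor>fps_nth (rat_mult_series m) n\<rfloor>)"

lemma fps_of_int_mult_series: "m > 0 \<Longrightarrow> fps_of_int (mult_series m) = rat_mult_series m"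
  using rat_mult_series_integral by (auto simp: fps_eq_iff mult_series_def elim: Ints_cases)

lemma mult_series_0: "fps_nth (mult_series m) 0 = 0"
  by (simp add: mult_series_def)

lemma mult_series_linear: "fps_nth (mult_series m) 1 = \<epsilon> m * int m"
proof -
  have "fps_nth (rat_mult_series m) 1 = of_int (\<epsilon> m * int m)"
    unfolding rat_mult_series_1 by simp
  thus ?thesis unfolding mult_series_def fps_nth_Abs_fps by (simp only: floor_of_int)
qed

lemma mult_series_compose:
  "m > 0 \<Longrightarrow> n > 0 \<Longrightarrow> mult_series m oo mult_series n = mult_series (m * n)"
  by (simp add: fps_of_int_inject[symmetric] fps_of_int_compose fps_of_int_mult_series rat_mult_series_compose)

lemma mult_series_1: "mult_series 1 = fps_X"
proof -
  have "rat_mult_series 1 = fps_X"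
  proof (rule log_series_cancel)
    show "log_series oo rat_mult_series 1 = log_series oo fps_X"
      unfolding log_compose_rat_mult_series using eps_1 by simp
  qed simp_all
  thus ?thesis by (simp add: fps_eq_iff mult_series_def)
qed

text \<open>Compare l(u_p) = \<epsilon>(p) p l(x) with l(x^p): in degrees prime to p the difference
  is p times a p-integral number, in degrees divisible by p it vanishes because \<epsilon>(p)^2 = 1.
  By induction the terms of index n \<ge> 2 are congruent modulo p, so the linear terms u_p and x^p
  are congruent as well.\<close>

lemma mult_series_prime:
  assumes p: "prime p"
  shows "of_nat p dvd mult_series p - fps_X ^ p"
  unfolding dvd_int_fps_iff
proof
  fix N
  define u where "u = mult_series p"
  have p2: "p \<ge> 2" using p by (rule prime_ge_2_nat)
  have "int p dvd fps_nth (u - fps_X ^ p) N"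
  proof (induction N rule: less_induct)
    case (less N)
    show ?case
    proof (cases "N = 0")
      case True
      thus ?thesis using p2 mult_series_0[of p] by (simp add: u_def fps_X_power_nth)
    next
      case False
      hence N: "N > 0" by simp
      \<comment> \<open>Cutting both series off below degree N turns the induction hypothesis into a
        congruence of whole series, which can then be raised to powers.\<close>
      define f where "f = Abs_fps (\<lambda>j. if j < N then fps_nth u j else 0)"
      define g where "g = Abs_fps (\<lambda>j. if j < N then fps_nth (fps_X ^ p :: int fps) j else 0)"
      have fg: "of_nat p dvd f - g"
        unfolding dvd_int_fps_iff using less.IH by (auto simp: f_def g_def)
      define d where "d n = fps_nth (u ^ n) N - fps_nth ((fps_X ^ p :: int fps) ^ n) N" for n
      \<comment> \<open>The exponent exceeds the power of p in n by one: after division by n a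
        factor p remains.\<close>
      have d: "int (p ^ Suc (multiplicity p n)) dvd d n" if n: "n \<ge> 2" for n
      proof -
        have "fps_nth (u ^ n) N = fps_nth (f ^ n) N"
          using n N p2 mult_series_0[of p] by (intro fps_power_nth_cong_less) (auto simp: f_def u_def)
        moreover have "fps_nth ((fps_X ^ p :: int fps) ^ n) N = fps_nth (g ^ n) N"
          using n N p2 by (intro fps_power_nth_cong_less) (auto simp: g_def fps_X_power_nth)
        moreover obtain n' where n': "n = p ^ multiplicity p n * n'" using multiplicity_cofactor by blast
        hence "of_nat (p ^ Suc (multiplicity p n)) dvd f ^ n - g ^ n"
          using dvd_diff_power_prime_power_mult[OF fg, of "multiplicity p n" n'] by simp
        ultimately show ?thesis unfolding dvd_int_fps_iff d_def by simp
      qed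
      define R where "R = (\<Sum>n=2..N. of_int (\<epsilon> n) / of_nat n * (of_int (d n) :: rat))"
      have R: "qint p (R / of_nat p)"
        unfolding R_def sum_divide_distrib
      proof (intro qint_sum p)
        fix n assume n: "n \<in> {2..N}"
        then obtain c where c: "d n = int (p ^ Suc (multiplicity p n)) * c" using d[of n] by auto
        have "of_int (\<epsilon> n) / of_nat n * of_int (d n) / of_nat p =
            (of_int (\<epsilon> n * (int (p ^ multiplicity p n) * c)) / of_nat n :: rat)"
          unfolding c using p2 by simp
        moreover have "qint p \<dots>" using n p by (intro qint_divide_prime_power) auto
        ultimately show "qint p (of_int (\<epsilon> n) / of_nat n * of_int (d n) / of_nat p)" by simp
      qed
      have "fps_nth (log_series oo fps_of_int (fps_X ^ p)) N =
          (\<Sum>n=1..N. of_int (\<epsilon> n) / of_nat n * of_int (fps_nth ((fps_X ^ p) ^ n) N))"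
        unfolding log_compose_nth[OF N] by (simp flip: fps_of_int_power)
      moreover have "fps_nth (log_series oo fps_of_int u) N =
          (\<Sum>n=1..N. of_int (\<epsilon> n) / of_nat n * of_int (fps_nth (u ^ n) N))"
        unfolding log_compose_nth[OF N] by (simp flip: fps_of_int_power)
      moreover have "{1..N} = insert 1 {2..N}" using N by auto
      ultimately have sum: "fps_nth (log_series oo fps_of_int u) N - fps_nth (log_series oo fps_of_int (fps_X ^ p)) N
          = of_int (fps_nth (u - fps_X ^ p) N) + R"
        using eps_1 by (simp add: R_def d_def sum_subtractf right_diff_distrib)
      have lu: "fps_nth (log_series oo fps_of_int u) N = of_int (\<epsilon> p) * of_nat p * (of_int (\<epsilon> N) / of_nat N)"
        using p2 by (simp add: u_def fps_of_int_mult_series log_compose_rat_mult_series log_series_nth)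
      have "fps_of_int (fps_X ^ p) = fps_X ^ p" by (simp add: fps_eq_iff fps_X_power_nth)
      hence lX: "fps_nth (log_series oo fps_of_int (fps_X ^ p)) N =
          (if p dvd N then fps_nth log_series (N div p) else 0)"
        using p2 by (simp add: fps_compose_X_power_nth)
      have "qint p ((fps_nth (log_series oo fps_of_int u) N - fps_nth (log_series oo fps_of_int (fps_X ^ p)) N) / of_nat p)"
      proof (cases "p dvd N")
        case False
        have "qint p (of_int (\<epsilon> p) * (of_int (\<epsilon> N) / of_nat N))"
          using False N p by (intro qint_mult qint_of_int qint_divide)
        thus ?thesis using False p2 by (simp add: lu lX)
      next
        case True
        then obtain N' where N': "N = p * N'" by blast
        hence N'0: "N' > 0" using N by simp
        have "of_int (\<epsilon> p) * of_nat p * (of_int (\<epsilon> N) / of_nat N) =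
            (of_int (\<epsilon> p) * of_int (\<epsilon> p) * (of_int (\<epsilon> N') / of_nat N') :: rat)"
          using N'0 p2 by (simp add: N' eps_mult)
        also have "of_int (\<epsilon> p) * of_int (\<epsilon> p) = (1 :: rat)"
          using eps_sq[of p] p2 by (simp flip: of_int_mult)
        finally have "of_int (\<epsilon> p) * of_nat p * (of_int (\<epsilon> N) / of_nat N) = (of_int (\<epsilon> N') / of_nat N' :: rat)"
          by (simp only: mult_1)
        moreover have "N div p = N'" using N' p2 by simp
        ultimately have "fps_nth (log_series oo fps_of_int u) N = fps_nth (log_series oo fps_of_int (fps_X ^ p)) N"
          using True by (simp only: lu lX log_series_nth if_True)
        thus ?thesis using qint_of_int[OF p, of 0] by simp
      qed
      hence "qint p ((fps_nth (log_series oo fps_of_int u) N - fps_nth (log_series oo fps_of_int (fps_X ^ p)) N) / of_nat p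
          - R / of_nat p)" using R by (intro qint_diff p)
      hence "qint p (of_int (fps_nth (u - fps_X ^ p) N) / of_nat p)"
        unfolding sum by (simp add: add_divide_distrib)
      thus ?thesis by (intro int_dvd_of_qint p)
    qed
  qed
  thus "int p dvd fps_nth (mult_series p - fps_X ^ p) N" by (simp add: u_def)
qed

end

subsection \<open>Power series in infinitely many variables\<close>

text \<open>Divisibility of monomials, that is, the pointwise order; the order that exponents carry
  as a type is the linear one used for leading terms.\<close>

definition below :: "(nat \<Rightarrow>\<^sub>0 nat) \<Rightarrow> (nat \<Rightarrow>\<^sub>0 nat) set" where
  "below e = {a. \<forall>i. Poly_Mapping.lookup a i \<le> Poly_Mapping.lookup e i}"

lemma belowD: "a \<in> below e \<Longrightarrow> Poly_Mapping.lookup a i \<le> Poly_Mapping.lookup e i"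
  by (simp add: below_def)

lemma keys_below: "a \<in> below e \<Longrightarrow> Poly_Mapping.keys a \<subseteq> Poly_Mapping.keys e"
proof
  fix i assume "a \<in> below e" "i \<in> Poly_Mapping.keys a"
  thus "i \<in> Poly_Mapping.keys e" using belowD[of a e i] by (simp add: in_keys_iff)
qed

lemma below_refl [simp]: "e \<in> below e"
  by (simp add: below_def)

lemma zero_below [simp]: "0 \<in> below e"
  by (simp add: below_def)

lemma below_trans: "a \<in> below b \<Longrightarrow> b \<in> below c \<Longrightarrow> a \<in> below c"
  by (auto simp: below_def intro: order_trans)

lemma below_diff: "e - a \<in> below e"
  by (simp add: below_def lookup_minus)

lemma diff_diff_below: "a \<in> below e \<Longrightarrow> e - (e - a) = a"
  by (rule poly_mapping_eqI) (simp add: belowD lookup_minus)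

lemma diff_add_below: "a \<in> below e \<Longrightarrow> a + (e - a) = e"
  by (rule poly_mapping_eqI) (simp add: belowD lookup_minus lookup_add)

lemma add_below_iff: "a \<in> below e \<Longrightarrow> a + b \<in> below e \<longleftrightarrow> b \<in> below (e - a)"
proof -
  assume "a \<in> below e"
  hence "Poly_Mapping.lookup a i + x \<le> Poly_Mapping.lookup e i \<longleftrightarrow> x \<le> Poly_Mapping.lookup e i - Poly_Mapping.lookup a i" for x i
    using belowD[of a e i] by (simp add: le_diff_conv2 add.commute)
  thus ?thesis by (simp add: below_def lookup_add lookup_minus)
qed

lemma bij_betw_below_PiE:
  assumes "finite F" "Poly_Mapping.keys e \<subseteq> F"
  shows "bij_betw (\<lambda>c. restrict (Poly_Mapping.lookup c) F) (below e) (Pi\<^sub>E F (\<lambda>i. {..Poly_Mapping.lookup e i}))"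
proof -
  define g where "g h = Abs_poly_mapping (\<lambda>i. if i \<in> F then h i else 0)" for h :: "nat \<Rightarrow> nat"
  have g: "Poly_Mapping.lookup (g h) i = (if i \<in> F then h i else 0)" for h i
  proof -
    have "finite {i. (if i \<in> F then h i else 0) \<noteq> 0}" using assms(1) by (rule rev_finite_subset) auto
    thus ?thesis by (simp add: g_def)
  qed
  have out: "Poly_Mapping.lookup e i = 0" if "i \<notin> F" for i
    using assms(2) that by (auto simp: in_keys_iff)
  have out': "Poly_Mapping.lookup c i = 0" if "i \<notin> F" "c \<in> below e" for c i
    using out[OF that(1)] belowD[OF that(2), of i] by simp
  show ?thesis
  proof (rule bij_betw_byWitness[of _ g])
    show "\<forall>c\<in>below e. g (restrict (Poly_Mapping.lookup c) F) = c"
      by (intro ballI poly_mapping_eqI) (simp add: g out')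
    show "\<forall>h\<in>Pi\<^sub>E F (\<lambda>i. {..Poly_Mapping.lookup e i}). restrict (Poly_Mapping.lookup (g h)) F = h"
      by (auto simp: g fun_eq_iff PiE_def extensional_def)
    show "(\<lambda>c. restrict (Poly_Mapping.lookup c) F) ` below e \<subseteq> Pi\<^sub>E F (\<lambda>i. {..Poly_Mapping.lookup e i})"
      by (auto simp: below_def)
    show "g ` Pi\<^sub>E F (\<lambda>i. {..Poly_Mapping.lookup e i}) \<subseteq> below e"
      by (auto simp: below_def g PiE_def Pi_def)
  qed
qed

lemma finite_below [simp]: "finite (below e)"
  using bij_betw_finite[OF bij_betw_below_PiE[OF finite_keys subset_refl, of e]]
  by (simp add: finite_PiE)

lemma sum_below_prod:
  fixes g :: "nat \<Rightarrow> nat \<Rightarrow> 'a::comm_ring_1"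
  assumes "finite F" "Poly_Mapping.keys e \<subseteq> F"
  shows "(\<Sum>c\<in>below e. \<Prod>i\<in>F. g i (Poly_Mapping.lookup c i)) = (\<Prod>i\<in>F. \<Sum>j\<le>Poly_Mapping.lookup e i. g i j)"
proof -
  have "(\<Prod>i\<in>F. \<Sum>j\<le>Poly_Mapping.lookup e i. g i j) =
      (\<Sum>h\<in>Pi\<^sub>E F (\<lambda>i. {..Poly_Mapping.lookup e i}). \<Prod>i\<in>F. g i (h i))"
    using assms(1) by (subst prod_sum_PiE) auto
  also have "\<dots> = (\<Sum>c\<in>below e. \<Prod>i\<in>F. g i (restrict (Poly_Mapping.lookup c) F i))"
    by (rule sum.reindex_bij_betw[OF bij_betw_below_PiE[OF assms], symmetric])
  finally show ?thesis by simp
qed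

text \<open>Arbitrary coefficients on finitely supported exponents, in all variables at once: one
  ring, independent of n and r, of which every truncated ring is a quotient. Being a type, it can be
  a class instance, so the results on Adams operations apply to it.\<close>

typedef mps = "UNIV :: ((nat \<Rightarrow>\<^sub>0 nat) \<Rightarrow> int) set"
  morphisms mcoeff Abs_mps by simp

lemma mcoeff_Abs [simp]: "mcoeff (Abs_mps f) = f"
  by (simp add: Abs_mps_inverse)

lemma mps_eqI: "(\<And>e. mcoeff f e = mcoeff g e) \<Longrightarrow> f = g"
  by (simp add: mcoeff_inject[symmetric] fun_eq_iff)

instantiation mps :: "{zero, one, plus, minus, uminus, times}"
begin

definition "0 = Abs_mps (\<lambda>e. 0)"
definition "1 = Abs_mps (\<lambda>e. if e = 0 then 1 else 0)"
definition "f + g = Abs_mps (\<lambda>e. mcoeff f e + mcoeff g e)"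
definition "f - g = Abs_mps (\<lambda>e. mcoeff f e - mcoeff g e)"
definition "- f = Abs_mps (\<lambda>e. - mcoeff f e)"
definition "f * g = Abs_mps (\<lambda>e. \<Sum>a\<in>below e. mcoeff f a * mcoeff g (e - a))"

instance ..

end

lemma mcoeff_simps [simp]:
  "mcoeff 0 e = 0"
  "mcoeff (f + g) e = mcoeff f e + mcoeff g e"
  "mcoeff (f - g) e = mcoeff f e - mcoeff g e"
  "mcoeff (- f) e = - mcoeff f e"
  by (simp_all add: zero_mps_def plus_mps_def minus_mps_def uminus_mps_def)

lemma mcoeff_1: "mcoeff 1 e = (if e = 0 then 1 else 0)"
  by (simp add: one_mps_def)

lemma mcoeff_mult: "mcoeff (f * g) e = (\<Sum>a\<in>below e. mcoeff f a * mcoeff g (e - a))"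
  by (simp add: times_mps_def)

text \<open>The common step in associativity and in multiplicativity of substitution: the pairs (a,
  b) with a + b below e are enlarged to all pairs, the weight vanishing on the new ones.\<close>

lemma sum_mcoeff_mult:
  assumes "\<And>s. s \<notin> below e \<Longrightarrow> w s = 0"
  shows "(\<Sum>s\<in>below e. mcoeff (f * g) s * w s) =
    (\<Sum>a\<in>below e. \<Sum>b\<in>below e. mcoeff f a * mcoeff g b * w (a + b))"
proof -
  have "(\<Sum>s\<in>below e. mcoeff (f * g) s * w s) =
      (\<Sum>(s, a)\<in>Sigma (below e) below. mcoeff f a * mcoeff g (s - a) * w s)"
    by (simp add: mcoeff_mult sum_distrib_right sum.Sigma)
  also have "\<dots> = (\<Sum>(a, b)\<in>{ab \<in> below e \<times> below e. fst ab + snd ab \<in> below e}. mcoeff f a * mcoeff g b * w (a + b))"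
  proof (rule sum.reindex_bij_witness[of _ "\<lambda>(a, b). (a + b, a)" "\<lambda>(s, a). (a, s - a)"])
    fix x assume "x \<in> Sigma (below e) below"
    then obtain s a where x: "x = (s, a)" "s \<in> below e" "a \<in> below s" by blast
    show "(case case x of (s, a) \<Rightarrow> (a, s - a) of (a, b) \<Rightarrow> (a + b, a)) = x"
      using x by (simp add: diff_add_below)
    show "(case x of (s, a) \<Rightarrow> (a, s - a)) \<in> {ab \<in> below e \<times> below e. fst ab + snd ab \<in> below e}"
      using x below_trans[OF x(3,2)] below_trans[OF below_diff x(2)] by (simp add: diff_add_below)
    show "(case case x of (s, a) \<Rightarrow> (a, s - a) of (a, b) \<Rightarrow> mcoeff f a * mcoeff g b * w (a + b)) =
         (case x of (s, a) \<Rightarrow> mcoeff f a * mcoeff g (s - a) * w s)"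
      using x by (simp add: diff_add_below)
  next
    fix x assume "x \<in> {ab \<in> below e \<times> below e. fst ab + snd ab \<in> below e}"
    then obtain a b where x: "x = (a, b)" "a + b \<in> below e" by (cases x) auto
    show "(case case x of (a, b) \<Rightarrow> (a + b, a) of (s, a) \<Rightarrow> (a, s - a)) = x"
      using x by simp
    show "(case x of (a, b) \<Rightarrow> (a + b, a)) \<in> Sigma (below e) below"
      using x by (simp add: below_def lookup_add)
  qed
  also have "\<dots> = (\<Sum>(a, b)\<in>below e \<times> below e. mcoeff f a * mcoeff g b * w (a + b))"
  proof (rule sum.mono_neutral_left)
    have *: "s \<in> below e" if "w s \<noteq> 0" for s using assms that by blast
    show "\<forall>x\<in>below e \<times> below e - {ab \<in> below e \<times> below e. fst ab + snd ab \<in> below e}.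
       (case x of (a, b) \<Rightarrow> mcoeff f a * mcoeff g b * w (a + b)) = 0"
      by (auto dest: *)
  qed auto
  finally show ?thesis by (simp add: sum.cartesian_product)
qed

instance mps :: comm_ring_1
proof
  fix f g h :: mps
  show "f * g * h = f * (g * h)"
  proof (rule mps_eqI)
    fix e
    \<comment> \<open>Subtraction of exponents is truncated at 0, so \<open>e - s\<close> is
      meaningful only for s below e; hence the default 0 elsewhere.\<close>
    define w where "w s = (if s \<in> below e then mcoeff h (e - s) else 0)" for s
    have "mcoeff (f * g * h) e = (\<Sum>s\<in>below e. mcoeff (f * g) s * w s)"
      unfolding mcoeff_mult[of "f * g"] by (intro sum.cong refl) (simp add: w_def)
    also have "\<dots> = (\<Sum>a\<in>below e. \<Sum>b\<in>below e. mcoeff f a * mcoeff g b * w (a + b))"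
      by (rule sum_mcoeff_mult) (simp add: w_def)
    also have "\<dots> = (\<Sum>a\<in>below e. mcoeff f a * mcoeff (g * h) (e - a))"
    proof (intro sum.cong refl)
      fix a assume a: "a \<in> below e"
      have "(\<Sum>b\<in>below e. mcoeff f a * mcoeff g b * w (a + b)) =
          (\<Sum>b\<in>below (e - a). mcoeff f a * mcoeff g b * w (a + b))"
      proof (rule sum.mono_neutral_right)
        show "below (e - a) \<subseteq> below e" using below_trans[OF _ below_diff] by blast
        show "\<forall>i\<in>below e - below (e - a). mcoeff f a * mcoeff g i * w (a + i) = 0"
          using add_below_iff[OF a] by (simp add: w_def)
      qed simp
      also have "\<dots> = mcoeff f a * mcoeff (g * h) (e - a)"
        unfolding mcoeff_mult sum_distrib_left
        by (intro sum.cong refl) (simp add: w_def add_below_iff[OF a] diff_diff_add mult.assoc)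
      finally show "(\<Sum>b\<in>below e. mcoeff f a * mcoeff g b * w (a + b)) = mcoeff f a * mcoeff (g * h) (e - a)" .
    qed
    finally show "mcoeff (f * g * h) e = mcoeff (f * (g * h)) e" by (simp only: mcoeff_mult)
  qed
  show "f * g = g * f"
  proof (rule mps_eqI)
    fix e
    have "(\<Sum>a\<in>below e. mcoeff f a * mcoeff g (e - a)) = (\<Sum>a\<in>below e. mcoeff g a * mcoeff f (e - a))"
      by (rule sum.reindex_bij_witness[of _ "\<lambda>a. e - a" "\<lambda>a. e - a"])
         (simp_all add: diff_diff_below below_diff)
    thus "mcoeff (f * g) e = mcoeff (g * f) e" by (simp only: mcoeff_mult)
  qed
  show "1 * f = f"
  proof (rule mps_eqI)
    fix e
    have "mcoeff (1 * f) e = (\<Sum>a\<in>below e. if a = 0 then mcoeff f e else 0)"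
      unfolding mcoeff_mult mcoeff_1 by (intro sum.cong refl) simp
    thus "mcoeff (1 * f) e = mcoeff f e" by simp
  qed
  show "(f + g) * h = f * h + g * h"
    by (rule mps_eqI) (simp add: mcoeff_mult distrib_right sum.distrib)
  show "(0::mps) \<noteq> 1"
  proof
    assume "(0::mps) = 1"
    hence "mcoeff 0 0 = mcoeff 1 0" by simp
    thus False by (simp add: mcoeff_1)
  qed
qed (auto intro: mps_eqI)

lemma mcoeff_of_nat_mult: "mcoeff (of_nat n * f) e = int n * mcoeff f e"
  by (induction n) (simp_all add: algebra_simps)

instance mps :: torsion_free_ring
proof
  fix n and x :: mps
  assume "of_nat n * x = 0"
  hence "int n * mcoeff x e = 0" for e by (metis mcoeff_of_nat_mult mcoeff_simps(1))
  thus "n = 0 \<or> x = 0" by (auto intro: mps_eqI)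
qed

lemma dvd_mps_iff: "of_nat q dvd f \<longleftrightarrow> (\<forall>e. int q dvd mcoeff f e)"
proof
  assume "\<forall>e. int q dvd mcoeff f e"
  hence "f = of_nat q * Abs_mps (\<lambda>e. mcoeff f e div int q)"
    by (intro mps_eqI) (simp add: mcoeff_of_nat_mult)
  thus "of_nat q dvd f" by (rule dvdI)
qed (auto simp: mcoeff_of_nat_mult)

lemma mcoeff_sum: "mcoeff (\<Sum>i\<in>A. f i) e = (\<Sum>i\<in>A. mcoeff (f i) e)"
  by (induction A rule: infinite_finite_induct) simp_all

lemma mcoeff_mult_cong:
  assumes "\<And>a. a \<in> below e \<Longrightarrow> mcoeff f a = mcoeff f' a" "\<And>a. a \<in> below e \<Longrightarrow> mcoeff g a = mcoeff g' a"
  shows "mcoeff (f * g) e = mcoeff (f' * g') e"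
  unfolding mcoeff_mult using assms below_diff by (intro sum.cong refl) simp

lemma mcoeff_power_cong:
  assumes "\<And>a. a \<in> below e \<Longrightarrow> mcoeff f a = mcoeff g a"
  shows "mcoeff (f ^ n) e = mcoeff (g ^ n) e"
  using assms
proof (induction n arbitrary: e)
  case (Suc n)
  show ?case unfolding power_Suc
    by (intro mcoeff_mult_cong Suc.IH Suc.prems) (auto intro: below_trans)
qed simp

definition mmono :: "(nat \<Rightarrow>\<^sub>0 nat) \<Rightarrow> int \<Rightarrow> mps" where
  "mmono a c = Abs_mps (\<lambda>e. if e = a then c else 0)"

lemma mcoeff_mmono: "mcoeff (mmono a c) e = (if e = a then c else 0)"
  by (simp add: mmono_def)

lemma mmono_mult: "mmono a c * mmono b d = mmono (a + b) (c * d)"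
proof (rule mps_eqI)
  fix e
  have "mcoeff (mmono a c * mmono b d) e = (\<Sum>x\<in>below e. if x = a then c * mcoeff (mmono b d) (e - a) else 0)"
    unfolding mcoeff_mult by (intro sum.cong refl) (simp add: mcoeff_mmono)
  also have "\<dots> = (if a \<in> below e then c * mcoeff (mmono b d) (e - a) else 0)" by simp
  also have "\<dots> = mcoeff (mmono (a + b) (c * d)) e"
  proof (cases "a \<in> below e")
    case True
    hence "e - a = b \<longleftrightarrow> e = a + b" using diff_add_below[OF True] by auto
    thus ?thesis using True by (simp add: mcoeff_mmono)
  next
    case False
    hence "e \<noteq> a + b" by (auto simp: below_def lookup_add)
    thus ?thesis using False by (simp add: mcoeff_mmono)
  qed
  finally show "mcoeff (mmono a c * mmono b d) e = mcoeff (mmono (a + b) (c * d)) e" .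
qed

lemma mmono_power: "mmono a c ^ n = mmono (\<Sum>j<n. a) (c ^ n)"
proof (induction n)
  case 0
  show ?case by (rule mps_eqI) (simp add: mcoeff_mmono mcoeff_1)
next
  case (Suc n)
  thus ?case by (simp add: mmono_mult add.commute mult.commute del: sum_constant)
qed

subsection \<open>Substituting a power series for every variable\<close>

text \<open>The coefficient of x^e in the product of the u(x_i)^(a_i). Outside the two supports
  every factor is the constant term of u^0, which is 1; an index in the support of e alone
  contributes 0.\<close>

definition subst_coeff :: "int fps \<Rightarrow> (nat \<Rightarrow>\<^sub>0 nat) \<Rightarrow> (nat \<Rightarrow>\<^sub>0 nat) \<Rightarrow> int" where
  "subst_coeff u a e = (\<Prod>i\<in>Poly_Mapping.keys a \<union> Poly_Mapping.keys e.
     fps_nth (u ^ Poly_Mapping.lookup a i) (Poly_Mapping.lookup e i))"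

text \<open>When u has no constant term, u(x_i)^k starts in degree k, so only exponents a below e
  contribute and the sum is the genuine, finite one.\<close>

definition msubst :: "int fps \<Rightarrow> mps \<Rightarrow> mps" where
  "msubst u f = Abs_mps (\<lambda>e. \<Sum>a\<in>below e. mcoeff f a * subst_coeff u a e)"

lemma mcoeff_msubst: "mcoeff (msubst u f) e = (\<Sum>a\<in>below e. mcoeff f a * subst_coeff u a e)"
  by (simp add: msubst_def)

lemma subst_coeff_superset:
  assumes "finite F" "Poly_Mapping.keys a \<subseteq> F" "Poly_Mapping.keys e \<subseteq> F"
  shows "subst_coeff u a e = (\<Prod>i\<in>F. fps_nth (u ^ Poly_Mapping.lookup a i) (Poly_Mapping.lookup e i))"
  unfolding subst_coeff_def using assms
  by (intro prod.mono_neutral_left) (auto simp: in_keys_iff)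

lemma fps_power_nth_less:
  fixes u :: "int fps"
  assumes "fps_nth u 0 = 0" "j < k"
  shows "fps_nth (u ^ k) j = 0"
  using startsby_zero_power_prefix[OF assms(1)] assms(2) by blast

lemma subst_coeff_eq_0:
  assumes "fps_nth u 0 = 0" "a \<notin> below e"
  shows "subst_coeff u a e = 0"
proof -
  obtain i where i: "Poly_Mapping.lookup e i < Poly_Mapping.lookup a i"
    using assms(2) unfolding below_def by (auto simp: not_le)
  hence "i \<in> Poly_Mapping.keys a" by (simp add: in_keys_iff)
  thus ?thesis unfolding subst_coeff_def
    using fps_power_nth_less[OF assms(1) i] by (intro prod_zero) auto
qed

lemma mcoeff_msubst_superset:
  assumes "fps_nth u 0 = 0" "c \<in> below e"
  shows "mcoeff (msubst u f) c = (\<Sum>a\<in>below e. mcoeff f a * subst_coeff u a c)"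
  unfolding mcoeff_msubst using assms subst_coeff_eq_0[OF assms(1)]
  by (intro sum.mono_neutral_left) (auto intro: below_trans)

lemma msubst_add: "msubst u (f + g) = msubst u f + msubst u g"
  by (rule mps_eqI) (simp add: mcoeff_msubst distrib_right sum.distrib)

lemma subst_coeff_0: "subst_coeff u 0 e = (if e = 0 then 1 else 0)"
proof -
  have "subst_coeff u 0 e = 0" if ne: "e \<noteq> 0"
  proof -
    obtain i where "Poly_Mapping.lookup e i \<noteq> Poly_Mapping.lookup 0 i"
      using ne poly_mapping_eqI[of e 0] by blast
    thus ?thesis unfolding subst_coeff_def by (intro prod_zero) (auto simp: in_keys_iff)
  qed
  thus ?thesis by (simp add: subst_coeff_def)
qed

lemma msubst_1: "msubst u 1 = 1"
proof (rule mps_eqI)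
  fix e
  have "mcoeff (msubst u 1) e = (\<Sum>a\<in>below e. if a = 0 then subst_coeff u 0 e else 0)"
    unfolding mcoeff_msubst mcoeff_1 by (intro sum.cong refl) simp
  thus "mcoeff (msubst u 1) e = mcoeff 1 e" by (simp add: subst_coeff_0 mcoeff_1)
qed

lemma subst_coeff_add:
  assumes "a \<in> below e" "b \<in> below e"
  shows "subst_coeff u (a + b) e = (\<Sum>c\<in>below e. subst_coeff u a c * subst_coeff u b (e - c))"
proof -
  let ?F = "Poly_Mapping.keys e"
  have "subst_coeff u (a + b) e =
      (\<Prod>i\<in>?F. fps_nth (u ^ Poly_Mapping.lookup (a + b) i) (Poly_Mapping.lookup e i))"
    using keys_below[OF assms(1)] keys_below[OF assms(2)] keys_add[of a b]
    by (intro subst_coeff_superset) auto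
  also have "\<dots> = (\<Prod>i\<in>?F. \<Sum>j\<le>Poly_Mapping.lookup e i. fps_nth (u ^ Poly_Mapping.lookup a i) j *
      fps_nth (u ^ Poly_Mapping.lookup b i) (Poly_Mapping.lookup e i - j))"
    by (simp add: lookup_add power_add fps_mult_nth atLeast0AtMost)
  also have "\<dots> = (\<Sum>c\<in>below e. \<Prod>i\<in>?F. fps_nth (u ^ Poly_Mapping.lookup a i) (Poly_Mapping.lookup c i) *
      fps_nth (u ^ Poly_Mapping.lookup b i) (Poly_Mapping.lookup e i - Poly_Mapping.lookup c i))"
    by (rule sum_below_prod[symmetric]) auto
  also have "\<dots> = (\<Sum>c\<in>below e. subst_coeff u a c * subst_coeff u b (e - c))"
  proof (intro sum.cong refl)
    fix c assume c: "c \<in> below e"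
    have "subst_coeff u a c = (\<Prod>i\<in>?F. fps_nth (u ^ Poly_Mapping.lookup a i) (Poly_Mapping.lookup c i))"
      using keys_below[OF assms(1)] keys_below[OF c] by (intro subst_coeff_superset) auto
    moreover have "subst_coeff u b (e - c) =
        (\<Prod>i\<in>?F. fps_nth (u ^ Poly_Mapping.lookup b i) (Poly_Mapping.lookup (e - c) i))"
      using keys_below[OF assms(2)] keys_below[OF below_diff, of e c] by (intro subst_coeff_superset) auto
    ultimately show "(\<Prod>i\<in>?F. fps_nth (u ^ Poly_Mapping.lookup a i) (Poly_Mapping.lookup c i) *
        fps_nth (u ^ Poly_Mapping.lookup b i) (Poly_Mapping.lookup e i - Poly_Mapping.lookup c i)) =
        subst_coeff u a c * subst_coeff u b (e - c)"
      by (simp add: prod.distrib lookup_minus)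
  qed
  finally show ?thesis .
qed

lemma msubst_mult:
  assumes u: "fps_nth u 0 = 0"
  shows "msubst u (f * g) = msubst u f * msubst u g"
proof (rule mps_eqI)
  fix e
  have "mcoeff (msubst u (f * g)) e = (\<Sum>a\<in>below e. \<Sum>b\<in>below e. mcoeff f a * mcoeff g b * subst_coeff u (a + b) e)"
    unfolding mcoeff_msubst by (rule sum_mcoeff_mult) (rule subst_coeff_eq_0[OF u])
  also have "\<dots> = (\<Sum>a\<in>below e. \<Sum>b\<in>below e. \<Sum>c\<in>below e.
      (mcoeff f a * subst_coeff u a c) * (mcoeff g b * subst_coeff u b (e - c)))"
    by (intro sum.cong refl) (simp add: subst_coeff_add sum_distrib_left mult_ac)
  also have "\<dots> = (\<Sum>a\<in>below e. \<Sum>c\<in>below e. \<Sum>b\<in>below e.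
      (mcoeff f a * subst_coeff u a c) * (mcoeff g b * subst_coeff u b (e - c)))"
    by (intro sum.cong refl sum.swap)
  also have "\<dots> = (\<Sum>c\<in>below e. \<Sum>a\<in>below e. \<Sum>b\<in>below e.
      (mcoeff f a * subst_coeff u a c) * (mcoeff g b * subst_coeff u b (e - c)))"
    by (rule sum.swap)
  also have "\<dots> = (\<Sum>c\<in>below e. mcoeff (msubst u f) c * mcoeff (msubst u g) (e - c))"
    by (intro sum.cong refl) (simp add: mcoeff_msubst_superset[OF u, of _ e] below_diff sum_product)
  finally show "mcoeff (msubst u (f * g)) e = mcoeff (msubst u f * msubst u g) e"
    by (simp only: mcoeff_mult)
qed

text \<open>For a fixed monomial the sum over intermediate exponents factors over the variables, and
  each factor is a one-variable composition. The order of composition is reversed.\<close>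

lemma msubst_msubst:
  assumes u: "fps_nth u 0 = 0" and v: "fps_nth v 0 = 0"
  shows "msubst u (msubst v f) = msubst (v oo u) f"
proof (rule mps_eqI)
  fix e :: "nat \<Rightarrow>\<^sub>0 nat"
  let ?F = "Poly_Mapping.keys e"
  have comp: "(\<Sum>c\<in>below e. subst_coeff v a c * subst_coeff u c e) = subst_coeff (v oo u) a e"
    if a: "a \<in> below e" for a
  proof -
    have "subst_coeff v a c * subst_coeff u c e =
        (\<Prod>i\<in>?F. fps_nth (v ^ Poly_Mapping.lookup a i) (Poly_Mapping.lookup c i) *
                fps_nth (u ^ Poly_Mapping.lookup c i) (Poly_Mapping.lookup e i))" if c: "c \<in> below e" for c
    proof -
      have "subst_coeff v a c = (\<Prod>i\<in>?F. fps_nth (v ^ Poly_Mapping.lookup a i) (Poly_Mapping.lookup c i))"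
        using keys_below[OF a] keys_below[OF c] by (intro subst_coeff_superset) auto
      moreover have "subst_coeff u c e = (\<Prod>i\<in>?F. fps_nth (u ^ Poly_Mapping.lookup c i) (Poly_Mapping.lookup e i))"
        using keys_below[OF c] by (intro subst_coeff_superset) auto
      ultimately show ?thesis by (simp add: prod.distrib)
    qed
    hence "(\<Sum>c\<in>below e. subst_coeff v a c * subst_coeff u c e) =
      (\<Sum>c\<in>below e. \<Prod>i\<in>?F. fps_nth (v ^ Poly_Mapping.lookup a i) (Poly_Mapping.lookup c i) *
                fps_nth (u ^ Poly_Mapping.lookup c i) (Poly_Mapping.lookup e i))"
      by (intro sum.cong refl)
    also have "\<dots> = (\<Prod>i\<in>?F. \<Sum>j\<le>Poly_Mapping.lookup e i. fps_nth (v ^ Poly_Mapping.lookup a i) j *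
                fps_nth (u ^ j) (Poly_Mapping.lookup e i))"
      by (rule sum_below_prod) auto
    also have "\<dots> = (\<Prod>i\<in>?F. fps_nth ((v oo u) ^ Poly_Mapping.lookup a i) (Poly_Mapping.lookup e i))"
      by (simp add: fps_compose_power[OF u] fps_compose_nth atLeast0AtMost)
    also have "\<dots> = subst_coeff (v oo u) a e"
      using keys_below[OF a] by (intro subst_coeff_superset[symmetric]) auto
    finally show ?thesis .
  qed
  have "mcoeff (msubst u (msubst v f)) e =
      (\<Sum>c\<in>below e. \<Sum>a\<in>below e. mcoeff f a * (subst_coeff v a c * subst_coeff u c e))"
    unfolding mcoeff_msubst[of u]
    by (intro sum.cong refl) (simp add: mcoeff_msubst_superset[OF v, of _ e] sum_distrib_right mult.assoc)
  also have "\<dots> = (\<Sum>a\<in>below e. \<Sum>c\<in>below e. mcoeff f a * (subst_coeff v a c * subst_coeff u c e))"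
    by (rule sum.swap)
  also have "\<dots> = (\<Sum>a\<in>below e. mcoeff f a * subst_coeff (v oo u) a e)"
    by (intro sum.cong refl) (simp add: comp flip: sum_distrib_left)
  finally show "mcoeff (msubst u (msubst v f)) e = mcoeff (msubst (v oo u) f) e"
    by (simp only: mcoeff_msubst)
qed

lemma subst_coeff_X_power:
  "subst_coeff (fps_X ^ p) a e = (if (\<Sum>j<p. a) = e then 1 else 0)"
proof (cases "(\<Sum>j<p. a) = e")
  case True
  hence "Poly_Mapping.lookup e i = p * Poly_Mapping.lookup a i" for i
    using lookup_sum[of "\<lambda>j. a" "{..<p}" i] by simp
  thus ?thesis using True by (simp add: subst_coeff_def power_mult[symmetric] fps_X_power_nth)
next
  case False
  then obtain i where "Poly_Mapping.lookup (\<Sum>j<p. a) i \<noteq> Poly_Mapping.lookup e i"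
    using poly_mapping_eqI[of "\<Sum>j<p. a" e] by blast
  hence i: "p * Poly_Mapping.lookup a i \<noteq> Poly_Mapping.lookup e i"
    using lookup_sum[of "\<lambda>j. a" "{..<p}" i] by simp
  hence "i \<in> Poly_Mapping.keys a \<union> Poly_Mapping.keys e" by (auto simp: in_keys_iff)
  moreover have "fps_nth ((fps_X ^ p) ^ Poly_Mapping.lookup a i) (Poly_Mapping.lookup e i) = (0::int)"
    using i by (simp add: power_mult[symmetric] fps_X_power_nth)
  ultimately have "subst_coeff (fps_X ^ p) a e = 0"
    unfolding subst_coeff_def by (intro prod_zero bexI[of _ i]) auto
  thus ?thesis using False by simp
qed

lemma msubst_X: "msubst fps_X f = f"
proof (rule mps_eqI)
  fix e
  have "mcoeff (msubst fps_X f) e = (\<Sum>a\<in>below e. if a = e then mcoeff f e else 0)"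
    unfolding mcoeff_msubst using subst_coeff_X_power[of 1] by (intro sum.cong refl) auto
  thus "mcoeff (msubst fps_X f) e = mcoeff f e" by simp
qed

text \<open>As in one variable: the coefficient at e depends on the finitely many monomials below e,
  additivity modulo p reduces to these, and Fermat treats the coefficients.\<close>

lemma prime_dvd_mps_frobenius:
  assumes "prime p"
  shows "of_nat p dvd f ^ p - msubst (fps_X ^ p) f"
  unfolding dvd_mps_iff
proof
  fix e
  define g where "g = (\<Sum>a\<in>below e. mmono a (mcoeff f a))"
  define h where "h = (\<Sum>a\<in>below e. mmono (\<Sum>j<p. a) (mcoeff f a))"
  have "mcoeff g a = mcoeff f a" if "a \<in> below e" for a
    using that by (simp add: g_def mcoeff_sum mcoeff_mmono)
  hence 1: "mcoeff (f ^ p) e = mcoeff (g ^ p) e" by (intro mcoeff_power_cong) simp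
  have "of_nat p dvd g ^ p - (\<Sum>a\<in>below e. mmono a (mcoeff f a) ^ p)"
    unfolding g_def by (rule prime_dvd_frobenius_sum[OF assms])
  moreover have "of_nat p dvd (\<Sum>a\<in>below e. mmono a (mcoeff f a) ^ p) - h"
    unfolding h_def sum_subtractf[symmetric]
  proof (rule dvd_sum)
    fix a
    show "of_nat p dvd mmono a (mcoeff f a) ^ p - mmono (\<Sum>j<p. a) (mcoeff f a)"
      unfolding dvd_mps_iff mmono_power using fermat_int[OF assms] by (simp add: mcoeff_mmono)
  qed
  ultimately have "of_nat p dvd (g ^ p - (\<Sum>a\<in>below e. mmono a (mcoeff f a) ^ p)) +
     ((\<Sum>a\<in>below e. mmono a (mcoeff f a) ^ p) - h)" by (rule dvd_add)
  hence "int p dvd mcoeff (g ^ p - h) e" unfolding dvd_mps_iff by simp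
  moreover have "mcoeff h e = mcoeff (msubst (fps_X ^ p) f) e"
    unfolding h_def mcoeff_sum mcoeff_msubst subst_coeff_X_power
    by (intro sum.cong refl) (auto simp: mcoeff_mmono)
  ultimately show "int p dvd mcoeff (f ^ p - msubst (fps_X ^ p) f) e" using 1 by simp
qed

lemma msubst_cong_mod:
  assumes "of_nat p dvd u - v"
  shows "of_nat p dvd msubst u f - msubst v f"
  unfolding dvd_mps_iff
proof
  fix e
  have "int p dvd subst_coeff u a e - subst_coeff v a e" for a
  proof -
    have "int p dvd fps_nth (u ^ k) j - fps_nth (v ^ k) j" for k j
    proof -
      have "u - v dvd u ^ k - v ^ k" by (simp only: power_diff_sumr2 dvd_triv_left)
      hence "of_nat p dvd u ^ k - v ^ k" by (rule dvd_trans[OF assms])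
      thus ?thesis unfolding dvd_int_fps_iff by simp
    qed
    hence "fps_nth (u ^ k) j mod int p = fps_nth (v ^ k) j mod int p" for k j
      by (simp add: mod_eq_dvd_iff)
    hence "subst_coeff u a e mod int p = subst_coeff v a e mod int p"
      unfolding subst_coeff_def by (subst (1 2) mod_prod_eq[symmetric]) simp
    thus ?thesis by (simp add: mod_eq_dvd_iff)
  qed
  hence "int p dvd (\<Sum>a\<in>below e. mcoeff f a * (subst_coeff u a e - subst_coeff v a e))"
    by (intro dvd_sum dvd_mult)
  thus "int p dvd mcoeff (msubst u f - msubst v f) e"
    by (simp add: mcoeff_msubst right_diff_distrib sum_subtractf)
qed

lemma mcoeff_msubst_eq_0:
  assumes "\<And>a. a \<in> below e \<Longrightarrow> mcoeff f a = 0"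
  shows "mcoeff (msubst u f) e = 0"
  unfolding mcoeff_msubst using assms by (intro sum.neutral) simp

section \<open>Linear coefficients, and the Adams operations on power series\<close>

lemma below_single: "below (Poly_Mapping.single i 1) = {0, Poly_Mapping.single i 1}"
proof -
  have "a = 0 \<or> a = Poly_Mapping.single i 1" if a: "a \<in> below (Poly_Mapping.single i 1)" for a
  proof (cases "Poly_Mapping.lookup a i = 0")
    case True
    have "Poly_Mapping.lookup a t = 0" for t
      using True belowD[OF a, of t] by (cases "t = i") (auto simp: lookup_single when_def)
    hence "a = 0" by (intro poly_mapping_eqI) simp
    thus ?thesis ..
  next
    case False
    have "Poly_Mapping.lookup a t = Poly_Mapping.lookup (Poly_Mapping.single i 1) t" for t
      using False belowD[OF a, of t] by (cases "t = i") (auto simp: lookup_single when_def)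
    hence "a = Poly_Mapping.single i 1" by (intro poly_mapping_eqI)
    thus ?thesis ..
  qed
  thus ?thesis by auto
qed

lemma mcoeff_msubst_single:
  "mcoeff (msubst u f) (Poly_Mapping.single i 1) = fps_nth u 1 * mcoeff f (Poly_Mapping.single i 1)"
proof -
  have "(0 :: nat \<Rightarrow>\<^sub>0 nat) \<noteq> Poly_Mapping.single i 1"
    by (metis lookup_single_eq lookup_zero zero_neq_one)
  moreover have "subst_coeff u (Poly_Mapping.single i 1) (Poly_Mapping.single i 1) = fps_nth u 1"
    by (simp add: subst_coeff_def)
  ultimately show ?thesis
    unfolding mcoeff_msubst below_single by (simp add: subst_coeff_0)
qed

context sign_character
begin

text \<open>The Frobenius congruence goes through the substitution of x_i^p: it is congruent to the
  p-th power, and also to the substitution of u_p since u_p is congruent to x^p.\<close>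

sublocale adams_operations "\<lambda>m. msubst (mult_series m)"
proof
  fix p :: nat and x assume p: "prime p"
  have "of_nat p dvd (msubst (mult_series p) x - msubst (fps_X ^ p) x) - (x ^ p - msubst (fps_X ^ p) x)"
    by (intro dvd_diff msubst_cong_mod mult_series_prime prime_dvd_mps_frobenius p)
  thus "of_nat p dvd msubst (mult_series p) x - x ^ p" by simp
next
  fix m n :: nat and x assume "m > 0" "n > 0"
  thus "msubst (mult_series m) (msubst (mult_series n) x) = msubst (mult_series (m * n)) x"
    by (simp add: msubst_msubst mult_series_0 mult_series_compose mult.commute)
qed (simp_all add: msubst_add msubst_mult msubst_1 mult_series_0 mult_series_1[simplified] msubst_X)

end

subsection \<open>Surjections from a type-class ring onto a record ring\<close>

text \<open>Carries identities from a type-class ring to a ring with explicit carrier. That the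
  target is a commutative ring is derived from the surjection, so its axioms need no separate
  verification.\<close>

locale ring_surjection =
  fixes R :: "('r, 'm) ring_scheme" (structure) and h :: "'a::comm_ring_1 \<Rightarrow> 'r"
  assumes carrier_eq: "carrier R = range h"
    and h_add: "h (x + y) = h x \<oplus> h y"
    and h_mult: "h (x * y) = h x \<otimes> h y"
    and h_zero: "h 0 = \<zero>"
    and h_one: "h 1 = \<one>"
begin

lemma h_closed [simp]: "h x \<in> carrier R"
  by (simp add: carrier_eq)

lemma abelian_group: "abelian_group R"
proof (rule abelian_groupI)
  fix x assume "x \<in> carrier R"
  then obtain a where "x = h a" by (auto simp: carrier_eq)
  thus "\<exists>y\<in>carrier R. y \<oplus> x = \<zero>"
    by (intro bexI[of _ "h (- a)"]) (simp_all add: h_add[symmetric] h_zero)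
qed (auto simp: carrier_eq h_add[symmetric] h_zero[symmetric] add_ac intro: arg_cong[of _ _ h])

lemma cring: "cring R"
proof (rule cringI[OF abelian_group])
  show "comm_monoid R"
    by (rule comm_monoidI)
      (auto simp: carrier_eq h_mult[symmetric] h_one[symmetric] mult_ac intro: arg_cong[of _ _ h])
qed (auto simp: carrier_eq h_mult[symmetric] h_add[symmetric] distrib_right)

lemma h_sum: "finite A \<Longrightarrow> finsum R (\<lambda>i. h (f i)) A = h (\<Sum>i\<in>A. f i)"
proof (induction A rule: finite_induct)
  interpret abelian_group R by (rule abelian_group)
  case empty
  show ?case by (simp add: h_zero)
next
  interpret abelian_group R by (rule abelian_group)
  case (insert x F)
  thus ?case by (simp add: h_add Pi_def)
qed

lemma h_prod: "finite A \<Longrightarrow> finprod R (\<lambda>i. h (f i)) A = h (\<Prod>i\<in>A. f i)"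
proof (induction A rule: finite_induct)
  interpret cring R by (rule cring)
  case empty
  show ?case by (simp add: h_one)
next
  interpret cring R by (rule cring)
  case (insert x F)
  thus ?case by (simp add: h_mult Pi_def)
qed

lemma h_power: "h x [^] (n::nat) = h (x ^ n)"
proof (induction n)
  interpret cring R by (rule cring)
  case 0
  show ?case by (simp add: h_one)
next
  interpret cring R by (rule cring)
  case (Suc n)
  thus ?case by (simp add: h_mult[symmetric] mult.commute)
qed

lemma h_of_nat: "add_pow R (n::nat) \<one> = h (of_nat n)"
proof (induction n)
  interpret cring R by (rule cring)
  case 0
  show ?case by (simp add: h_zero)
next
  interpret cring R by (rule cring)
  case (Suc n)
  thus ?case by (simp add: h_add h_one[symmetric] a_comm)
qed

lemma h_of_int: "add_pow R (k::int) \<one> = h (of_int k)"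
proof (cases "k \<ge> 0")
  case True
  thus ?thesis by (simp add: add_pow_int_ge h_of_nat)
next
  interpret cring R by (rule cring)
  case False
  have "h (of_int k) \<oplus> h (of_nat (nat (- k))) = \<zero>"
    using False by (simp add: h_add[symmetric] h_zero)
  hence "\<ominus> h (of_nat (nat (- k))) = h (of_int k)"
    by (intro minus_equality) auto
  thus ?thesis using False by (simp add: add_pow_int_lt h_of_nat)
qed

lemma h_peval: "ring_peval R (\<lambda>i. h (v i)) p = h (peval v p)"
  unfolding ring_peval_def peval_def mval_def
  by (simp add: h_power h_prod h_of_int h_mult[symmetric] h_sum)

end

subsection \<open>Truncated power series rings\<close>

definition mtrunc :: "nat \<Rightarrow> (nat \<Rightarrow> enat) \<Rightarrow> mps \<Rightarrow> (nat \<Rightarrow> nat) \<Rightarrow> int" where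
  "mtrunc n r f = (\<lambda>e. if e \<in> trunc_exps n r then mcoeff f (Abs_poly_mapping e) else 0)"

text \<open>A section of \<open>mtrunc\<close> on the carrier. It is not multiplicative in general,
  as a product may leave the admissible exponents.\<close>

definition mlift :: "((nat \<Rightarrow> nat) \<Rightarrow> int) \<Rightarrow> mps" where
  "mlift g = Abs_mps (\<lambda>e. g (Poly_Mapping.lookup e))"

lemma lookup_Abs_trunc_exps:
  assumes "e \<in> trunc_exps n r"
  shows "Poly_Mapping.lookup (Abs_poly_mapping e) = e"
proof -
  have "{i. e i \<noteq> 0} \<subseteq> {..<n}" using assms by (auto simp: trunc_exps_def not_less[symmetric])
  hence "finite {i. e i \<noteq> 0}" by (rule finite_subset) simp
  thus ?thesis by simp
qed

lemma trunc_exps_mono: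
  assumes "e \<in> trunc_exps n r" "\<And>i. a i \<le> e i"
  shows "a \<in> trunc_exps n r"
proof -
  have "a i = 0" if "i \<ge> n" for i using assms(1) assms(2)[of i] that by (simp add: trunc_exps_def)
  moreover have "enat (a i) < r i" if "i < n" for i
  proof -
    have "enat (a i) \<le> enat (e i)" using assms(2) by simp
    also have "\<dots> < r i" using assms(1) that by (simp add: trunc_exps_def)
    finally show ?thesis .
  qed
  ultimately show ?thesis by (simp add: trunc_exps_def)
qed

lemma zero_in_trunc_exps: "\<forall>i<n. r i \<ge> 2 \<Longrightarrow> (\<lambda>i. 0) \<in> trunc_exps n r"
proof -
  assume r: "\<forall>i<n. r i \<ge> 2"
  have "(0::enat) < r i" if "i < n" for i
  proof -
    have "(0::enat) < 2" by simp
    also have "2 \<le> r i" using r that by simp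
    finally show ?thesis .
  qed
  thus ?thesis by (simp add: trunc_exps_def zero_enat_def)
qed

lemma unit_in_trunc_exps:
  assumes "\<forall>i<n. r i \<ge> 2" "i < n"
  shows "Poly_Mapping.lookup (Poly_Mapping.single i 1) \<in> trunc_exps n r"
proof -
  have "enat (Poly_Mapping.lookup (Poly_Mapping.single i 1) j) < r j" if "j < n" for j
  proof -
    have "enat (Poly_Mapping.lookup (Poly_Mapping.single i 1) j) \<le> enat 1"
      by (simp add: lookup_single when_def)
    also have "enat 1 < 2" by (simp add: numeral_eq_enat)
    also have "2 \<le> r j" using assms that by simp
    finally show ?thesis .
  qed
  thus ?thesis using assms(2) by (auto simp: trunc_exps_def lookup_single when_def)
qed

lemma mcoeff_mlift: "mcoeff (mlift g) e = g (Poly_Mapping.lookup e)"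
  by (simp add: mlift_def)

lemma mtrunc_mlift: "g \<in> carrier (trunc_ring n r) \<Longrightarrow> mtrunc n r (mlift g) = g"
  by (auto simp: mtrunc_def mcoeff_mlift fun_eq_iff lookup_Abs_trunc_exps trunc_ring_def)

lemma mlift_mtrunc:
  assumes "Poly_Mapping.lookup e \<in> trunc_exps n r"
  shows "mcoeff (mlift (mtrunc n r f)) e = mcoeff f e"
  using assms by (simp add: mcoeff_mlift mtrunc_def)

lemma below_trunc_exps:
  assumes "Poly_Mapping.lookup e \<in> trunc_exps n r" "a \<in> below e"
  shows "Poly_Mapping.lookup a \<in> trunc_exps n r"
  using trunc_exps_mono[OF assms(1)] belowD[OF assms(2)] by blast

lemma mtrunc_mult: "mtrunc n r (f * g) = mtrunc n r f \<otimes>\<^bsub>trunc_ring n r\<^esub> mtrunc n r g"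
proof
  fix e
  show "mtrunc n r (f * g) e = (mtrunc n r f \<otimes>\<^bsub>trunc_ring n r\<^esub> mtrunc n r g) e"
  proof (cases "e \<in> trunc_exps n r")
    case True
    define E where "E = Abs_poly_mapping e"
    have E: "Poly_Mapping.lookup E = e" using True by (simp add: E_def lookup_Abs_trunc_exps)
    have "(\<Sum>a\<in>below E. mcoeff f a * mcoeff g (E - a)) =
        (\<Sum>a\<in>{a. \<forall>i. a i \<le> e i}. mtrunc n r f a * mtrunc n r g (\<lambda>i. e i - a i))"
    proof (rule sum.reindex_bij_witness[of _ Abs_poly_mapping Poly_Mapping.lookup])
      fix a assume a: "a \<in> below E"
      show "Abs_poly_mapping (Poly_Mapping.lookup a) = a" by (rule lookup_inverse)
      show "Poly_Mapping.lookup a \<in> {a. \<forall>i. a i \<le> e i}" using belowD[OF a] by (simp add: E)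
      have "(\<lambda>i. e i - Poly_Mapping.lookup a i) = Poly_Mapping.lookup (E - a)"
        by (simp add: fun_eq_iff lookup_minus E)
      moreover have "Poly_Mapping.lookup c \<in> trunc_exps n r" if "c \<in> below E" for c
        using True by (intro below_trunc_exps[OF _ that]) (simp add: E)
      ultimately show "mtrunc n r f (Poly_Mapping.lookup a) * mtrunc n r g (\<lambda>i. e i - Poly_Mapping.lookup a i) =
          mcoeff f a * mcoeff g (E - a)"
        using a by (simp add: mtrunc_def below_diff)
    next
      fix a assume "a \<in> {a. \<forall>i. a i \<le> e i}"
      hence a: "\<And>i. a i \<le> e i" by simp
      have "Poly_Mapping.lookup (Abs_poly_mapping a) = a"
        by (rule lookup_Abs_trunc_exps[OF trunc_exps_mono[OF True a]])
      thus "Poly_Mapping.lookup (Abs_poly_mapping a) = a" "Abs_poly_mapping a \<in> below E"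
        using a by (simp_all add: below_def E)
    qed
    thus ?thesis using True by (simp add: mtrunc_def trunc_ring_def mcoeff_mult E_def)
  qed (simp add: mtrunc_def trunc_ring_def)
qed

lemma ring_surjection_mtrunc:
  assumes "\<forall>i<n. r i \<ge> 2"
  shows "ring_surjection (trunc_ring n r) (mtrunc n r)"
proof
  show "carrier (trunc_ring n r) = range (mtrunc n r)"
  proof
    show "carrier (trunc_ring n r) \<subseteq> range (mtrunc n r)"
      using mtrunc_mlift by (metis rangeI subsetI)
    show "range (mtrunc n r) \<subseteq> carrier (trunc_ring n r)"
      by (auto simp: mtrunc_def trunc_ring_def)
  qed
  show "mtrunc n r 1 = \<one>\<^bsub>trunc_ring n r\<^esub>"
  proof
    fix e
    have "Abs_poly_mapping e = 0 \<longleftrightarrow> e = (\<lambda>i. 0)" if "e \<in> trunc_exps n r"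
      using lookup_Abs_trunc_exps[OF that] by (metis Abs_poly_mapping lookup_zero)
    thus "mtrunc n r 1 e = \<one>\<^bsub>trunc_ring n r\<^esub> e"
      using zero_in_trunc_exps[OF assms] by (auto simp: mtrunc_def trunc_ring_def mcoeff_1)
  qed
qed (simp_all only: mtrunc_mult, simp_all add: mtrunc_def trunc_ring_def fun_eq_iff)

subsection \<open>The lambda operations on truncated power series\<close>

context sign_character
begin

text \<open>The series vanishing on all exponents below e form an ideal from which positive integers
  can be cancelled, and a substitution never uses coefficients outside \<open>below e\<close>. So
  the congruence passes from the Adams operations to the lambda operations.\<close>

lemma lam_cong_below:
  assumes "\<And>a. a \<in> below e \<Longrightarrow> mcoeff f a = mcoeff g a"
  shows "mcoeff (lam k f) e = mcoeff (lam k g) e"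
proof -
  define I where "I = {f. \<forall>a\<in>below e. mcoeff f a = 0}"
  have "lam k f - lam k g \<in> I"
    unfolding lam_def
  proof (rule newton_cong_ideal[OF newton_lam_series newton_lam_series])
    fix x y :: mps assume y: "y \<in> I"
    show "x * y \<in> I"
    proof -
      have "mcoeff (x * y) a = 0" if "a \<in> below e" for a
        unfolding mcoeff_mult using y below_trans[OF below_diff that]
        by (intro sum.neutral) (simp add: I_def)
      thus ?thesis by (simp add: I_def)
    qed
  next
    fix k and x :: mps assume "of_nat (Suc k) * x \<in> I"
    thus "x \<in> I" by (simp add: I_def mcoeff_of_nat_mult del: of_nat_Suc)
  next
    fix i :: nat
    have "mcoeff (msubst (mult_series i) f) a = mcoeff (msubst (mult_series i) g) a" if "a \<in> below e" for a
      unfolding mcoeff_msubst using assms below_trans[OF _ that] by (intro sum.cong refl) simp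
    thus "msubst (mult_series i) f - msubst (mult_series i) g \<in> I" by (simp add: I_def)
  qed (simp_all add: I_def)
  thus ?thesis by (simp add: I_def)
qed

lemma lam_vanish_below:
  assumes "\<And>a. a \<in> below e \<Longrightarrow> mcoeff f a = 0" "k \<ge> 1"
  shows "mcoeff (lam k f) e = 0"
  using lam_cong_below[of e f 0 k] assms by (simp add: lam_zero)

text \<open>In Newton's identity for p \<lambda>^p f all terms but j = 0 are products of two series
  without constant term and have no linear part. What remains is a sign times \<psi>_p f, whose
  linear part is \<epsilon>(p) p times that of f; the factor p cancels.\<close>

lemma mcoeff_lam_single:
  assumes "mcoeff f 0 = 0" "p \<ge> 1"
  shows "mcoeff (lam p f) (Poly_Mapping.single i 1) =
    (-1) ^ (p - 1) * \<epsilon> p * mcoeff f (Poly_Mapping.single i 1)"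
proof -
  define s where "s = (Poly_Mapping.single i 1 :: nat \<Rightarrow>\<^sub>0 nat)"
  obtain m where m: "p = Suc m" using assms(2) by (cases p) auto
  have below0: "a = 0" if "a \<in> below 0" for a
    using belowD[OF that] by (intro poly_mapping_eqI) simp
  have s0: "s \<noteq> 0" unfolding s_def by (metis lookup_single_eq lookup_zero zero_neq_one)
  have \<psi>0: "mcoeff (msubst u f) 0 = 0" for u
    using assms(1) below0 by (intro mcoeff_msubst_eq_0) auto
  have below_s: "below s = {0, s}" unfolding s_def by (rule below_single)
  have dec: "mcoeff (x * y) s = 0" if "mcoeff x 0 = 0" "mcoeff y 0 = 0" for x y
    using that s0 by (simp add: mcoeff_mult below_s)
  have sgn: "mcoeff (x * ((-1) ^ k * y)) e = (-1) ^ k * mcoeff (x * y) e" for x y e k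
    by (cases "even k") simp_all
  have "int p * mcoeff (lam p f) s = mcoeff (of_nat (Suc m) * lam (Suc m) f) s"
    by (simp only: mcoeff_of_nat_mult m)
  also have "\<dots> = (\<Sum>j\<le>m. (-1) ^ (m - j) * mcoeff (lam j f * msubst (mult_series (Suc (m - j))) f) s)"
    unfolding lam_def newton_rec[OF newton_lam_series] mcoeff_sum by (simp only: sgn)
  also have "\<dots> = (\<Sum>j\<in>{0}. (-1) ^ (m - j) * mcoeff (lam j f * msubst (mult_series (Suc (m - j))) f) s)"
  proof (rule sum.mono_neutral_right)
    show "\<forall>j\<in>{..m} - {0}. (-1) ^ (m - j) * mcoeff (lam j f * msubst (mult_series (Suc (m - j))) f) s = 0"
    proof
      fix j assume "j \<in> {..m} - {0}"
      hence "mcoeff (lam j f) 0 = 0" using below0 assms(1) by (intro lam_vanish_below) auto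
      thus "(-1) ^ (m - j) * mcoeff (lam j f * msubst (mult_series (Suc (m - j))) f) s = 0"
        by (simp add: dec \<psi>0)
    qed
  qed auto
  also have "\<dots> = (-1) ^ m * (\<epsilon> p * int p * mcoeff f s)"
    by (simp add: lam_0 m s_def mcoeff_msubst_single[simplified] mult_series_linear[simplified])
  finally have "int p * mcoeff (lam p f) s = int p * ((-1) ^ m * \<epsilon> p * mcoeff f s)"
    by (simp only: mult_ac)
  thus ?thesis using assms(2) by (simp add: m s_def)
qed

definition trunc_lam :: "nat \<Rightarrow> (nat \<Rightarrow> enat) \<Rightarrow> nat \<Rightarrow> ((nat \<Rightarrow> nat) \<Rightarrow> int) \<Rightarrow> (nat \<Rightarrow> nat) \<Rightarrow> int" where
  "trunc_lam n r k f = mtrunc n r (lam k (mlift f))"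

text \<open>Independence of the chosen lift: admissible exponents are closed downwards, so two lifts
  agree everywhere below an admissible exponent. All identities then descend along
  \<open>mtrunc\<close>.\<close>

lemma trunc_lam_mtrunc: "trunc_lam n r k (mtrunc n r f) = mtrunc n r (lam k f)"
proof
  fix e
  show "trunc_lam n r k (mtrunc n r f) e = mtrunc n r (lam k f) e"
  proof (cases "e \<in> trunc_exps n r")
    case True
    have "mcoeff (lam k (mlift (mtrunc n r f))) (Abs_poly_mapping e) = mcoeff (lam k f) (Abs_poly_mapping e)"
    proof (rule lam_cong_below)
      fix a assume "a \<in> below (Abs_poly_mapping e)"
      hence "Poly_Mapping.lookup a \<in> trunc_exps n r"
        by (rule below_trunc_exps[rotated]) (simp only: lookup_Abs_trunc_exps[OF True] True)
      thus "mcoeff (mlift (mtrunc n r f)) a = mcoeff f a" by (rule mlift_mtrunc)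
    qed
    thus ?thesis by (simp add: trunc_lam_def mtrunc_def)
  qed (simp add: trunc_lam_def mtrunc_def)
qed

lemma lambda_ring_trunc_lam:
  assumes "\<forall>i<n. r i \<ge> 2"
  shows "lambda_ring (trunc_ring n r) (trunc_lam n r)"
proof -
  let ?R = "trunc_ring n r" and ?h = "mtrunc n r"
  interpret ring_surjection ?R ?h using assms by (rule ring_surjection_mtrunc)
  have "trunc_lam n r k (?h f \<oplus>\<^bsub>?R\<^esub> ?h g) =
      finsum ?R (\<lambda>i. trunc_lam n r i (?h f) \<otimes>\<^bsub>?R\<^esub> trunc_lam n r (k - i) (?h g)) {0..k}" for k f g
    by (simp add: h_add[symmetric] h_mult[symmetric] trunc_lam_mtrunc lam_add h_sum)
  moreover have "trunc_lam n r k (?h f \<otimes>\<^bsub>?R\<^esub> ?h g) = ring_peval ?R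
      (\<lambda>i. if i < k then trunc_lam n r (i + 1) (?h f) else trunc_lam n r (i - k + 1) (?h g)) (lam_P k)"
    if "k \<ge> 1" for k f g
    unfolding h_mult[symmetric] trunc_lam_mtrunc lam_mult[OF that] h_peval[symmetric]
    by (simp add: if_distrib[of ?h])
  moreover have "trunc_lam n r k (trunc_lam n r m (?h f)) = ring_peval ?R
      (\<lambda>i. trunc_lam n r (i + 1) (?h f)) (lam_PP k m)" if "k \<ge> 1" "m \<ge> 1" for k m f
    unfolding trunc_lam_mtrunc lam_comp[OF that] h_peval[symmetric] ..
  moreover have "trunc_lam n r i \<one>\<^bsub>?R\<^esub> = \<zero>\<^bsub>?R\<^esub>" if "i > 1" for i
    unfolding h_one[symmetric] h_zero[symmetric] trunc_lam_mtrunc lam_one[OF that] ..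
  ultimately show ?thesis
    unfolding lambda_ring_def carrier_eq using cring
    by (auto simp: trunc_lam_mtrunc lam_0 lam_1[simplified] h_one)
qed

text \<open>An exponent of too small total degree has only exponents of too small degree below it; x
  vanishes on all of them, hence so does its image there.\<close>

lemma filtered_lambda_structure_trunc_lam:
  assumes "\<forall>i<n. r i \<ge> 2"
  shows "filtered_lambda_structure (trunc_ring n r) (trunc_filt n r d) (trunc_lam n r)"
  unfolding filtered_lambda_structure_def
proof (intro conjI allI impI ballI lambda_ring_trunc_lam[OF assms])
  interpret ring_surjection "trunc_ring n r" "mtrunc n r" using assms by (rule ring_surjection_mtrunc)
  fix k j x assume j: "j \<ge> (1::nat)" and x: "x \<in> trunc_filt n r d k"
  have "k \<le> d * (\<Sum>i<n. e i)" if ne: "trunc_lam n r j x e \<noteq> 0" for e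
  proof (rule ccontr)
    assume less: "\<not> k \<le> d * (\<Sum>i<n. e i)"
    have e: "e \<in> trunc_exps n r" using ne by (auto simp: trunc_lam_def mtrunc_def split: if_splits)
    have "mcoeff (mlift x) a = 0" if a: "a \<in> below (Abs_poly_mapping e)" for a
    proof (rule ccontr)
      assume "mcoeff (mlift x) a \<noteq> 0"
      hence "k \<le> d * (\<Sum>i<n. Poly_Mapping.lookup a i)" using x by (simp add: mcoeff_mlift trunc_filt_def)
      also have "\<dots> \<le> d * (\<Sum>i<n. e i)"
        using belowD[OF a] by (intro mult_left_mono sum_mono) (simp_all add: lookup_Abs_trunc_exps[OF e])
      finally show False using less by simp
    qed
    hence "mcoeff (lam j (mlift x)) (Abs_poly_mapping e) = 0" using j by (rule lam_vanish_below)
    thus False using ne by (simp add: trunc_lam_def mtrunc_def e)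
  qed
  thus "trunc_lam n r j x \<in> trunc_filt n r d k"
    by (simp add: trunc_filt_def) (simp add: trunc_lam_def)
qed

lemma trunc_lam_single:
  assumes "\<forall>i<n. r i \<ge> 2" "i < n" "x (\<lambda>i. 0) = 0" "p \<ge> 1"
  shows "trunc_lam n r p x (Poly_Mapping.lookup (Poly_Mapping.single i 1)) =
    (-1) ^ (p - 1) * \<epsilon> p * x (Poly_Mapping.lookup (Poly_Mapping.single i 1))"
proof -
  have "mcoeff (mlift x) 0 = x (\<lambda>i. 0)"
  proof -
    have "Poly_Mapping.lookup 0 = (\<lambda>i::nat. 0::nat)" by (simp add: fun_eq_iff)
    thus ?thesis by (simp add: mcoeff_mlift)
  qed
  hence "mcoeff (mlift x) 0 = 0" using assms(3) by simp
  from mcoeff_lam_single[OF this assms(4), of i] show ?thesis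
    using unit_in_trunc_exps[OF assms(1,2)] by (simp add: trunc_lam_def mtrunc_def mcoeff_mlift)
qed

end

subsection \<open>Distinguishing the structures\<close>

lemma sum_eq_1_imp_unit:
  fixes e :: "nat \<Rightarrow> nat"
  assumes "\<forall>i\<ge>n. e i = 0" "(\<Sum>i<n. e i) = 1"
  shows "\<exists>i<n. e = Poly_Mapping.lookup (Poly_Mapping.single i 1)"
proof -
  have "\<exists>i\<in>{..<n}. e i = 1 \<and> (\<forall>j\<in>{..<n}. i \<noteq> j \<longrightarrow> e j = 0)"
    using sum_eq_1_iff[of "{..<n}" e] assms(2) by simp
  then obtain i where i: "i < n" "e i = 1" "\<And>j. j < n \<Longrightarrow> i \<noteq> j \<Longrightarrow> e j = 0" by blast
  have "e j = Poly_Mapping.lookup (Poly_Mapping.single i 1) j" for j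
    using i assms(1) by (cases "j < n") (auto simp: lookup_single when_def not_less)
  thus ?thesis using i(1) by blast
qed

text \<open>For d > 0, filtration d means total degree at least 1, and filtration d + 1 means total
  degree at least 2, since 2 d \<ge> d + 1. The difference is the linear part.\<close>

lemma trunc_filt_Suc_iff:
  assumes "d > 0" "x \<in> trunc_filt n r d d"
  shows "x \<in> trunc_filt n r d (Suc d) \<longleftrightarrow>
    (\<forall>i<n. x (Poly_Mapping.lookup (Poly_Mapping.single i 1)) = 0)"
proof
  assume x: "x \<in> trunc_filt n r d (Suc d)"
  show "\<forall>i<n. x (Poly_Mapping.lookup (Poly_Mapping.single i 1)) = 0"
  proof (intro allI impI, rule ccontr)
    fix i assume "i < n" "x (Poly_Mapping.lookup (Poly_Mapping.single i 1)) \<noteq> 0"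
    hence "Suc d \<le> d * (\<Sum>j<n. Poly_Mapping.lookup (Poly_Mapping.single i 1) j)"
      using x by (simp add: trunc_filt_def)
    moreover have "(\<Sum>j<n. Poly_Mapping.lookup (Poly_Mapping.single i 1) j) = (1::nat)"
      using \<open>i < n\<close> by (simp add: lookup_single when_def)
    ultimately show False by simp
  qed
next
  assume z: "\<forall>i<n. x (Poly_Mapping.lookup (Poly_Mapping.single i 1)) = 0"
  have "Suc d \<le> d * (\<Sum>i<n. e i)" if ne: "x e \<noteq> 0" for e
  proof -
    have e: "e \<in> trunc_exps n r" using assms(2) ne by (auto simp: trunc_filt_def trunc_ring_def)
    have "d * 1 \<le> d * (\<Sum>i<n. e i)" using assms(2) ne by (simp add: trunc_filt_def)
    hence "1 \<le> (\<Sum>i<n. e i)" using assms(1) by (simp only: mult_le_cancel1)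
    moreover have "(\<Sum>i<n. e i) \<noteq> 1"
      using sum_eq_1_imp_unit[of n e] e z ne by (auto simp: trunc_exps_def)
    ultimately have "d * 2 \<le> d * (\<Sum>i<n. e i)" by (intro mult_le_mono) auto
    thus ?thesis using assms(1) by linarith
  qed
  thus "x \<in> trunc_filt n r d (Suc d)" using assms(2) by (simp add: trunc_filt_def)
qed

lemma trunc_filt_zero_coeff:
  assumes "d > 0" "x \<in> trunc_filt n r d d"
  shows "x (\<lambda>i. 0) = 0"
  using assms by (auto simp: trunc_filt_def)

context sign_character
begin

text \<open>Expresses that the scalar is -1 by ring addition, the operation and the filtration
  alone, and for any x in filtration d but not d + 1. An isomorphism preserves such a condition
  without its effect on the variables being known.\<close>

lemma add_trunc_lam_filt_iff:
  assumes r: "\<forall>i<n. r i \<ge> 2" and d: "d > 0" and p: "p \<ge> 1"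
    and x: "x \<in> trunc_filt n r d d" "x \<notin> trunc_filt n r d (Suc d)"
  shows "x \<oplus>\<^bsub>trunc_ring n r\<^esub> trunc_lam n r p x \<in> trunc_filt n r d (Suc d) \<longleftrightarrow> (-1) ^ (p - 1) * \<epsilon> p = -1"
proof -
  let ?u = "\<lambda>i. Poly_Mapping.lookup (Poly_Mapping.single i 1)"
  let ?y = "x \<oplus>\<^bsub>trunc_ring n r\<^esub> trunc_lam n r p x"
  have y: "?y e = x e + trunc_lam n r p x e" for e by (simp add: trunc_ring_def)
  have lx: "trunc_lam n r p x \<in> trunc_filt n r d d"
    using filtered_lambda_structure_trunc_lam[OF r, of d] x(1) p unfolding filtered_lambda_structure_def by blast
  have "?y \<in> trunc_filt n r d d"
  proof -
    have "d \<le> d * (\<Sum>i<n. e i)" if "x e + trunc_lam n r p x e \<noteq> 0" for e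
    proof -
      have "x e \<noteq> 0 \<or> trunc_lam n r p x e \<noteq> 0" using that by auto
      thus ?thesis using x(1) lx unfolding trunc_filt_def by blast
    qed
    thus ?thesis using x(1) lx unfolding trunc_filt_def by (simp add: trunc_ring_def)
  qed
  hence "?y \<in> trunc_filt n r d (Suc d) \<longleftrightarrow> (\<forall>i<n. ?y (?u i) = 0)"
    by (rule trunc_filt_Suc_iff[OF d])
  also have "\<dots> \<longleftrightarrow> (\<forall>i<n. (1 + (-1) ^ (p - 1) * \<epsilon> p) * x (?u i) = 0)"
  proof -
    have "trunc_lam n r p x (?u i) = (-1) ^ (p - 1) * \<epsilon> p * x (?u i)" if "i < n" for i
      by (rule trunc_lam_single[OF r that _ p]) (rule trunc_filt_zero_coeff[OF d x(1)])
    thus ?thesis unfolding y by (simp add: algebra_simps)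
  qed
  also have "\<dots> \<longleftrightarrow> 1 + (-1) ^ (p - 1) * \<epsilon> p = 0"
    using x(2) unfolding trunc_filt_Suc_iff[OF d x(1)] by auto
  finally show ?thesis by linarith
qed

end

lemma sign_eq_if_filtered_lambda_iso:
  assumes "sign_character \<epsilon>1" "sign_character \<epsilon>2"
    and n: "n \<ge> 1" and d: "d > 0" and r: "\<forall>i<n. r i \<ge> 2" and p: "p \<ge> 1"
    and iso: "filtered_lambda_iso (trunc_ring n r) (trunc_filt n r d)
      (sign_character.trunc_lam \<epsilon>1 n r) (sign_character.trunc_lam \<epsilon>2 n r)"
  shows "\<epsilon>1 p = -1 \<longleftrightarrow> \<epsilon>2 p = -1"
proof -
  interpret A: sign_character \<epsilon>1 by fact
  interpret B: sign_character \<epsilon>2 by fact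
  let ?R = "trunc_ring n r" and ?I = "trunc_filt n r d"
  obtain \<phi> where "\<phi> \<in> ring_iso ?R ?R \<and> (\<forall>k. \<phi> ` ?I k = ?I k) \<and>
      (\<forall>i. \<forall>x\<in>carrier ?R. \<phi> (A.trunc_lam n r i x) = B.trunc_lam n r i (\<phi> x))"
    using iso unfolding filtered_lambda_iso_def ..
  hence \<phi>: "\<phi> \<in> ring_iso ?R ?R" "\<And>k. \<phi> ` ?I k = ?I k"
    "\<And>i x. x \<in> carrier ?R \<Longrightarrow> \<phi> (A.trunc_lam n r i x) = B.trunc_lam n r i (\<phi> x)"
    by simp_all
  have inj: "inj_on \<phi> (carrier ?R)" and add: "\<And>x y. x \<in> carrier ?R \<Longrightarrow> y \<in> carrier ?R \<Longrightarrow> \<phi> (x \<oplus>\<^bsub>?R\<^esub> y) = \<phi> x \<oplus>\<^bsub>?R\<^esub> \<phi> y"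
    using \<phi>(1) by (auto simp: ring_iso_def ring_hom_def bij_betw_def)
  have sub: "?I k \<subseteq> carrier ?R" for k by (auto simp: trunc_filt_def)
  have mem: "\<phi> z \<in> ?I k \<longleftrightarrow> z \<in> ?I k" if "z \<in> carrier ?R" for z k
    using inj_on_image_mem_iff[OF inj that sub, of k] \<phi>(2)[of k] by simp
  \<comment> \<open>The first variable, available because n \<ge> 1.\<close>
  define x :: "(nat \<Rightarrow> nat) \<Rightarrow> int"
    where "x = (\<lambda>e. if e = Poly_Mapping.lookup (Poly_Mapping.single 0 1) then 1 else 0)"
  have "(\<Sum>j<n. Poly_Mapping.lookup (Poly_Mapping.single 0 1) j) = (1::nat)"
    using n by (simp add: lookup_single when_def)
  hence x: "x \<in> ?I d"
    using unit_in_trunc_exps[OF r, of 0] n by (auto simp: trunc_filt_def x_def trunc_ring_def)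
  have x': "x \<notin> ?I (Suc d)"
    unfolding trunc_filt_Suc_iff[OF d x] using n by (auto simp: x_def intro!: exI[of _ 0])
  have xc: "x \<in> carrier ?R" using x sub by blast
  have lc: "A.trunc_lam n r p x \<in> carrier ?R"
    using A.filtered_lambda_structure_trunc_lam[OF r, of d] xc
    unfolding filtered_lambda_structure_def lambda_ring_def by blast
  interpret ring_surjection ?R "mtrunc n r" using r by (rule ring_surjection_mtrunc)
  interpret cring ?R by (rule cring)
  have "x \<oplus>\<^bsub>?R\<^esub> A.trunc_lam n r p x \<in> ?I (Suc d) \<longleftrightarrow>
      \<phi> (x \<oplus>\<^bsub>?R\<^esub> A.trunc_lam n r p x) \<in> ?I (Suc d)"
    using xc lc by (intro mem[symmetric]) simp
  also have "\<phi> (x \<oplus>\<^bsub>?R\<^esub> A.trunc_lam n r p x) = \<phi> x \<oplus>\<^bsub>?R\<^esub> B.trunc_lam n r p (\<phi> x)"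
    using add[OF xc lc] \<phi>(3)[OF xc] by simp
  finally have "(-1) ^ (p - 1) * \<epsilon>1 p = -1 \<longleftrightarrow> (-1) ^ (p - 1) * \<epsilon>2 p = -1"
    using A.add_trunc_lam_filt_iff[OF r d p x x'] B.add_trunc_lam_filt_iff[OF r d p, of "\<phi> x"]
      mem[OF xc] x x' by blast
  moreover have "\<epsilon> p = 1 \<or> \<epsilon> p = -1" if "sign_character \<epsilon>" for \<epsilon>
  proof -
    have "\<epsilon> p * \<epsilon> p = 1" using sign_character.eps_sq[OF that, of p] p by simp
    thus ?thesis by (simp add: square_eq_1_iff)
  qed
  from this[OF assms(1)] this[OF assms(2)] have "(\<epsilon>1 p = 1 \<or> \<epsilon>1 p = -1) \<and> (\<epsilon>2 p = 1 \<or> \<epsilon>2 p = -1)" ..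
  \<comment> \<open>If p - 1 is odd the test detects the value 1 instead of -1; since both
    characters take only these two values, this settles -1 as well.\<close>
  ultimately show ?thesis by (cases "even (p - 1)") auto
qed

section \<open>Characters with prescribed signs at the primes, and the cardinality argument\<close>

definition prime_sign :: "nat set \<Rightarrow> nat \<Rightarrow> int" where
  "prime_sign P n = (\<Prod>p\<in>#prime_factorization n. if p \<in> P then -1 else 1)"

lemma sign_character_prime_sign: "sign_character (prime_sign P)"
proof
  show "prime_sign P 1 = 1" by (simp add: prime_sign_def)
  show "prime_sign P (m * n) = prime_sign P m * prime_sign P n" if "m > 0" "n > 0" for m n
    using that by (simp add: prime_sign_def prime_factorization_mult)
  show "prime_sign P n * prime_sign P n = 1" for n
  proof -
    have "prod_mset (image_mset (\<lambda>p. if p \<in> P then -1 else 1) M) * prod_mset (image_mset (\<lambda>p. if p \<in> P then -1 else 1) M) = (1::int)"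
      for M :: "nat multiset" by (induction M) auto
    thus ?thesis by (simp add: prime_sign_def)
  qed
qed

lemma prime_sign_prime: "prime p \<Longrightarrow> prime_sign P p = -1 \<longleftrightarrow> p \<in> P"
  by (simp add: prime_sign_def prime_factorization_prime)

text \<open>Cantor's diagonal: the k-th element of A is put into S exactly when it is missing from
  the k-th set of a supposed enumeration.\<close>

lemma uncountable_Pow:
  assumes "infinite (A :: nat set)"
  shows "\<not> countable (Pow A)"
proof
  assume "countable (Pow A)"
  define S where "S = {enumerate A k |k. enumerate A k \<notin> from_nat_into (Pow A) k}"
  have "S \<in> Pow A" using enumerate_in_set[OF assms] by (auto simp: S_def)
  then obtain k where k: "from_nat_into (Pow A) k = S"
    using from_nat_into_surj[OF \<open>countable (Pow A)\<close>] by blast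
  have "enumerate A k \<in> S \<longleftrightarrow> enumerate A k \<notin> from_nat_into (Pow A) k"
  proof
    assume "enumerate A k \<in> S"
    then obtain j where j: "enumerate A k = enumerate A j" "enumerate A j \<notin> from_nat_into (Pow A) j"
      by (auto simp: S_def)
    moreover have "j = k" using j(1) enumerate_mono_iff[OF assms] by (metis less_irrefl linorder_neqE_nat)
    ultimately show "enumerate A k \<notin> from_nat_into (Pow A) k" by simp
  qed (auto simp: S_def)
  thus False unfolding k by blast
qed

theorem theorem1p1:
  fixes n d :: nat and r :: "nat \<Rightarrow> enat"
  assumes "n \<ge> 1" and "d > 0" and "\<forall>i<n. r i \<ge> 2"
  shows "\<not> countable
    ({lam. filtered_lambda_structure (trunc_ring n r) (trunc_filt n r d) lam} //
     {(l1, l2). filtered_lambda_iso (trunc_ring n r) (trunc_filt n r d) l1 l2})"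
proof
  let ?iso = "{(l1, l2). filtered_lambda_iso (trunc_ring n r) (trunc_filt n r d) l1 l2}"
  let ?Q = "{lam. filtered_lambda_structure (trunc_ring n r) (trunc_filt n r d) lam} // ?iso"
  let ?l = "\<lambda>P. sign_character.trunc_lam (prime_sign P) n r"
  let ?primes = "{p::nat. prime p}"
  assume "countable ?Q"
  moreover have "(\<lambda>P. ?iso `` {?l P}) ` Pow ?primes \<subseteq> ?Q"
  proof (rule image_subsetI)
    fix P
    show "?iso `` {?l P} \<in> ?Q"
      using sign_character.filtered_lambda_structure_trunc_lam[OF sign_character_prime_sign assms(3)]
      by (intro quotientI) simp
  qed
  ultimately have "countable ((\<lambda>P. ?iso `` {?l P}) ` Pow ?primes)" by (rule countable_subset[rotated])
  moreover have "inj_on (\<lambda>P. ?iso `` {?l P}) (Pow ?primes)"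
  proof (rule inj_onI)
    fix P P' assume P: "P \<in> Pow ?primes" "P' \<in> Pow ?primes" and eq: "?iso `` {?l P} = ?iso `` {?l P'}"
    have "filtered_lambda_iso (trunc_ring n r) (trunc_filt n r d) l l" for l
      unfolding filtered_lambda_iso_def by (intro exI[of _ id]) (simp add: ring_iso_set_refl)
    \<comment> \<open>Reflexivity places \<open>?l P'\<close> in its own class, which by assumption
      is the class of \<open>?l P\<close>.\<close>
    hence "?l P' \<in> ?iso `` {?l P}" unfolding eq by simp
    hence "filtered_lambda_iso (trunc_ring n r) (trunc_filt n r d) (?l P) (?l P')" by simp
    hence "prime_sign P p = -1 \<longleftrightarrow> prime_sign P' p = -1" if "prime p" for p
      using assms prime_ge_1_nat[OF that]
      by (intro sign_eq_if_filtered_lambda_iso[OF sign_character_prime_sign sign_character_prime_sign])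
    thus "P = P'" using P by (auto simp: prime_sign_prime)
  qed
  ultimately have "countable (Pow ?primes)" by (rule countable_image_inj_on)
  thus False using uncountable_Pow[OF primes_infinite] by blast
qed

end
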